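(* Among the $79$ relevant unweighted small-step quadrant models (counted up to reflection in the main diagonal), exactly $13$ are decoupled: the four models $\{(1,1),(-1,0),(0,-1)\}$ (Kreweras), $\{(-1,-1),(1,0),(0,1)\}$ (reverse Kreweras), $\{(1,1),(-1,0),(0,-1),(-1,-1),(1,0),(0,1)\}$ (double Kreweras), $\{(1,0),(1,1),(-1,0),(-1,-1)\}$ (Gessel), and the nine models $\#1=\{(0,1),(1,0),(-1,0),(-1,-1)\}$, $\#2=\{(0,1),(1,0),(-1,1),(-1,-1)\}$, $\#3=\{(0,1),(1,1),(0,-1),(-1,0)\}$, $\#4=\{(0,1),(1,0),(1,-1),(-1,0)\}$, $\#5=\{(0,1),(1,0),(1,1),(-1,-1),(-1,0)\}$, $\#6=\{(0,1),(0,-1),(1,1),(-1,-1),(-1,0)\}$, $\#7=\{(-1,1),(-1,0),(1,0),(-1,-1),(0,1)\}$, $\#8=\{(1,1),(0,-1),(1,0),(-1,0),(0,1)\}$, $\#9=\{(1,0),(0,-1),(0,1),(-1,1),(1,-1)\}$. Moreover, the following four weighted models are also decoupled (weights given as $(i,j)\!:\!w_{i,j}$): (W1) $(-1,0)\!:\!1,(-1,-1)\!:\!1,(0,-1)\!:\!\lambda,(1,-1)\!:\!1,(1,0)\!:\!2,(1,1)\!:\!1$; (W2) $(-1,0)\!:\!1,(-1,1)\!:\!1,(0,1)\!:\!2,(1,1)\!:\!1,(1,0)\!:\!2,(1,-1)\!:\!1,(0,-1)\!:\!1$; (W3) $(-1,0)\!:\!2,(-1,1)\!:\!1,(0,1)\!:\!1,(-1,-1)\!:\!1,(1,0)\!:\!1,(1,-1)\!:\!1,(0,-1)\!:\!2$;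 (W4) $(-1,0)\!:\!2,(-1,1)\!:\!1,(0,1)\!:\!2,(1,1)\!:\!1,(1,0)\!:\!1,(0,-1)\!:\!1,(-1,-1)\!:\!1$.
   Context: A (small-step) quadrant model is a set $\mathcal S\subseteq\{-1,0,1\}^2\setminus\{(0,0)\}$, possibly with weights $w_{i,j}$ on its steps (all equal to $1$ for unweighted models). The $79$ relevant models are the unweighted step sets of the classification of Bousquet-Mélou and Mishna, i.e. those for which the quadrant counting problem is not trivial nor equivalent to a simpler (half-plane or one-dimensional) problem, counted up to reflection in the line $x=y$. The kernel is $K(x,y)=xy\big(t\sum_{(i,j)\in\mathcal S}w_{i,j}x^iy^j-1\big)$. A model is decoupled if there exist rational functions $F(x)\in\mathbb{Q}(x,t)$ and $G(y)\in\mathbb{Q}(y,t)$ such that the numerator of $F(x)+G(y)-xy$, written as an irreducible fraction, is divisible by $K(x,y)$ (equivalently $xy=F(x)+G(y)$ whenever $K(x,y)=0$). *)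

theory Defs
  imports "HOL-Computational_Algebra.Computational_Algebra"
begin

type_synonym step = "int \<times> int"

definition small_steps :: "step set" where
  "small_steps = {-1, 0, 1} \<times> {-1, 0, 1} - {(0, 0)}"


(* A walk is the list of its steps; it starts at the origin. *)

definition endpoint :: "step list \<Rightarrow> int \<times> int" where
  "endpoint ws = (sum_list (map fst ws), sum_list (map snd ws))"

definition walks_in :: "(int \<times> int) set \<Rightarrow> step set \<Rightarrow> step list set" where
  "walks_in C S = {ws. set ws \<subseteq> S \<and> (\<forall>n\<le>length ws. endpoint (take n ws) \<in> C)}"

definition right_half_plane :: "(int \<times> int) set" where
  "right_half_plane = {(a, b). a \<ge> 0}"

definition upper_half_plane :: "(int \<times> int) set" where
  "upper_half_plane = {(a, b). b \<ge> 0}"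

definition quadrant :: "(int \<times> int) set" where
  "quadrant = right_half_plane \<inter> upper_half_plane"

definition used_steps :: "step set \<Rightarrow> step set" where
  "used_steps S = (\<Union>ws \<in> walks_in quadrant S. set ws)"

(* A model is trivial or equivalent to a half-plane or one-dimensional problem if, once the steps
   that no quadrant walk can use are discarded, one of the two positivity constraints implies the
   other. This covers all the cases discarded by Bousquet-Melou and Mishna: step sets without a
   step in one of the four directions x+, x-, y+, y- (without x+, for instance, the steps with
   i = -1 are never used and the constraint on x is void); step sets contained in {i <= j} or in
   {j <= i}; and those contained in {i + j <= 0}, for which no step is ever used. *)

definition simpler_problem :: "step set \<Rightarrow> bool" where
  "simpler_problem S \<longleftrightarrow>
     walks_in quadrant S = walks_in right_half_plane (used_steps S) \<or>
     walks_in quadrant S = walks_in upper_half_plane (used_steps S)"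

definition relevant :: "step set \<Rightarrow> bool" where
  "relevant S \<longleftrightarrow> S \<subseteq> small_steps \<and> \<not> simpler_problem S"

definition reflection_class :: "step set \<Rightarrow> step set set" where
  "reflection_class S = {S, prod.swap ` S}"


(* k[x,y,t] is represented as k[t][x][y]: in 'k poly poly poly the innermost variable is t and the
   outermost one is y. The field k(x,y,t) is its fraction field. *)

definition const3 :: "'k::field_char_0 \<Rightarrow> 'k poly poly poly" where
  "const3 c = [:[:[:c:]:]:]"

definition var_t :: "'k::field_char_0 poly poly poly" where
  "var_t = [:[:[:0, 1:]:]:]"

definition var_x :: "'k::field_char_0 poly poly poly" where
  "var_x = [:[:0, 1:]:]"

definition var_y :: "'k::field_char_0 poly poly poly" where
  "var_y = [:0, 1:]"

(* The subfield k(x,t) of k(x,y,t). *)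
definition rational_functions_x :: "'k::field_char_0 poly poly poly fract set" where
  "rational_functions_x = {Fract [:p:] [:q:] | p q :: 'k poly poly. q \<noteq> 0}"

(* The subfield k(y,t): here p and q lie in k[t][y], and map_poly makes each coefficient in k[t]
   a constant polynomial in x. *)
definition rational_functions_y :: "'k::field_char_0 poly poly poly fract set" where
  "rational_functions_y =
     {Fract (map_poly (\<lambda>c. [:c:]) p) (map_poly (\<lambda>c. [:c:]) q) | p q :: 'k poly poly. q \<noteq> 0}"

(* A weighted model is given by its weight function; a weight 0 means that the step is absent.
   The factor xy of the kernel is distributed over the sum so that all exponents are
   nonnegative. *)
definition kernel :: "(step \<Rightarrow> 'k::field_char_0) \<Rightarrow> 'k poly poly poly" where
  "kernel w =
     var_t * (\<Sum>(i, j)\<in>small_steps. const3 (w (i, j)) * var_x ^ nat (i + 1) * var_y ^ nat (j + 1))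
     - var_x * var_y"

(* N / D is the irreducible form of F(x) + G(y) - xy. The coefficient field k of F and G is that
   of the weights; it is the type rat for models with rational weights. *)
definition decoupled :: "(step \<Rightarrow> 'k::field_char_0) \<Rightarrow> bool" where
  "decoupled w \<longleftrightarrow>
     (\<exists>F\<in>rational_functions_x. \<exists>G\<in>rational_functions_y. \<exists>N D.
        D \<noteq> 0 \<and> coprime N D \<and> F + G - Fract (var_x * var_y) 1 = Fract N D \<and> kernel w dvd N)"

definition unweighted :: "step set \<Rightarrow> step \<Rightarrow> rat" where
  "unweighted S s = (if s \<in> S then 1 else 0)"


definition kreweras :: "step set" where
  "kreweras = {(1, 1), (-1, 0), (0, -1)}"

definition reverse_kreweras :: "step set" where
  "reverse_kreweras = {(-1, -1), (1, 0), (0, 1)}"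

definition double_kreweras :: "step set" where
  "double_kreweras = {(1, 1), (-1, 0), (0, -1), (-1, -1), (1, 0), (0, 1)}"

definition gessel :: "step set" where
  "gessel = {(1, 0), (1, 1), (-1, 0), (-1, -1)}"

definition nine_models :: "step set set" where
  "nine_models =
    {{(0, 1), (1, 0), (-1, 0), (-1, -1)},
     {(0, 1), (1, 0), (-1, 1), (-1, -1)},
     {(0, 1), (1, 1), (0, -1), (-1, 0)},
     {(0, 1), (1, 0), (1, -1), (-1, 0)},
     {(0, 1), (1, 0), (1, 1), (-1, -1), (-1, 0)},
     {(0, 1), (0, -1), (1, 1), (-1, -1), (-1, 0)},
     {(-1, 1), (-1, 0), (1, 0), (-1, -1), (0, 1)},
     {(1, 1), (0, -1), (1, 0), (-1, 0), (0, 1)},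
     {(1, 0), (0, -1), (0, 1), (-1, 1), (1, -1)}}"

definition W1 :: "'k::field_char_0 \<Rightarrow> step \<Rightarrow> 'k" where
  "W1 l = (\<lambda>_. 0)((-1, 0) := 1, (-1, -1) := 1, (0, -1) := l, (1, -1) := 1, (1, 0) := 2, (1, 1) := 1)"

definition W2 :: "step \<Rightarrow> rat" where
  "W2 = (\<lambda>_. 0)((-1, 0) := 1, (-1, 1) := 1, (0, 1) := 2, (1, 1) := 1, (1, 0) := 2, (1, -1) := 1,
     (0, -1) := 1)"

definition W3 :: "step \<Rightarrow> rat" where
  "W3 = (\<lambda>_. 0)((-1, 0) := 2, (-1, 1) := 1, (0, 1) := 1, (-1, -1) := 1, (1, 0) := 1, (1, -1) := 1,
     (0, -1) := 2)"

definition W4 :: "step \<Rightarrow> rat" where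
  "W4 = (\<lambda>_. 0)((-1, 0) := 2, (-1, 1) := 1, (0, 1) := 2, (1, 1) := 1, (1, 0) := 1, (0, -1) := 1,
     (-1, -1) := 1)"

end

theory Submission
  imports Defs "HOL-Computational_Algebra.Field_as_Ring"
begin

text \<open>Put \<open>s = 1 / t\<close>, and let the curve \<open>E\<close> be given by \<open>S(x, y) = s\<close>. A decoupling gives, for
  almost every integer \<open>s\<close>, rational functions with \<open>f(x) + g(y) = x y\<close> on \<open>E\<close>. Let \<open>P(n)\<close> be the
  orbit of a pole of \<open>x y\<close> under the two involutions of \<open>E\<close> that fix \<open>x\<close> and \<open>y\<close>, respectively. A
  pole of \<open>f\<close> or \<open>g\<close> at a point of the orbit propagates along it until the next pole of \<open>x y\<close>;
  hence the alternating sum of the polar parts of \<open>x y\<close> along the orbit vanishes. This fails if \<open>x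
  y\<close> has only the few poles near \<open>P(0)\<close> on the orbit, which can be read off the reduction of the
  orbit modulo a suitable prime, where it is a short cycle. The argument does not need to know
  whether the orbit is finite: the involutions change the sign of the invariant differential of
  \<open>E\<close>, so that a return of the orbit to \<open>P(0)\<close> forces an even power of the composition to be the
  identity near \<open>P(0)\<close>. The decoupled models are handled by explicit functions with poles at \<open>0\<close>,
  \<open>-1\<close> and infinity.\<close>

section \<open>Points of the curve over Laurent series\<close>

text \<open>The alternating sum vanishes by cancellation. With \<open>h = x y\<close> and
  \<open>n\<close> even, the points \<open>P(n - 1)\<close> and \<open>P(n)\<close> share
  \<open>y\<close>, so \<open>g\<close> drops out of \<open>h(P(n)) - h(P(n - 1))\<close>; the
  remaining differences of values of \<open>f\<close> telescope, because \<open>P(n)\<close> and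
  \<open>P(n + 1)\<close> share \<open>x\<close>. Points have coordinates in Laurent series: a
  branch of \<open>E\<close> is moved along by the involutions, and polar parts are read off without
  a smooth model or a group law. Reduction is used in one direction only: a coordinate that is 0 or
  infinity stays so modulo \<open>p\<close>. The cycle thus bounds the positions of possible poles,
  while the complex orbit may be infinite. Two possible poles at the same index of the cycle are
  then shown to be the same point. \<open>\<theta>\<close> is a root of the restriction of the curve
  to the axis \<open>x = 0\<close>, after coordinates have been inverted so as to bring poles of
  \<open>x y\<close> to 0. \<open>s\<close> enters a certificate only modulo \<open>p\<close>. One
  certificate thus excludes infinitely many integers \<open>s\<close>, whereas a decoupling can fail
  to specialize at finitely many only.\<close>

definition at0 :: "complex fls \<Rightarrow> complex \<Rightarrow> bool" where
  "at0 z c \<longleftrightarrow> (\<exists>Z. z = fps_to_fls Z \<and> fps_nth Z 0 = c)"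

definition regular :: "complex fls \<Rightarrow> bool" where
  "regular z \<longleftrightarrow> (\<exists>c. at0 z c)"

lemma at0_fps: "at0 (fps_to_fls Z) (fps_nth Z 0)"
  by (auto simp: at0_def)

lemma at0_add: "at0 a c \<Longrightarrow> at0 b d \<Longrightarrow> at0 (a + b) (c + d)"
  unfolding at0_def by (metis fps_to_fls_plus fps_add_nth)

lemma at0_diff: "at0 a c \<Longrightarrow> at0 b d \<Longrightarrow> at0 (a - b) (c - d)"
  unfolding at0_def by (metis fps_to_fls_minus fps_sub_nth)

lemma at0_uminus: "at0 a c \<Longrightarrow> at0 (- a) (- c)"
  unfolding at0_def by (metis fps_to_fls_uminus fps_neg_nth)

lemma at0_mult: "at0 a c \<Longrightarrow> at0 b d \<Longrightarrow> at0 (a * b) (c * d)"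
  unfolding at0_def by (metis fls_times_fps_to_fls fps_mult_nth_0)

lemma at0_of_int: "at0 (of_int n) (of_int n)"
proof -
  have "fps_nth (of_int n :: complex fps) 0 = of_int n"
    by (simp add: fps_of_int[symmetric])
  then show ?thesis
    unfolding at0_def by (metis fps_to_fls_of_int)
qed

lemma at0_0: "at0 0 0" and at0_1: "at0 1 1"
  using at0_of_int[of 0] at0_of_int[of 1] by simp_all

lemma at0_numeral: "at0 (numeral n) (numeral n)"
  using at0_of_int[of "numeral n"] by simp

lemma at0_power: "at0 a c \<Longrightarrow> at0 (a ^ n) (c ^ n)"
  by (induction n) (auto intro: at0_1 at0_mult)

lemma at0_const: "at0 (fls_const c) c"
  using at0_fps[of "fps_const c"] by simp

lemma at0_unique: "at0 a c \<Longrightarrow> at0 a d \<Longrightarrow> c = d"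
  by (auto simp: at0_def)

lemma at0_inverse:
  assumes "at0 a c" "c \<noteq> 0"
  shows "at0 (inverse a) (inverse c)"
proof -
  obtain A where A: "a = fps_to_fls A" "fps_nth A 0 = c"
    using assms by (auto simp: at0_def)
  have "A * inverse A = 1"
    using A assms by (simp add: inverse_mult_eq_1')
  then have "a * fps_to_fls (inverse A) = 1"
    using A by (metis fls_times_fps_to_fls fps_to_fls_eq_1_iff)
  then have "inverse a = fps_to_fls (inverse A)"
    by (metis inverse_unique)
  then show ?thesis
    using A by (auto simp: at0_def)
qed

lemma at0_divide:
  "at0 a c \<Longrightarrow> at0 b d \<Longrightarrow> d \<noteq> 0 \<Longrightarrow> at0 (a / b) (c / d)"
  by (simp add: divide_inverse at0_mult at0_inverse)

lemma regular_add: "regular a \<Longrightarrow> regular b \<Longrightarrow> regular (a + b)"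
  and regular_diff: "regular a \<Longrightarrow> regular b \<Longrightarrow> regular (a - b)"
  and regular_mult: "regular a \<Longrightarrow> regular b \<Longrightarrow> regular (a * b)"
  and regular_uminus: "regular a \<Longrightarrow> regular (- a)"
  unfolding regular_def
  by (blast intro: at0_add at0_diff at0_mult at0_uminus)+

lemma regular_or_inverse:
  assumes "z \<noteq> 0" "\<not> regular z"
  shows "at0 (inverse z) 0"
proof -
  have neg: "fls_subdegree z < 0"
  proof (rule ccontr)
    assume "\<not> fls_subdegree z < 0"
    then have "z = fps_to_fls (fls_regpart z)"
      by (simp add: fls_eq_iff fls_subdegree_ge0I)
    then show False
      using assms(2) at0_fps unfolding regular_def by metis
  qed
  have sub: "fls_subdegree (inverse z) > 0"
    using neg by (simp add: fls_inverse_subdegree)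
  then have "inverse z = fps_to_fls (fls_regpart (inverse z))"
    by (simp add: fls_eq_iff)
  moreover have "fps_nth (fls_regpart (inverse z)) 0 = 0"
    using sub by simp
  ultimately show ?thesis
    unfolding at0_def by blast
qed

lemma inverse_at0_0:
  assumes "z \<noteq> 0" "at0 (inverse z) 0"
  shows "\<not> regular z"
proof
  assume "regular z"
  then obtain c where "at0 z c" by (auto simp: regular_def)
  then have "at0 (z * inverse z) (c * 0)"
    using assms at0_mult by blast
  then show False
    using assms at0_unique[OF at0_1] by fastforce
qed

text \<open>\<^term>\<open>None\<close> stands for the point at infinity of the projective line.\<close>

definition val0 :: "complex fls \<Rightarrow> complex option" where
  "val0 z = (if regular z then Some (THE c. at0 z c) else None)"

lemma val0_Some: "val0 z = Some c \<longleftrightarrow> at0 z c"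
  unfolding val0_def regular_def
  by (auto intro: the_equality at0_unique theI2)

lemma val0_None: "val0 z = None \<longleftrightarrow> \<not> regular z"
  by (simp add: val0_def)

section \<open>Biquadratic curves and their Hamiltonian flow\<close>

type_synonym coefficients = "nat \<Rightarrow> nat \<Rightarrow> int"

text \<open>\<open>K i j\<close> is the coefficient of \<open>x^i y^j\<close>, so this is the
  coefficient of \<open>y^j\<close> in \<open>K(x, y)\<close>.\<close>

definition quad :: "coefficients \<Rightarrow> nat \<Rightarrow> 'a::comm_ring_1 \<Rightarrow> 'a" where
  "quad K j x = of_int (K 0 j) + of_int (K 1 j) * x + of_int (K 2 j) * x\<^sup>2"

definition biquad :: "coefficients \<Rightarrow> 'a \<Rightarrow> 'a \<Rightarrow> 'a::comm_ring_1" where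
  "biquad K x y = quad K 0 x + quad K 1 x * y + quad K 2 x * y\<^sup>2"

definition biquad_y :: "coefficients \<Rightarrow> 'a \<Rightarrow> 'a \<Rightarrow> 'a::comm_ring_1" where
  "biquad_y K x y = quad K 1 x + 2 * quad K 2 x * y"

definition tp :: "coefficients \<Rightarrow> nat \<Rightarrow> nat \<Rightarrow> int" where
  "tp K i j = K j i"

text \<open>The coefficients of \<open>x^2 K(1/x, y)\<close>, the equation in the chart at
  \<open>x = infinity\<close>.\<close>

definition rv :: "coefficients \<Rightarrow> nat \<Rightarrow> nat \<Rightarrow> int" where
  "rv K i j = K (2 - i) j"

lemma tp_tp [simp]: "tp (tp K) = K"
  by (simp add: tp_def fun_eq_iff)

lemma biquad_tp: "biquad (tp K) y x = biquad K x y"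
  by (simp add: biquad_def quad_def tp_def algebra_simps)

text \<open>On the curve the invariant differential is preserved up to sign by the two involutions.
  Dividing the derivation by it turns every point of the curve with coordinates in the field of
  Laurent series into a solution of the same Hamiltonian system, up to the sign of \<open>w\<close>.\<close>

definition flow :: "coefficients \<Rightarrow> complex fls \<Rightarrow> complex fls \<Rightarrow> complex fls \<Rightarrow> bool" where
  "flow K w x y \<longleftrightarrow> biquad K x y = 0 \<and> fls_deriv x = w * biquad_y K x y \<and>
     fls_deriv y = - (w * biquad_y (tp K) y x)"

lemma flow_tp: "flow K w x y \<Longrightarrow> flow (tp K) (- w) y x"
  by (simp add: flow_def biquad_tp)

lemma fls_deriv_inverse_field:
  fixes x :: "complex fls"
  assumes "x \<noteq> 0"
  shows "fls_deriv (inverse x) = - fls_deriv x * (inverse x)\<^sup>2"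
proof -
  have "fls_deriv (x * inverse x) = 0"
    using assms by simp
  then have "fls_deriv x * inverse x + x * fls_deriv (inverse x) = 0"
    by (simp add: add.commute)
  then have "inverse x * (fls_deriv x * inverse x + x * fls_deriv (inverse x)) = 0"
    by simp
  then have "fls_deriv x * (inverse x)\<^sup>2 + (inverse x * x) * fls_deriv (inverse x) = 0"
    by (simp add: algebra_simps power2_eq_square)
  then show ?thesis
    using assms by (simp add: eq_neg_iff_add_eq_0 add.commute)
qed

lemma quad_rv:
  fixes x :: "'a::field"
  assumes "x \<noteq> 0"
  shows "quad (rv K) j (inverse x) = quad K j x * (inverse x)\<^sup>2"
  using assms by (simp add: quad_def rv_def field_simps power2_eq_square)

text \<open>The system keeps its form in the chart \<open>1/x\<close>, with the same
  \<open>w\<close> up to sign; points at infinity are thereby reduced to finite ones.\<close>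

lemma flow_rv:
  assumes "flow K w x y" "x \<noteq> 0"
  shows "flow (rv K) (- w) (inverse x) y"
proof -
  define i where "i = inverse x"
  have ix: "i * x = 1" using assms by (simp add: i_def)
  have q: "quad (rv K) j i = quad K j x * i\<^sup>2" for j
    unfolding i_def by (rule quad_rv[OF assms(2)])
  have K: "biquad K x y = 0" and dx: "fls_deriv x = w * biquad_y K x y"
    and dy: "fls_deriv y = - (w * biquad_y (tp K) y x)"
    using assms by (auto simp: flow_def)
  have "biquad (rv K) i y = biquad K x y * i\<^sup>2"
    unfolding biquad_def q by algebra
  then have 1: "biquad (rv K) i y = 0" using K by simp
  have 2: "fls_deriv i = - w * biquad_y (rv K) i y"
    unfolding i_def fls_deriv_inverse_field[OF assms(2)] dx
    unfolding i_def[symmetric] biquad_y_def q by algebra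
  \<comment> \<open>The derivative of \<open>i^2 K(1/i, y)\<close> with respect to \<open>i\<close>
    is \<open>2 i K - K_x\<close>.\<close>
  have "biquad_y (tp (rv K)) y i = 2 * i * biquad K x y - biquad_y (tp K) y x"
    using ix unfolding biquad_def biquad_y_def quad_def tp_def rv_def by simp algebra
  then have 3: "fls_deriv y = - (- w * biquad_y (tp (rv K)) y i)"
    using dy K by simp
  show ?thesis
    using 1 2 3 unfolding flow_def i_def by simp
qed

section \<open>Uniqueness of formal solutions\<close>

definition agree :: "nat \<Rightarrow> complex fps \<Rightarrow> complex fps \<Rightarrow> bool" where
  "agree n a b \<longleftrightarrow> (\<forall>m<n. fps_nth a m = fps_nth b m)"

lemma agree_refl: "agree n a a"
  and agree_add: "agree n a b \<Longrightarrow> agree n c d \<Longrightarrow> agree n (a + c) (b + d)"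
  and agree_uminus: "agree n a b \<Longrightarrow> agree n (- a) (- b)"
  by (simp_all add: agree_def)

lemma agree_mult: "agree n a b \<Longrightarrow> agree n c d \<Longrightarrow> agree n (a * c) (b * d)"
  by (auto simp: agree_def fps_mult_nth intro!: sum.cong)

lemma agree_biquad_y:
  assumes "agree n X X'" "agree n Y Y'"
  shows "agree n (biquad_y K X Y) (biquad_y K X' Y')"
  unfolding biquad_y_def quad_def power2_eq_square
  by (intro agree_add agree_mult agree_refl assms)

lemma agree_deriv:
  assumes "agree n (fps_deriv X) (fps_deriv X')" "fps_nth X 0 = fps_nth X' 0"
  shows "agree (Suc n) X X'"
  unfolding agree_def
proof (intro allI impI)
  fix m assume "m < Suc n"
  then show "fps_nth X m = fps_nth X' m"
    using assms by (cases m) (auto simp: agree_def simp del: of_nat_Suc)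
qed

lemma fps_to_fls_biquad_y:
  "biquad_y K (fps_to_fls X) (fps_to_fls Y) = fps_to_fls (biquad_y K X Y)"
  by (simp add: biquad_y_def quad_def fls_times_fps_to_fls fps_to_fls_power fps_to_fls_of_int)

text \<open>If the coordinates agree to order \<open>n\<close>, so do the right-hand sides of the
  differential equations, since \<open>w\<close> has no pole. Integration in characteristic 0 then
  gains one order.\<close>

lemma flow_unique_regular:
  assumes "flow K w x y" "flow K w x' y'" "regular w"
    and "at0 x c" "at0 x' c" "at0 y d" "at0 y' d"
  shows "x = x' \<and> y = y'"
proof -
  obtain X X' Y Y' W where
    X: "x = fps_to_fls X" "fps_nth X 0 = c" and X': "x' = fps_to_fls X'" "fps_nth X' 0 = c"
    and Y: "y = fps_to_fls Y" "fps_nth Y 0 = d" and Y': "y' = fps_to_fls Y'" "fps_nth Y' 0 = d"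
    and W: "w = fps_to_fls W"
    using assms(3-) unfolding at0_def regular_def by blast
  have d: "fps_deriv X = W * biquad_y K X Y" "fps_deriv X' = W * biquad_y K X' Y'"
    "fps_deriv Y = - (W * biquad_y (tp K) Y X)" "fps_deriv Y' = - (W * biquad_y (tp K) Y' X')"
    using assms(1,2)
    unfolding flow_def X(1) X'(1) Y(1) Y'(1) W fps_to_fls_biquad_y fls_deriv_fps_to_fls
      fls_times_fps_to_fls[symmetric] fps_to_fls_uminus[symmetric] fps_to_fls_eq_iff
    by blast+
  have "agree n X X' \<and> agree n Y Y'" for n
  proof (induction n)
    case (Suc n)
    then have "agree n (fps_deriv X) (fps_deriv X')" "agree n (fps_deriv Y) (fps_deriv Y')"
      unfolding d by (auto intro!: agree_mult agree_refl agree_biquad_y agree_uminus)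
    then show ?case
      using X X' Y Y' agree_deriv by simp
  qed (simp add: agree_def)
  then have "X = X'" "Y = Y'"
    by (auto simp: agree_def fps_eq_iff)
  then show ?thesis
    using X X' Y Y' by simp
qed

lemma flow_unique_y_regular:
  assumes "flow K w x y" "flow K w x' y'" "regular w"
    and nz: "x \<noteq> 0" "x' \<noteq> 0"
    and "val0 x = val0 x'" "at0 y d" "at0 y' d"
  shows "x = x' \<and> y = y'"
proof (cases "val0 x")
  case (Some c)
  then have "at0 x c" "at0 x' c"
    using assms by (simp_all add: val0_Some[symmetric])
  then show ?thesis
    using flow_unique_regular assms by blast
next
  case None
  then have "\<not> regular x" "\<not> regular x'"
    using assms by (metis val0_None)+
  then have "at0 (inverse x) 0" "at0 (inverse x') 0"
    using nz regular_or_inverse by blast+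
  moreover have "flow (rv K) (- w) (inverse x) y" "flow (rv K) (- w) (inverse x') y'"
    using assms flow_rv by blast+
  ultimately have "inverse x = inverse x' \<and> y = y'"
    using flow_unique_regular assms regular_uminus by blast
  then show ?thesis by (simp add: inverse_eq_iff_eq)
qed

text \<open>The charts \<open>1/x\<close> and \<open>1/y\<close> bring infinite values to 0.
  Coincidence of two series is thus decided by their values in the projective line.\<close>

theorem flow_unique:
  assumes "flow K w x y" "flow K w x' y'" "regular w"
    and nz: "x \<noteq> 0" "x' \<noteq> 0" "y \<noteq> 0" "y' \<noteq> 0"
    and "val0 x = val0 x'" "val0 y = val0 y'"
  shows "x = x' \<and> y = y'"
proof (cases "val0 y")
  case (Some c)
  then have "at0 y c" "at0 y' c"
    using assms by (simp_all add: val0_Some[symmetric])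
  then show ?thesis
    using flow_unique_y_regular assms by blast
next
  case None
  then have "\<not> regular y" "\<not> regular y'"
    using assms by (metis val0_None)+
  then have "at0 (inverse y) 0" "at0 (inverse y') 0"
    using nz regular_or_inverse by blast+
  moreover have "flow (tp (rv (tp K))) (- w) x (inverse y)"
      "flow (tp (rv (tp K))) (- w) x' (inverse y')"
    using flow_tp[OF flow_rv[OF flow_tp[OF assms(1)]]] flow_tp[OF flow_rv[OF flow_tp[OF
      assms(2)]]] nz
    by simp_all
  ultimately have "x = x' \<and> inverse y = inverse y'"
    using flow_unique_y_regular[of "tp (rv (tp K))"] assms regular_uminus by blast
  then show ?thesis by (simp add: inverse_eq_iff_eq)
qed

text \<open>The second root of \<open>K(x, _)\<close>, from the sum of the roots.\<close>

definition other :: "coefficients \<Rightarrow> 'a::field \<Rightarrow> 'a \<Rightarrow> 'a" where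
  "other K x y = - (quad K 1 x / quad K 2 x) - y"

lemma other_other: "other K x (other K x y) = y"
  by (simp add: other_def)

lemma quad_other:
  "quad K 2 x \<noteq> 0 \<Longrightarrow> quad K 2 x * other K x y = - quad K 1 x - quad K 2 x * y"
  by (simp add: other_def field_simps)

lemma fls_deriv_quad: "fls_deriv (quad K j x) = fls_deriv x * (of_int (K 1 j) + 2 * of_int (K 2 j)
  * x)"
  by (simp add: quad_def power2_eq_square algebra_simps)

lemma fls_deriv_biquad:
  "fls_deriv (biquad K x y) = fls_deriv x * biquad_y (tp K) y x + fls_deriv y * biquad_y K x y"
  unfolding biquad_def power2_eq_square
  by (simp add: fls_deriv_quad biquad_y_def) (simp add: quad_def tp_def algebra_simps
    power2_eq_square)

lemma biquad_other:
  assumes "biquad K x y = 0" "quad K 2 x \<noteq> 0"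
  shows "biquad K x (other K x y) = 0"
proof -
  let ?z = "other K x y"
  have z: "quad K 2 x * ?z = - quad K 1 x - quad K 2 x * y"
    using quad_other assms by blast
  have "biquad K x ?z = quad K 0 x + ?z * (quad K 1 x + quad K 2 x * ?z)"
    by (simp add: biquad_def algebra_simps power2_eq_square)
  also have "quad K 1 x + quad K 2 x * ?z = - (quad K 2 x * y)"
    unfolding z by simp
  also have "quad K 0 x + ?z * - (quad K 2 x * y) = quad K 0 x - (quad K 2 x * ?z) * y"
    by (simp add: algebra_simps)
  also have "\<dots> = biquad K x y"
    unfolding z by (simp add: biquad_def algebra_simps power2_eq_square)
  finally show ?thesis using assms by simp
qed

text \<open>\<open>K_y\<close> takes opposite values at the two roots of a quadratic, hence the sign
  of \<open>w\<close>. The equation for the new \<open>y\<close> comes from differentiating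
  \<open>K = 0\<close> along the branch.\<close>

lemma flow_step:
  assumes fl: "flow K w x y" and nz: "quad K 2 x \<noteq> 0" "fls_deriv x \<noteq> 0"
  shows "flow K (- w) x (other K x y)"
proof -
  let ?z = "other K x y"
  have z: "quad K 2 x * ?z = - quad K 1 x - quad K 2 x * y"
    using quad_other nz by blast
  have neg: "biquad_y K x ?z = - biquad_y K x y"
    using z unfolding biquad_y_def by algebra
  have dx: "fls_deriv x = - w * biquad_y K x ?z"
    using fl by (simp add: flow_def neg)
  have K: "biquad K x ?z = 0"
    by (rule biquad_other) (use fl nz in \<open>simp_all add: flow_def\<close>)
  have "0 = fls_deriv (biquad K x ?z)"
    by (simp add: K)
  also have "\<dots> = (fls_deriv ?z - w * biquad_y (tp K) ?z x) * biquad_y K x ?z"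
    unfolding fls_deriv_biquad dx by (simp add: algebra_simps)
  \<comment> \<open>The factor \<open>biquad_y K x ?z\<close> may be cancelled: it divides
    \<open>fls_deriv x\<close>, which is nonzero.\<close>
  finally have "fls_deriv ?z = w * biquad_y (tp K) ?z x"
    using dx nz(2) by auto
  then show ?thesis
    using dx K by (simp add: flow_def)
qed

section \<open>Poles along an orbit\<close>

text \<open>Positions of equal parity carry distinct points here. As \<open>h\<close> is regular
  from position 3 on, a pole of \<open>f\<close> at \<open>x 2\<close> would be passed on to all
  later points, and infinitely many pairs of values would lie in the finite set
  \<open>A \<times> B\<close>.\<close>

lemma regular_at_right_end:
  fixes x y h :: "int \<Rightarrow> complex fls"
  assumes shx: "\<And>n. even n \<Longrightarrow> x (n + 1) = x n" and shy: "\<And>n. odd n \<Longrightarrow> y (n + 1) = y n"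
    and sum: "\<And>n. f (x n) + g (y n) = h n"
    and fin: "finite A" "finite B"
    and fA: "\<And>n. val0 (x n) \<notin> A \<Longrightarrow> regular (f (x n))"
    and gB: "\<And>n. val0 (y n) \<notin> B \<Longrightarrow> regular (g (y n))"
    and reg: "\<And>n. n \<ge> 3 \<Longrightarrow> regular (h n)"
    and inj: "\<And>n m. even (n - m) \<Longrightarrow> val0 (x n) = val0 (x m) \<Longrightarrow>
      val0 (y n) = val0 (y m) \<Longrightarrow> n = m"
  shows "regular (f (x 2))"
proof (rule ccontr)
  assume nr: "\<not> regular (f (x 2))"
  have g_of_f: "\<not> regular (g (y n))" if "\<not> regular (f (x n))" "n \<ge> 3" for n
    using that regular_diff[OF reg[of n], of "g (y n)"] sum[of n, symmetric] by auto
  have f_of_g: "\<not> regular (f (x n))" if "\<not> regular (g (y n))" "n \<ge> 3" for n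
    using that regular_diff[OF reg[of n], of "f (x n)"] sum[of n, symmetric] by auto
  have all: "\<not> regular (f (x (2 + 2 * int k)))" for k
  proof (induction k)
    case (Suc k)
    let ?n = "2 + 2 * int k"
    have "\<not> regular (f (x (?n + 1)))"
      using Suc shx[of ?n] by simp
    then have "\<not> regular (g (y (?n + 1)))"
      using g_of_f by simp
    then have "\<not> regular (g (y (?n + 1 + 1)))"
      by (subst shy) auto
    then have "\<not> regular (f (x (?n + 1 + 1)))"
      using f_of_g by simp
    then show ?case by (simp add: add.commute)
  qed (use nr in simp)
  define F where "F k = (val0 (x (4 + 2 * int k)), val0 (y (4 + 2 * int k)))" for k
  have "F k \<in> A \<times> B" for k
    using all[of "Suc k"] g_of_f[of "4 + 2 * int k"] fA gB unfolding F_def by auto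
  then have "finite (range F)"
    using fin by (meson finite_SigmaI finite_subset image_subsetI)
  moreover have "inj F"
  proof (rule injI)
    fix k l assume "F k = F l"
    then have "4 + 2 * int k = 4 + 2 * int l"
      unfolding F_def by (intro inj) auto
    then show "k = l" by simp
  qed
  ultimately show False
    using finite_imageD by blast
qed

text \<open>The values \<open>f (x (2 * j))\<close> change by regular amounts away from the four positions. If the
  orbit is periodic, this goes once around it; otherwise a pole of \<open>f\<close> or \<open>g\<close> would propagate to
  infinitely many points.\<close>

theorem regular_across_poles:
  fixes x y h :: "int \<Rightarrow> complex fls"
  assumes shx: "\<And>n. even n \<Longrightarrow> x (n + 1) = x n" and shy: "\<And>n. odd n \<Longrightarrow> y (n + 1) = y n"
    and sum: "\<And>n. f (x n) + g (y n) = h n"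
    and fin: "finite A" "finite B"
    and fA: "\<And>n. val0 (x n) \<notin> A \<Longrightarrow> regular (f (x n))"
    and gB: "\<And>n. val0 (y n) \<notin> B \<Longrightarrow> regular (g (y n))"
    and uniq: "\<And>n m. even (n - m) \<Longrightarrow> val0 (x n) = val0 (x m) \<Longrightarrow>
      val0 (y n) = val0 (y m) \<Longrightarrow> x n = x m \<and> y n = y m"
    and shift: "\<And>n m i. even (n - m) \<Longrightarrow> x n = x m \<Longrightarrow> y n = y m \<Longrightarrow>
      x (n + i) = x (m + i) \<and> y (n + i) = y (m + i)"
    and poles: "\<And>n. \<not> regular (h n) \<Longrightarrow>
      \<exists>i\<in>{-1, 0, 1, 2}. even (n - i) \<and> x n = x i \<and> y n = y i"
    and ne: "\<not> (x 2 = x 0 \<and> y 2 = y 0)"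
  shows "regular (h 0 - h (-1) + h 2 - h 1)"
proof -
  define per where "per M \<longleftrightarrow> 0 < M \<and> even M \<and> x M = x 0 \<and> y M = y 0" for M :: int
  have perI: "per \<bar>n - m\<bar>" if "even (n - m)" "n \<noteq> m" "x n = x m" "y n = y m" for n m
  proof (cases "n > m")
    case True
    then show ?thesis
      using that shift[of n m "- m"] by (auto simp: per_def)
  next
    case False
    then show ?thesis
      using that shift[of m n "- n"] by (auto simp: per_def)
  qed
  have fx: "f (x (n + 1)) = f (x n)" if "even n" for n
    using shx that by simp
  have dif: "f (x (n + 1)) - f (x (n - 1)) = h (n + 1) - h n" if "odd n" for n
    using sum[of n, symmetric] sum[of "n + 1", symmetric] shy[OF that] shx[of "n - 1"] that by simp
  have tot: "h 0 - h (-1) + h 2 - h 1 = f (x 2) - f (x (-2))"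
  proof -
    have "h 0 - h (-1) + h 2 - h 1 = (h 0 - h (-1)) + (h 2 - h 1)" by simp
    also have "\<dots> = (f (x 0) - f (x (-2))) + (f (x 2) - f (x 0))"
      using dif[of "-1", symmetric] dif[of 1, symmetric] by simp
    finally show ?thesis by simp
  qed
  show ?thesis
  proof (cases "\<exists>M. per M")
    case False
    have inj: "n = m" if "even (n - m)" "val0 (x n) = val0 (x m)"
        "val0 (y n) = val0 (y m)" for n m
      using perI uniq that False by blast
    have reg: "regular (h n)" if "n \<notin> {-1, 0, 1, 2}" for n
      using poles perI False that by blast
    have "regular (f (x 2))"
    proof (rule regular_at_right_end[of x y f g h A B])
      show "regular (h n)" if "n \<ge> 3" for n
        using that by (intro reg) auto
    qed (fact shx shy sum fin fA gB inj)+
    \<comment> \<open>The reversal \<open>n\<close> to \<open>1 - n\<close> preserves the pattern of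
      shared coordinates and permutes the positions \<open>-1, 0, 1, 2\<close>; moreover
      \<open>x (-1) = x (-2)\<close>.\<close>
    moreover have "regular (f (x (1 - 2)))"
    proof (rule regular_at_right_end[of "\<lambda>n. x (1 - n)" "\<lambda>n. y (1 - n)" f g "\<lambda>n. h (1 - n)" A B])
      show "x (1 - (n + 1)) = x (1 - n)" if "even n" for n
        using shx[of "- n"] that by (simp add: add.commute)
      show "y (1 - (n + 1)) = y (1 - n)" if "odd n" for n
        using shy[of "- n"] that by (simp add: add.commute)
      show "n = m" if "even (n - m)" "val0 (x (1 - n)) = val0 (x (1 - m))"
        "val0 (y (1 - n)) = val0 (y (1 - m))" for n m
        using inj[of "1 - n" "1 - m"] that by simp
      show "regular (h (1 - n))" if "n \<ge> 3" for n
        using that by (intro reg) auto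
    qed (fact sum fin fA gB)+
    ultimately show ?thesis
      unfolding tot using fx[of "-2"] regular_diff by simp
  next
    case True
    then obtain M0 where M0: "per M0" by blast
    define m where "m = (LEAST k. per (int k))"
    have ex: "per (int (nat M0))"
      using M0 by (simp add: per_def)
    have "per (int m)"
      unfolding m_def using ex by (rule LeastI)
    have least: "int m \<le> k" if "per k" for k
    proof -
      have "per (int (nat k))" using that by (simp add: per_def)
      then have "m \<le> nat k" unfolding m_def by (rule Least_le)
      moreover have "0 < k" using that by (simp add: per_def)
      ultimately show ?thesis by linarith
    qed
    have m: "even m" "m > 2"
    proof -
      show "even m" using \<open>per (int m)\<close> by (simp add: per_def)
      moreover have "m \<noteq> 2" "m > 0"
        using \<open>per (int m)\<close> ne by (auto simp: per_def)
      moreover have "m \<noteq> 1" using \<open>even m\<close> by auto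
      ultimately show "m > 2" by linarith
    qed
    \<comment> \<open>The distance of such an \<open>n\<close> from each of the four positions is
      positive and less than the least period.\<close>
    have reg: "regular (h n)" if "3 \<le> n" "n \<le> int m - 2" for n
    proof (rule ccontr)
      assume "\<not> regular (h n)"
      then obtain i where i: "i \<in> {-1, 0, 1, 2}" "even (n - i)" "x n = x i" "y n = y i"
        using poles by blast
      have "n \<noteq> i" using i(1) that by auto
      with i have "per \<bar>n - i\<bar>"
        by (intro perI) auto
      then have "int m \<le> \<bar>n - i\<bar>" by (rule least)
      then have "n = int m - 2" "i = -1" using i that m by auto
      then show False using i m by simp
    qed
    have stepreg: "regular (f (x (2 + 2 * int k)) - f (x 2))" if "2 + 2 * int k \<le> int m - 2" for k
      using that
    proof (induction k)
      case 0
      then show ?case using at0_0 by (auto simp: regular_def)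
    next
      case (Suc k)
      have "f (x (2 + 2 * int (Suc k))) - f (x (2 + 2 * int k))
          = h (2 + 2 * int (Suc k)) - h (2 + 2 * int (Suc k) - 1)"
        using dif[of "2 + 2 * int (Suc k) - 1"] by (simp add: algebra_simps)
      moreover have "regular \<dots>"
        using Suc.prems by (intro regular_diff reg) auto
      ultimately have "regular (f (x (2 + 2 * int (Suc k))) - f (x (2 + 2 * int k)))"
        by simp
      from regular_add[OF this Suc.IH] Suc.prems show ?case
        by (simp add: algebra_simps)
    qed
    obtain q where q: "m = 4 + 2 * q"
    proof -
      from m obtain q' where "m = 2 * q'" by blast
      with m that[of "q' - 2"] show ?thesis by simp
    qed
    \<comment> \<open>Positions \<open>m - 2\<close> and \<open>-2\<close> carry the same point,
      which closes the way around.\<close>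
    have "x (int m + (-2)) = x (0 + (-2))"
      using shift[of "int m" 0 "-2"] \<open>per (int m)\<close> by (simp add: per_def)
    then have "regular (f (x (-2)) - f (x 2))"
      using stepreg[of q] q by simp
    from regular_uminus[OF this] show ?thesis
      unfolding tot by simp
  qed
qed

section \<open>Reduction modulo a prime\<close>

locale reduction =
  fixes \<theta> :: complex and e r p :: int
  assumes theta: "\<theta>\<^sup>2 = - of_int e * \<theta> - 1" and Im_theta: "Im \<theta> \<noteq> 0"
    and prime_p: "prime p" and root_mod: "p dvd r\<^sup>2 + e * r + 1"
begin

text \<open>Reduction modulo a prime ideal of \<open>\<int>[\<theta>]\<close> above \<open>p\<close>.\<close>

definition red :: "complex \<Rightarrow> int \<Rightarrow> bool" where
  "red z c \<longleftrightarrow> (\<exists>a b. z = of_int a + of_int b * \<theta> \<and> p dvd c - (a + b * r))"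

lemma red_of_int: "red (of_int n) n"
  unfolding red_def by (rule exI[of _ n], rule exI[of _ 0]) simp

lemma red_theta: "red \<theta> r"
  unfolding red_def by (rule exI[of _ 0], rule exI[of _ 1]) simp

lemma red_add: "red z c \<Longrightarrow> red z' c' \<Longrightarrow> red (z + z') (c + c')"
  unfolding red_def
proof (elim exE conjE)
  fix a b a' b' assume *: "z = of_int a + of_int b * \<theta>" "p dvd c - (a + b * r)"
    "z' = of_int a' + of_int b' * \<theta>" "p dvd c' - (a' + b' * r)"
  have "z + z' = of_int (a + a') + of_int (b + b') * \<theta>"
    using * by (simp add: algebra_simps)
  moreover have "c + c' - ((a + a') + (b + b') * r) = c - (a + b * r) + (c' - (a' + b' * r))"
    by (simp add: algebra_simps)
  ultimately show "\<exists>a b. z + z' = of_int a + of_int b * \<theta> \<and> p dvd c + c' - (a + b * r)"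
    using * by (metis dvd_add)
qed

lemma red_mult: "red z c \<Longrightarrow> red z' c' \<Longrightarrow> red (z * z') (c * c')"
  unfolding red_def
proof (elim exE conjE)
  fix a b a' b' assume *: "z = of_int a + of_int b * \<theta>" "p dvd c - (a + b * r)"
    "z' = of_int a' + of_int b' * \<theta>" "p dvd c' - (a' + b' * r)"
  have "z * z' = of_int a * of_int a' + (of_int a * of_int b' + of_int b * of_int a') * \<theta>
      + of_int b * of_int b' * \<theta>\<^sup>2"
    using * by (simp add: algebra_simps power2_eq_square)
  also have "\<dots> = of_int (a * a' - b * b') + of_int (a * b' + b * a' - e * b * b') * \<theta>"
    unfolding theta by (simp add: algebra_simps)
  finally have 1: "z * z' = of_int (a * a' - b * b') + of_int (a * b' + b * a' - e * b * b') * \<theta>" .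
  have "c * c' - ((a * a' - b * b') + (a * b' + b * a' - e * b * b') * r)
      = c * (c' - (a' + b' * r)) + (c - (a + b * r)) * (a' + b' * r) + b * b' * (r\<^sup>2 + e * r + 1)"
    by (simp add: algebra_simps power2_eq_square)
  moreover have "p dvd \<dots>"
    using * root_mod by (meson dvd_add dvd_mult dvd_mult2)
  ultimately show "\<exists>a b. z * z' = of_int a + of_int b * \<theta> \<and> p dvd c * c' - (a + b * r)"
    using 1 by metis
qed

lemma red_uminus: "red z c \<Longrightarrow> red (- z) (- c)"
  using red_mult[OF red_of_int[of "-1"]] by simp

lemma red_diff: "red z c \<Longrightarrow> red z' c' \<Longrightarrow> red (z - z') (c - c')"
  using red_add[OF _ red_uminus] by simp

lemma red_power: "red z c \<Longrightarrow> red (z ^ n) (c ^ n)"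
  by (induction n) (use red_of_int[of 1] red_mult in auto)

lemma red_cong: "red z c \<Longrightarrow> p dvd c - c' \<Longrightarrow> red z c'"
  unfolding red_def
proof (elim exE conjE)
  fix a b assume *: "z = of_int a + of_int b * \<theta>" "p dvd c - (a + b * r)" "p dvd c - c'"
  have "c' - (a + b * r) = c - (a + b * r) - (c - c')" by simp
  then have "p dvd c' - (a + b * r)" using * by (metis dvd_diff)
  then show "\<exists>a b. z = of_int a + of_int b * \<theta> \<and> p dvd c' - (a + b * r)"
    using * by blast
qed

text \<open>As \<open>\<theta>\<close> is not real, 1 and \<open>\<theta>\<close> are linearly
  independent over the integers; this is what makes residues well defined.\<close>

lemma red_0: "red 0 c \<Longrightarrow> p dvd c"
proof -
  assume "red 0 c"
  then obtain a b where ab: "0 = of_int a + of_int b * \<theta>" "p dvd c - (a + b * r)"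
    by (auto simp: red_def)
  have "Im (of_int a + of_int b * \<theta>) = of_int b * Im \<theta>"
    by simp
  then have "of_int b * Im \<theta> = 0"
    using ab(1) by (metis zero_complex.sel(2))
  then have "b = 0" using Im_theta by simp
  then show ?thesis using ab by simp
qed

lemmas red_intros = red_add red_diff red_mult red_uminus red_power red_of_int

text \<open>The value of \<open>z\<close> at the origin, taken in the projective line, reduces to
  the point \<open>a : b\<close> over the field with \<open>p\<close> elements. Writing
  \<open>z\<close> as a quotient \<open>Z / W\<close> treats infinity like any other value.\<close>

definition reduces :: "complex fls \<Rightarrow> int \<Rightarrow> int \<Rightarrow> bool" where
  "reduces z a b \<longleftrightarrow> \<not> (p dvd a \<and> p dvd b) \<and>
     (\<exists>Z W. fps_to_fls Z = z * fps_to_fls W \<and> red (fps_nth Z 0) a \<and> red (fps_nth W 0) b)"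

text \<open>A zero of the series is seen modulo \<open>p\<close>; the converse may fail, so that the
  cycle only gives an upper bound for the set of poles.\<close>

lemma reduces_at0_0:
  assumes "reduces z a b" "at0 z 0"
  shows "p dvd a"
proof -
  obtain Z W where ZW: "fps_to_fls Z = z * fps_to_fls W" "red (fps_nth Z 0) a"
    using assms by (auto simp: reduces_def)
  have "at0 (z * fps_to_fls W) (0 * fps_nth W 0)"
    using assms at0_fps at0_mult by blast
  then have "fps_nth Z 0 = 0"
    using ZW at0_fps[of Z] at0_unique by fastforce
  then show ?thesis using ZW red_0 by simp
qed

lemma reduces_infinite:
  assumes "reduces z a b" "z \<noteq> 0" "\<not> regular z"
  shows "p dvd b"
proof -
  obtain Z W where ZW: "fps_to_fls Z = z * fps_to_fls W" "red (fps_nth W 0) b"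
    using assms by (auto simp: reduces_def)
  have "at0 (inverse z * fps_to_fls Z) (0 * fps_nth Z 0)"
    using assms regular_or_inverse at0_fps at0_mult by blast
  moreover have "inverse z * fps_to_fls Z = fps_to_fls W"
    using ZW assms by (simp add: field_simps)
  ultimately have "fps_nth W 0 = 0"
    using at0_fps[of W] at0_unique by fastforce
  then show ?thesis using ZW red_0 by simp
qed

lemma reduces_at0:
  assumes "at0 z c" "red c a"
  shows "reduces z a 1"
proof -
  obtain Z where "z = fps_to_fls Z" "fps_nth Z 0 = c"
    using assms by (auto simp: at0_def)
  moreover have "\<not> p dvd 1" using prime_p by (meson not_prime_unit)
  ultimately show ?thesis
    unfolding reduces_def using assms red_of_int[of 1]
    by (intro conjI exI[of _ Z] exI[of _ 1]) auto
qed

lemma proportional_mod: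
  assumes "p dvd u * d - v * c" "\<not> (p dvd u \<and> p dvd v)" "\<not> (p dvd c \<and> p dvd d)"
  obtains l where "p dvd l * u - c" "p dvd l * v - d"
proof -
  have inv: "\<exists>k. p dvd k * w - 1" if "\<not> p dvd w" for w
  proof -
    have "coprime w p" using that prime_p by (meson coprime_commute prime_imp_coprime)
    then obtain a b where "a * w + b * p = 1"
      using bezout_int[of w p] by auto
    then have "a * w - 1 = p * (- b)" by (simp add: algebra_simps)
    then show ?thesis by (metis dvd_triv_left)
  qed
  show ?thesis
  proof (cases "p dvd u")
    case False
    then obtain k where k: "p dvd k * u - 1" using inv by blast
    have "k * c * u - c = (k * u - 1) * c" by (simp add: algebra_simps)
    moreover have "k * c * v - d = (k * u - 1) * d - k * (u * d - v * c)"
      by (simp add: algebra_simps)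
    ultimately show ?thesis
      using k assms(1) by (intro that[of "k * c"]) (simp_all only: dvd_diff dvd_mult dvd_mult2)
  next
    case True
    then obtain k where k: "p dvd k * v - 1" using inv assms by blast
    have "k * d * v - d = (k * v - 1) * d" by (simp add: algebra_simps)
    moreover have "k * d * u - c = (k * v - 1) * c + k * (u * d - v * c)"
      by (simp add: algebra_simps)
    ultimately show ?thesis
      using k assms(1) by (intro that[of "k * d"]) (simp_all only: dvd_add dvd_mult dvd_mult2)
  qed
qed

text \<open>Homogeneous coordinates are determined up to a factor only. Rescaling \<open>Z\<close>
  and \<open>W\<close> by an integer yields the prescribed representative
  \<open>c : d\<close>.\<close>

lemma reducesI:
  assumes "fps_to_fls Z = z * fps_to_fls W" "red (fps_nth Z 0) u" "red (fps_nth W 0) v"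
    and "p dvd u * d - v * c" "\<not> (p dvd u \<and> p dvd v)" "\<not> (p dvd c \<and> p dvd d)"
  shows "reduces z c d"
proof -
  obtain l where l: "p dvd l * u - c" "p dvd l * v - d"
    using proportional_mod assms by blast
  have "fps_to_fls (of_int l * Z) = z * fps_to_fls (of_int l * W)"
    using assms(1) by (simp add: fls_times_fps_to_fls)
  moreover have "red (fps_nth (of_int l * Z) 0) c" "red (fps_nth (of_int l * W) 0) d"
    using red_cong[OF red_mult[OF red_of_int[of l] assms(2)] l(1)]
      red_cong[OF red_mult[OF red_of_int[of l] assms(3)] l(2)]
    by (simp_all flip: fps_of_int)
  ultimately show ?thesis
    using assms(6) unfolding reduces_def by blast
qed

end

section \<open>Conjugate roots in homogeneous coordinates\<close>

definition hquad :: "coefficients \<Rightarrow> nat \<Rightarrow> 'a \<Rightarrow> 'a \<Rightarrow> 'a::comm_ring_1" where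
  "hquad K j a v = of_int (K 0 j) * v\<^sup>2 + of_int (K 1 j) * a * v + of_int (K 2 j) * a\<^sup>2"

lemma hquad_eq: "hquad K j (x * v) v = quad K j x * v\<^sup>2"
  by (simp add: hquad_def quad_def algebra_simps power2_eq_square)

text \<open>The homogeneous coordinates of the root conjugate to \<open>c : d\<close>. The two formulas agree where
  both are defined; the first is used at finite points and the second at infinity.\<close>

definition conj1 :: "coefficients \<Rightarrow> 'a \<Rightarrow> 'a \<Rightarrow> 'a \<Rightarrow> 'a \<Rightarrow> 'a::comm_ring_1 \<times> 'a" where
  "conj1 K a v c d = (- (hquad K 1 a v * d + hquad K 2 a v * c), hquad K 2 a v * d)"

definition conj2 :: "coefficients \<Rightarrow> 'a \<Rightarrow> 'a \<Rightarrow> 'a \<Rightarrow> 'a \<Rightarrow> 'a::comm_ring_1 \<times> 'a" where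
  "conj2 K a v c d = (hquad K 0 a v * c, - (hquad K 1 a v * c + hquad K 0 a v * d))"

text \<open>The comparison by a determinant lets a certificate list any representative of a
  projective point.\<close>

definition conj_ok :: "coefficients \<Rightarrow> int \<Rightarrow> int \<Rightarrow> int \<Rightarrow> int \<Rightarrow> int \<Rightarrow> int \<Rightarrow> int \<Rightarrow> bool" where
  "conj_ok K p a v c d c' d' \<longleftrightarrow> \<not> (p dvd c' \<and> p dvd d') \<and>
     (case (if p dvd d then conj2 K a v c d else conj1 K a v c d) of
       (u, w) \<Rightarrow> p dvd u * d' - w * c' \<and> \<not> (p dvd u \<and> p dvd w))"

lemma conj1_other:
  assumes "quad K 2 x \<noteq> 0" "X = x * V" "Y = y * W" "conj1 K X V Y W = (U, T)"
  shows "U = other K x y * T"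
proof -
  define z where "z = other K x y"
  have z: "quad K 2 x * z = - quad K 1 x - quad K 2 x * y"
    unfolding z_def using quad_other assms(1) by blast
  have "U = (- quad K 1 x - quad K 2 x * y) * (V\<^sup>2 * W)" "T = quad K 2 x * (V\<^sup>2 * W)"
    using assms(4) unfolding assms(2,3) conj1_def hquad_eq prod.inject
    by (simp_all add: algebra_simps flip: minus_mult_left)
  then show ?thesis
    unfolding z[symmetric] z_def[symmetric] by (simp add: mult_ac)
qed

text \<open>This is the product of the roots: on the curve \<open>-(q1 y + q0) = q2 y^2\<close>,
  where \<open>qj\<close> is the value of \<open>quad K j\<close>, so that the pair represents
  \<open>q0 / (q2 y)\<close>.\<close>

lemma conj2_other:
  assumes "quad K 2 x \<noteq> 0" "biquad K x y = 0" "X = x * V" "Y = y * W" "conj2 K X V Y W = (U, T)"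
  shows "U = other K x y * T"
proof -
  define z where "z = other K x y"
  have z: "quad K 2 x * z = - quad K 1 x - quad K 2 x * y"
    unfolding z_def using quad_other assms(1) by blast
  have "quad K 0 x = - (quad K 1 x + quad K 2 x * y) * y"
    using assms(2) unfolding biquad_def
    by (simp add: eq_neg_iff_add_eq_0 algebra_simps power2_eq_square)
  also have "quad K 1 x + quad K 2 x * y = - (quad K 2 x * z)"
    unfolding z by simp
  finally have c: "quad K 0 x = quad K 2 x * z * y" by simp
  have q1: "quad K 1 x = - (quad K 2 x * z) - quad K 2 x * y"
    unfolding z by simp
  have b: "quad K 1 x * y + quad K 0 x = - (quad K 2 x * y * y)"
    by (simp only: q1 c) (simp add: algebra_simps)
  have U: "U = quad K 0 x * (V\<^sup>2 * (y * W))"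
    and T: "T = - (quad K 1 x * y + quad K 0 x) * (V\<^sup>2 * W)"
    using assms(5) unfolding assms(3,4) conj2_def hquad_eq prod.inject
    by (simp_all add: algebra_simps)
  show ?thesis
    unfolding U T[unfolded b] unfolding c z_def[symmetric] by (simp add: mult_ac)
qed

context reduction begin

lemma red_hquad:
  "red a c \<Longrightarrow> red v d \<Longrightarrow> red (hquad K j a v) (hquad K j c d)"
  unfolding hquad_def of_int_eq_id id_apply by (intro red_intros)

lemma reduces_other:
  assumes "quad K 2 x \<noteq> 0" "biquad K x y = 0" "reduces x a v" "reduces y c d"
    and ok: "conj_ok K p a v c d c' d'"
  shows "reduces (other K x y) c' d'"
proof -
  obtain X V where X: "fps_to_fls X = x * fps_to_fls V" "red (fps_nth X 0) a" "red (fps_nth V 0) v"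
    using assms(3) by (auto simp: reduces_def)
  obtain Y W where Y: "fps_to_fls Y = y * fps_to_fls W" "red (fps_nth Y 0) c" "red (fps_nth W 0) d"
    using assms(4) by (auto simp: reduces_def)
  have hq: "fps_to_fls (hquad K j X V) = hquad K j (fps_to_fls X) (fps_to_fls V)" for j
    by (simp add: hquad_def fls_times_fps_to_fls fps_to_fls_power fps_to_fls_of_int)
  have hq0: "fps_nth (hquad K j X V) 0 = hquad K j (fps_nth X 0) (fps_nth V 0)" for j
    by (simp add: hquad_def fps_power_zeroth flip: fps_of_int)
  show ?thesis
  proof (cases "p dvd d")
    case False
    show ?thesis
    proof (rule reducesI)
      show "fps_to_fls (- (hquad K 1 X V * W + hquad K 2 X V * Y))
          = other K x y * fps_to_fls (hquad K 2 X V * W)"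
        by (rule conj1_other[OF assms(1) X(1) Y(1)])
          (simp add: conj1_def hq fls_times_fps_to_fls)
      show "red (fps_nth (- (hquad K 1 X V * W + hquad K 2 X V * Y)) 0)
          (- (hquad K 1 a v * d + hquad K 2 a v * c))"
        "red (fps_nth (hquad K 2 X V * W) 0) (hquad K 2 a v * d)"
        using X Y by (auto simp: hq0 simp del: minus_add_distrib intro!: red_intros red_hquad)
    qed (use ok False in \<open>auto simp: conj_ok_def conj1_def\<close>)
  next
    case True
    show ?thesis
    proof (rule reducesI)
      show "fps_to_fls (hquad K 0 X V * Y)
          = other K x y * fps_to_fls (- (hquad K 1 X V * Y + hquad K 0 X V * W))"
        by (rule conj2_other[OF assms(1,2) X(1) Y(1)])
          (simp add: conj2_def hq fls_times_fps_to_fls)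
      show "red (fps_nth (hquad K 0 X V * Y) 0) (hquad K 0 a v * c)"
        "red (fps_nth (- (hquad K 1 X V * Y + hquad K 0 X V * W)) 0)
          (- (hquad K 1 a v * c + hquad K 0 a v * d))"
        using X Y by (auto simp: hq0 simp del: minus_add_distrib intro!: red_intros red_hquad)
    qed (use ok True in \<open>auto simp: conj_ok_def conj2_def\<close>)
  qed
qed

end

section \<open>Nondegeneracy, and the points on the axis\<close>

lemma quad_at0_0:
  "at0 x 0 \<Longrightarrow> at0 (quad K j x) (of_int (K 0 j))"
  using at0_add[OF at0_add[OF at0_of_int[of "K 0 j"]
      at0_mult[OF at0_of_int[of "K 1 j"]]]
      at0_mult[OF at0_of_int[of "K 2 j"] at0_power[of _ _ 2]], of x 0 x 0]
  by (simp add: quad_def)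

text \<open>Two differentiations, each followed by cancelling \<open>fls_deriv x\<close>, isolate
  \<open>a\<close>.\<close>

lemma constants_of_derivation:
  assumes "fls_deriv x \<noteq> 0" "fls_deriv a = 0" "fls_deriv b = 0" "fls_deriv c = 0"
    and "a * x\<^sup>2 + b * x + c = (0 :: complex fls)"
  shows "a = 0 \<and> b = 0 \<and> c = 0"
proof -
  have "fls_deriv (a * x\<^sup>2 + b * x + c) = fls_deriv x * (2 * a * x + b)"
    using assms(2-4) by (simp add: power2_eq_square algebra_simps)
  then have 1: "2 * a * x + b = 0"
    using assms(1,5) by simp
  have "fls_deriv (2 * a * x + b) = 2 * a * fls_deriv x"
    using assms(2-4) by simp
  then have "a = 0"
    using assms(1) 1 by simp
  then show ?thesis
    using 1 assms(5) by simp
qed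

lemma quad_nonzero:
  fixes x :: "complex fls"
  assumes "fls_deriv x \<noteq> 0" "K i j \<noteq> 0" "i \<le> 2"
  shows "quad K j x \<noteq> 0"
proof
  assume "quad K j x = 0"
  then have "of_int (K 2 j) * x\<^sup>2 + of_int (K 1 j) * x + of_int (K 0 j) = 0"
    by (simp add: quad_def algebra_simps)
  then have "(of_int (K 2 j) :: complex fls) = 0 \<and> (of_int (K 1 j) :: complex fls) = 0
      \<and> (of_int (K 0 j) :: complex fls) = 0"
    by (intro constants_of_derivation[OF assms(1)]) auto
  then have "K 0 j = 0" "K 1 j = 0" "K 2 j = 0"
    by (simp_all only: of_int_eq_0_iff)
  moreover have "i = 0 \<or> i = 1 \<or> i = 2" using assms(3) by auto
  ultimately show False using assms(2) by auto
qed

text \<open>If all three coefficients vanished modulo \<open>p\<close>, both conjugation formulas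
  would give \<open>0 : 0\<close>.\<close>

lemma conj_ok_nondegenerate:
  assumes "conj_ok K p a v c d c' d'"
  shows "\<exists>j\<le>2. \<not> p dvd hquad K j a v"
proof (rule ccontr)
  assume "\<not> ?thesis"
  then have "p dvd hquad K j a v" if "j \<le> 2" for j using that by blast
  then have "p dvd hquad K 0 a v" "p dvd hquad K 1 a v" "p dvd hquad K 2 a v"
    by simp_all
  then show False
    using assms unfolding conj_ok_def conj1_def conj2_def by (auto split: if_splits)
qed

context reduction begin

text \<open>A constant \<open>y\<close> with nonconstant \<open>x\<close> would mean that the curve
  contains the whole line through that value of \<open>y\<close>; the reduction of \<open>y\<close>
  shows that the equation of this fibre is not zero, even modulo \<open>p\<close>.\<close>

lemma nonconstant:
  assumes "biquad K x y = 0" "fls_deriv x \<noteq> 0" "reduces y c d"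
    and nd: "\<exists>j\<le>2. \<not> p dvd hquad (tp K) j c d"
  shows "fls_deriv y \<noteq> 0"
proof
  assume dy: "fls_deriv y = 0"
  have "biquad (tp K) y x = 0"
    using assms(1) by (simp add: biquad_tp)
  then have "quad (tp K) 2 y * x\<^sup>2 + quad (tp K) 1 y * x + quad (tp K) 0 y = 0"
    unfolding biquad_def by (simp add: algebra_simps)
  then have "quad (tp K) 2 y = 0 \<and> quad (tp K) 1 y = 0 \<and> quad (tp K) 0 y = 0"
    using assms(2) dy by (intro constants_of_derivation) (simp_all add: fls_deriv_quad)
  moreover obtain j where j: "j \<le> 2" "\<not> p dvd hquad (tp K) j c d"
    using nd by blast
  moreover have "j = 0 \<or> j = 1 \<or> j = 2" using j by auto
  ultimately have q0: "quad (tp K) j y = 0" by auto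
  obtain Y W where Y: "fps_to_fls Y = y * fps_to_fls W" "red (fps_nth Y 0) c" "red (fps_nth W 0) d"
    using assms(3) by (auto simp: reduces_def)
  have "fps_to_fls (hquad (tp K) j Y W) = hquad (tp K) j (fps_to_fls Y) (fps_to_fls W)"
    by (simp add: hquad_def fls_times_fps_to_fls fps_to_fls_power fps_to_fls_of_int)
  also have "\<dots> = 0"
    unfolding Y(1) hquad_eq q0 by simp
  finally have "fps_nth (hquad (tp K) j Y W) 0 = 0"
    by simp
  moreover have "fps_nth (hquad (tp K) j Y W) 0 = hquad (tp K) j (fps_nth Y 0) (fps_nth W 0)"
    by (simp add: hquad_def fps_power_zeroth flip: fps_of_int)
  ultimately have "red 0 (hquad (tp K) j c d)"
    using red_hquad Y by metis
  then show False using red_0 j by blast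
qed

lemma step_invariant:
  assumes fl: "flow K w x y" and dx: "fls_deriv x \<noteq> 0" and row: "\<exists>i\<le>2. K i 2 \<noteq> 0"
    and red: "reduces x a v" "reduces y c d" and ok: "conj_ok K p a v c d c' d'"
    and nd: "\<exists>j\<le>2. \<not> p dvd hquad (tp K) j c' d'"
  shows "flow K (- w) x (other K x y) \<and> fls_deriv (other K x y) \<noteq> 0 \<and>
    reduces (other K x y) c' d'"
proof -
  have q: "quad K 2 x \<noteq> 0" using row dx quad_nonzero by blast
  have K: "biquad K x y = 0" using fl by (simp add: flow_def)
  have "reduces (other K x y) c' d'"
    using reduces_other q K red ok by blast
  then show ?thesis
    using flow_step[OF fl q dx] nonconstant[OF biquad_other[OF K q] dx _ nd] by blast
qed

lemma edge_equation:
  assumes "biquad K x y = 0" "at0 x 0" "fps_to_fls Y = y * fps_to_fls W"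
  shows "of_int (K 0 0) * (fps_nth W 0)\<^sup>2 + of_int (K 0 1) * (fps_nth Y 0 * fps_nth W 0)
    + of_int (K 0 2) * (fps_nth Y 0)\<^sup>2 = 0"
proof -
  have "quad K 0 x * (fps_to_fls W)\<^sup>2 + quad K 1 x * (fps_to_fls Y * fps_to_fls W)
      + quad K 2 x * (fps_to_fls Y)\<^sup>2 = biquad K x y * (fps_to_fls W)\<^sup>2"
    unfolding assms(3) biquad_def by (simp add: algebra_simps power2_eq_square)
  also have "\<dots> = 0" using assms by simp
  finally have "at0 0 (of_int (K 0 0) * (fps_nth W 0)\<^sup>2
    + of_int (K 0 1) * (fps_nth Y 0 * fps_nth W 0) + of_int (K 0 2) * (fps_nth Y 0)\<^sup>2)"
    using at0_add[OF at0_add[OF at0_mult[OF quad_at0_0[OF assms(2)]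
      at0_power[OF at0_fps]] at0_mult[OF quad_at0_0[OF assms(2)]
      at0_mult[OF at0_fps at0_fps]]] at0_mult[OF
      quad_at0_0[OF assms(2)] at0_power[OF at0_fps]]] by metis
  then show ?thesis using at0_unique[OF at0_0] by metis
qed

lemma val0_ratio:
  assumes "fps_to_fls Y = y * fps_to_fls W" "y \<noteq> 0" "fps_nth Y 0 \<noteq> 0 \<or> fps_nth W 0 \<noteq> 0"
  shows "val0 y = (if fps_nth W 0 = 0 then None else Some (fps_nth Y 0 / fps_nth W 0))"
proof (cases "fps_nth W 0 = 0")
  case False
  then have "fps_to_fls W \<noteq> 0" by auto
  then have "y = fps_to_fls Y / fps_to_fls W" using assms(1) by (simp add: field_simps)
  then show ?thesis
    using False at0_divide[OF at0_fps at0_fps] by (simp add: val0_Some)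
next
  case True
  have "\<not> regular y"
  proof
    assume "regular y"
    then obtain b where "at0 y b" by (auto simp: regular_def)
    then have "at0 (fps_to_fls Y) (b * fps_nth W 0)"
      unfolding assms(1) by (intro at0_mult at0_fps)
    then show False
      using True assms(3) at0_unique[OF at0_fps] by fastforce
  qed
  then show ?thesis using True by (simp add: val0_None)
qed

text \<open>On \<open>x = 0\<close> the values of \<open>y\<close> are roots of the quadratic
  \<open>K(0, _)\<close>. Either its discriminant is 0 and there is a single root, or it is nonzero
  modulo \<open>p\<close> and distinct roots keep distinct reductions.\<close>

lemma edge_unique:
  assumes K: "biquad K x y = 0" "biquad K x' y' = 0" and sp: "at0 x 0" "at0 x' 0"
    and nz: "y \<noteq> 0" "y' \<noteq> 0" and red: "reduces y c d" "reduces y' c d"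
    and disc: "(K 0 1)\<^sup>2 - 4 * K 0 0 * K 0 2 = 0 \<or> \<not> p dvd (K 0 1)\<^sup>2 - 4 * K 0 0 * K 0 2"
    and ne: "\<exists>j\<le>2. K 0 j \<noteq> 0"
  shows "val0 y = val0 y'"
proof -
  obtain Y W where Y: "fps_to_fls Y = y * fps_to_fls W" "red (fps_nth Y 0) c" "red (fps_nth W 0) d"
    using red(1) by (auto simp: reduces_def)
  obtain Y' W' where Y': "fps_to_fls Y' = y' * fps_to_fls W'" "red (fps_nth Y' 0) c" "red (fps_nth
    W' 0) d"
    using red(2) by (auto simp: reduces_def)
  define a b a' b' where "a = fps_nth Y 0" "b = fps_nth W 0" "a' = fps_nth Y' 0" "b' = fps_nth W' 0"
  note abdefs = this
  have cd: "\<not> (p dvd c \<and> p dvd d)" using red by (simp add: reduces_def)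
  have r: "red a c" "red b d" "red a' c" "red b' d" using Y Y' by (simp_all add: abdefs)
  have nz1: "a \<noteq> 0 \<or> b \<noteq> 0" "a' \<noteq> 0 \<or> b' \<noteq> 0"
    using r cd red_0 by metis+
  define e0 e1 e2 :: complex where "e0 = of_int (K 0 0)" "e1 = of_int (K 0 1)" "e2 = of_int (K 0 2)"
  note edefs = this
  have E: "e0 * b\<^sup>2 + e1 * (a * b) + e2 * a\<^sup>2 = 0"
    using edge_equation[OF K(1) sp(1) Y(1)] by (simp add: abdefs edefs)
  have E': "e0 * b'\<^sup>2 + e1 * (a' * b') + e2 * a'\<^sup>2 = 0"
    using edge_equation[OF K(2) sp(2) Y'(1)] by (simp add: abdefs edefs)
  \<comment> \<open>\<open>\<delta>\<close> vanishes exactly if the projective points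
    \<open>a : b\<close> and \<open>a' : b'\<close> coincide. Otherwise they are the two roots, and
    the relations 1, 2, 3 below are Vieta's formulas in homogeneous form.\<close>
  define s \<delta> where "s = a * b' + a' * b" and "\<delta> = a * b' - a' * b"
  have "\<delta> = 0"
  proof (rule ccontr)
    assume d0: "\<delta> \<noteq> 0"
    have "\<delta> * (e1 * b * b' + e2 * s) = 0"
      using E E' unfolding \<delta>_def s_def by algebra
    then have 1: "e1 * b * b' = - e2 * s" using d0 by (simp add: eq_neg_iff_add_eq_0)
    have "\<delta> * (e1 * a * a' + e0 * s) = 0"
      using E E' unfolding \<delta>_def s_def by algebra
    then have 2: "e1 * a * a' = - e0 * s" using d0 by (simp add: eq_neg_iff_add_eq_0)
    have "\<delta> * (e2 * a * a' - e0 * b * b') = 0"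
      using E E' unfolding \<delta>_def s_def by algebra
    then have 3: "e2 * a * a' = e0 * b * b'" using d0 by simp
    have D: "(e1\<^sup>2 - 4 * e0 * e2) * (b * b')\<^sup>2 = e2\<^sup>2 * \<delta>\<^sup>2"
      using 1 3 unfolding \<delta>_def s_def by algebra
    have D': "(e1\<^sup>2 - 4 * e0 * e2) * (a * a')\<^sup>2 = e0\<^sup>2 * \<delta>\<^sup>2"
      using 2 3 unfolding \<delta>_def s_def by algebra
    let ?D = "(K 0 1)\<^sup>2 - 4 * K 0 0 * K 0 2"
    have De: "e1\<^sup>2 - 4 * e0 * e2 = of_int ?D" by (simp add: edefs)
    show False
    proof (cases "?D = 0")
      case True
      then have D0: "e1\<^sup>2 - 4 * e0 * e2 = 0" using De by simp
      then have "e2 = 0" "e0 = 0" using D D' d0 by simp_all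
      moreover from this have "e1 = 0" using D0 by simp
      ultimately have "K 0 0 = 0" "K 0 1 = 0" "K 0 2 = 0" by (simp_all add: edefs)
      moreover obtain j where "j \<le> 2" "K 0 j \<noteq> 0" using ne by blast
      moreover from this have "j = 0 \<or> j = 1 \<or> j = 2" by auto
      ultimately show False by auto
    next
      case False
      then have nd: "\<not> p dvd ?D" using disc by simp
      \<comment> \<open>Both points reduce to \<open>c : d\<close>, so \<open>\<delta>\<close>
        reduces to 0, and by \<open>D\<close> and \<open>D'\<close> so do the multiples of the
        discriminant on their left-hand sides.\<close>
      have "red \<delta> (c * d - c * d)" unfolding \<delta>_def using r by (intro red_intros)
      then have rd: "red (e2\<^sup>2 * \<delta>\<^sup>2) ((K 0 2)\<^sup>2 * (c * d - c * d)\<^sup>2)"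
          "red (e0\<^sup>2 * \<delta>\<^sup>2) ((K 0 0)\<^sup>2 * (c * d - c * d)\<^sup>2)"
        unfolding edefs by (intro red_intros; assumption)+
      have "red (of_int ?D * (b * b')\<^sup>2) (?D * (d * d)\<^sup>2)" "red (of_int ?D * (a * a')\<^sup>2) (?D * (c
        * c)\<^sup>2)"
        by (rule red_mult[OF red_of_int red_power[OF red_mult[OF r(2,4)]]],
            rule red_mult[OF red_of_int red_power[OF red_mult[OF r(1,3)]]])
      then have "red (of_int ?D * (b * b')\<^sup>2 - e2\<^sup>2 * \<delta>\<^sup>2) (?D * (d * d)\<^sup>2 - (K 0 2)\<^sup>2 * (c * d -
        c * d)\<^sup>2)"
          "red (of_int ?D * (a * a')\<^sup>2 - e0\<^sup>2 * \<delta>\<^sup>2) (?D * (c * c)\<^sup>2 - (K 0 0)\<^sup>2 * (c * d - c *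
            d)\<^sup>2)"
        using rd red_diff by blast+
      then have "p dvd ?D * (d * d)\<^sup>2" "p dvd ?D * (c * c)\<^sup>2"
        using D D' De red_0 by simp_all
      then have "p dvd d" "p dvd c"
        using nd prime_p by (auto simp: prime_dvd_mult_iff prime_dvd_power_iff)
      then show False using cd by blast
    qed
  qed
  then have ab: "a * b' = a' * b" by (simp add: \<delta>_def)
  then have "b = 0 \<longleftrightarrow> b' = 0" using nz1 by auto
  moreover have "a / b = a' / b'" if "b \<noteq> 0" "b' \<noteq> 0" using ab that by (simp add: field_simps)
  ultimately show ?thesis
    using val0_ratio[OF Y(1) nz(1)] val0_ratio[OF Y'(1) nz(2)] nz1
    by (auto simp: abdefs)
qed

end

section \<open>The orbit in both directions and its reduction\<close>

definition involution :: "coefficients \<Rightarrow> bool \<Rightarrow> 'a::field \<times> 'a \<Rightarrow> 'a \<times> 'a" where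
  "involution K b z = (case z of (x, y) \<Rightarrow> if b then (x, other K x y) else (other (tp K) y x, y))"

primrec alternate :: "coefficients \<Rightarrow> bool \<Rightarrow> 'a::field \<times> 'a \<Rightarrow> nat \<Rightarrow> 'a \<times> 'a" where
  "alternate K b z 0 = z"
| "alternate K b z (Suc k) = involution K (even k = b) (alternate K b z k)"

text \<open>The two halves start with different involutions; this makes the rule uniform over all
  integers: a step from \<open>n\<close> to \<open>n + 1\<close> keeps \<open>x\<close> if
  \<open>n\<close> is even and \<open>y\<close> if \<open>n\<close> is odd.\<close>

definition orbit :: "coefficients \<Rightarrow> 'a::field \<times> 'a \<Rightarrow> int \<Rightarrow> 'a \<times> 'a" where
  "orbit K z n = (if n \<ge> 0 then alternate K True z (nat n) else alternate K False z (nat (- n)))"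

lemma involution_involution: "involution K b (involution K b z) = z"
  by (auto simp: involution_def other_other split: prod.splits)

lemma orbit_0: "orbit K z 0 = z"
  by (simp add: orbit_def)

lemma orbit_succ: "orbit K z (n + 1) = involution K (even n) (orbit K z n)"
proof (cases "n \<ge> 0")
  case True
  then have "nat (n + 1) = Suc (nat n)" by simp
  then show ?thesis using True by (simp add: orbit_def even_nat_iff)
next
  case False
  define k where "k = nat (- n - 1)"
  have n: "n = - int k - 1" using False by (simp add: k_def)
  have "nat (- n) = Suc k" using n by simp
  then have "orbit K z n = involution K (odd k) (alternate K False z k)"
    using False by (simp add: orbit_def)
  moreover have "orbit K z (n + 1) = alternate K False z k"
    by (cases "k = 0") (auto simp: orbit_def n)
  moreover have "even n = odd k" by (simp add: n)
  ultimately show ?thesis by (simp add: involution_involution)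
qed

lemma orbit_pred: "orbit K z (n - 1) = involution K (odd n) (orbit K z n)"
  using orbit_succ[of K z "n - 1"] by (simp add: involution_involution)

type_synonym point = "(int \<times> int) \<times> int \<times> int"

text \<open>Conjugation is tested both ways, as the orbit is followed to positive and to negative
  positions.\<close>

definition link_ok :: "coefficients \<Rightarrow> int \<Rightarrow> bool \<Rightarrow> point \<Rightarrow> point \<Rightarrow> bool" where
  "link_ok K p b P Q = (case (P, Q) of (((a, v), c, d), ((a', v'), c', d')) \<Rightarrow>
     if b then a = a' \<and> v = v' \<and> conj_ok K p a v c d c' d' \<and> conj_ok K p a v c' d' c d
     else c = c' \<and> d = d' \<and> conj_ok (tp K) p c d a v a' v' \<and> conj_ok (tp K) p c d a' v' a v)"

text \<open>The even length makes the parity of a position depend on its index only, and length at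
  least 4 keeps the positions \<open>-1, 0, 1, 2\<close> apart. The nonzero coefficients of degree 2
  ensure that both involutions are defined at nonconstant points.\<close>

definition cycle_ok :: "coefficients \<Rightarrow> int \<Rightarrow> point list \<Rightarrow> bool" where
  "cycle_ok K p ps \<longleftrightarrow> even (length ps) \<and> length ps \<ge> 4 \<and>
     (\<exists>i\<le>2. K i 2 \<noteq> 0) \<and> (\<exists>i\<le>2. K 2 i \<noteq> 0) \<and>
     (\<forall>k<length ps. link_ok K p (even k) (ps ! k) (ps ! (Suc k mod length ps)))"

definition periodic :: "'a list \<Rightarrow> int \<Rightarrow> 'a" where
  "periodic ps n = ps ! nat (n mod int (length ps))"

lemma periodic_link:
  assumes "cycle_ok K p ps"
  shows "link_ok K p (even n) (periodic ps n) (periodic ps (n + 1))"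
proof -
  let ?N = "int (length ps)"
  have N: "even ?N" "?N > 0" using assms by (auto simp: cycle_ok_def)
  define k where "k = nat (n mod ?N)"
  have k: "int k = n mod ?N" "k < length ps"
    using N by (simp_all add: k_def nat_less_iff)
  have "int (Suc k mod length ps) = (n mod ?N + 1) mod ?N"
    using k(1) by (simp add: zmod_int add.commute)
  then have "Suc k mod length ps = nat ((n + 1) mod ?N)"
    by (metis mod_add_left_eq nat_int)
  moreover have "even k = even n"
    using k(1) N(1) by (metis dvd_mod_iff even_of_nat)
  moreover have "link_ok K p (even k) (ps ! k) (ps ! (Suc k mod length ps))"
    using assms k(2) unfolding cycle_ok_def by blast
  ultimately show ?thesis
    unfolding periodic_def k_def by simp
qed

text \<open>The factor \<open>w\<close> at position \<open>n\<close>: every involution reverses its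
  sign.\<close>

definition sgn_parity :: "int \<Rightarrow> 'a::ring_1 \<Rightarrow> 'a" where
  "sgn_parity n w = (if even n then w else - w)"

locale curve_orbit = reduction +
  fixes K :: "nat \<Rightarrow> nat \<Rightarrow> int" and ps :: "point list" and w x0 y0 :: "complex fls"
  assumes cycle: "cycle_ok K p ps"
    and flow0: "flow K w x0 y0" and regular_w: "regular w"
    and dx0: "fls_deriv x0 \<noteq> 0" and dy0: "fls_deriv y0 \<noteq> 0"
    and reduces0: "case ps ! 0 of ((a, v), c, d) \<Rightarrow> reduces x0 a v \<and> reduces y0 c d"
begin

definition x :: "int \<Rightarrow> complex fls" where "x n = fst (orbit K (x0, y0) n)"
definition y :: "int \<Rightarrow> complex fls" where "y n = snd (orbit K (x0, y0) n)"

abbreviation "pt \<equiv> periodic ps"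

lemma xy_0: "x 0 = x0" "y 0 = y0"
  by (simp_all add: x_def y_def orbit_0)

lemma x_even: "even n \<Longrightarrow> x (n + 1) = x n"
  and y_even: "even n \<Longrightarrow> y (n + 1) = other K (x n) (y n)"
  and y_odd: "odd n \<Longrightarrow> y (n + 1) = y n"
  and x_odd: "odd n \<Longrightarrow> x (n + 1) = other (tp K) (y n) (x n)"
  by (simp_all add: x_def y_def orbit_succ involution_def split: prod.splits)

lemma x_even': "odd n \<Longrightarrow> x (n - 1) = x n"
  and y_even': "odd n \<Longrightarrow> y (n - 1) = other K (x n) (y n)"
  and y_odd': "even n \<Longrightarrow> y (n - 1) = y n"
  and x_odd': "even n \<Longrightarrow> x (n - 1) = other (tp K) (y n) (x n)"
  by (simp_all add: x_def y_def orbit_pred involution_def split: prod.splits)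

definition good :: "int \<Rightarrow> bool" where
  "good n \<longleftrightarrow> flow K (sgn_parity n w) (x n) (y n) \<and> fls_deriv (x n) \<noteq> 0 \<and> fls_deriv (y n) \<noteq> 0 \<and>
    reduces (x n) (fst (fst (pt n))) (snd (fst (pt n))) \<and>
    reduces (y n) (fst (snd (pt n))) (snd (snd (pt n)))"

lemma link: "link_ok K p (even n) (pt n) (pt (n + 1))"
  using periodic_link[OF cycle] .

lemma nondegenerate_y: "\<exists>j\<le>2. \<not> p dvd hquad (tp K) j (fst (snd (pt n))) (snd (snd (pt n)))"
proof (cases "even n")
  case True
  then show ?thesis
    using link[of "n - 1"] by (auto simp: link_ok_def split: prod.splits dest!:
      conj_ok_nondegenerate)
next
  case False
  then show ?thesis
    using link[of n] by (auto simp: link_ok_def split: prod.splits dest!: conj_ok_nondegenerate)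
qed

lemma nondegenerate_x: "\<exists>j\<le>2. \<not> p dvd hquad K j (fst (fst (pt n))) (snd (fst (pt n)))"
proof (cases "even n")
  case False
  then show ?thesis
    using link[of "n - 1"] by (auto simp: link_ok_def split: prod.splits dest!:
      conj_ok_nondegenerate)
next
  case True
  then show ?thesis
    using link[of n] by (auto simp: link_ok_def split: prod.splits dest!: conj_ok_nondegenerate)
qed

lemma rows: "\<exists>i\<le>2. K i 2 \<noteq> 0" "\<exists>i\<le>2. (tp K) i 2 \<noteq> 0"
  using cycle by (auto simp: cycle_ok_def tp_def)

lemma good_move_y:
  assumes "good n" "x m = x n" "y m = other K (x n) (y n)" "even m \<noteq> even n"
    and "fst (pt m) = fst (pt n)"
    and "conj_ok K p (fst (fst (pt n))) (snd (fst (pt n))) (fst (snd (pt n))) (snd (snd (pt n)))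
      (fst (snd (pt m))) (snd (snd (pt m)))"
  shows "good m"
proof -
  have "flow K (- sgn_parity n w) (x n) (y m) \<and> fls_deriv (y m) \<noteq> 0 \<and>
      reduces (y m) (fst (snd (pt m))) (snd (snd (pt m)))"
    unfolding assms(3) by (rule step_invariant[OF _ _ rows(1) _ _ assms(6) nondegenerate_y])
      (use assms(1) in \<open>auto simp: good_def\<close>)
  moreover have "- sgn_parity n w = sgn_parity m w"
    using assms(4) by (auto simp: sgn_parity_def)
  ultimately show ?thesis
    using assms by (simp add: good_def)
qed

lemma good_move_x:
  assumes "good n" "y m = y n" "x m = other (tp K) (y n) (x n)" "even m \<noteq> even n"
    and "snd (pt m) = snd (pt n)"
    and "conj_ok (tp K) p (fst (snd (pt n))) (snd (snd (pt n))) (fst (fst (pt n))) (snd (fst (pt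
      n)))
      (fst (fst (pt m))) (snd (fst (pt m)))"
  shows "good m"
proof -
  have fl: "flow (tp K) (- sgn_parity n w) (y n) (x n)"
    using assms(1) flow_tp by (simp add: good_def)
  have *: "flow (tp K) (- (- sgn_parity n w)) (y n) (x m) \<and> fls_deriv (x m) \<noteq> 0 \<and>
      reduces (x m) (fst (fst (pt m))) (snd (fst (pt m)))"
    unfolding assms(3) by (rule step_invariant[OF fl _ rows(2) _ _ assms(6)])
      (use assms(1) nondegenerate_x in \<open>auto simp: good_def\<close>)
  moreover have "- sgn_parity n w = sgn_parity m w"
    using assms(4) by (auto simp: sgn_parity_def)
  ultimately have "flow K (sgn_parity m w) (x m) (y n)"
    using flow_tp[of "tp K" "- (- sgn_parity n w)"] by simp
  then show ?thesis
    using assms * by (simp add: good_def)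
qed

lemma good: "good n"
proof (induction n rule: int_induct[of _ 0])
  case base
  have "pt 0 = ps ! 0" by (simp add: periodic_def)
  then show ?case
    using flow0 dx0 dy0 reduces0 by (auto simp: good_def xy_0 sgn_parity_def split: prod.splits)
next
  case (step1 i)
  show ?case
  proof (cases "even i")
    case True
    then show ?thesis
      using link[of i] step1
      by (intro good_move_y[of i "i + 1"]) (auto simp: x_even y_even link_ok_def split: prod.splits)
  next
    case False
    then show ?thesis
      using link[of i] step1
      by (intro good_move_x[of i "i + 1"]) (auto simp: x_odd y_odd link_ok_def split: prod.splits)
  qed
next
  case (step2 i)
  show ?case
  proof (cases "even i")
    case False
    then show ?thesis
      using link[of "i - 1"] step2
      by (intro good_move_y[of i "i - 1"]) (auto simp: x_even' y_even' link_ok_def split: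
        prod.splits)
  next
    case True
    then show ?thesis
      using link[of "i - 1"] step2
      by (intro good_move_x[of i "i - 1"]) (auto simp: x_odd' y_odd' link_ok_def split: prod.splits)
  qed
qed

lemma flow_orbit: "flow K (sgn_parity n w) (x n) (y n)"
  and dx: "fls_deriv (x n) \<noteq> 0" and dy: "fls_deriv (y n) \<noteq> 0"
  and reduces_x: "reduces (x n) (fst (fst (pt n))) (snd (fst (pt n)))"
  and reduces_y: "reduces (y n) (fst (snd (pt n))) (snd (snd (pt n)))"
  using good by (simp_all add: good_def)

lemma on_curve: "biquad K (x n) (y n) = 0"
  using flow_orbit by (simp add: flow_def)

lemma x_nz: "x n \<noteq> 0" and y_nz: "y n \<noteq> 0"
  using dx[of n] dy[of n] by auto

text \<open>Equal parity means equal sign of \<open>w\<close>, so that both points solve the same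
  differential equation.\<close>

lemma orbit_unique:
  assumes "even (n - m)" "val0 (x n) = val0 (x m)" "val0 (y n) = val0 (y m)"
  shows "x n = x m \<and> y n = y m"
proof (rule flow_unique)
  show "flow K (sgn_parity n w) (x n) (y n)" by (rule flow_orbit)
  show "flow K (sgn_parity n w) (x m) (y m)"
    using flow_orbit[of m] assms(1) by (simp add: sgn_parity_def)
  show "regular (sgn_parity n w)"
    using regular_w regular_uminus by (simp add: sgn_parity_def)
qed (use x_nz y_nz assms in auto)

lemma orbit_shift:
  assumes "even (n - m)" "x n = x m" "y n = y m"
  shows "x (n + i) = x (m + i) \<and> y (n + i) = y (m + i)"
proof (induction i rule: int_induct[of _ 0])
  case base
  then show ?case using assms by simp
next
  case (step1 i)
  have "even (n + i) = even (m + i)" using assms(1) by auto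
  then show ?case
    using step1 x_even[of "n + i"] x_even[of "m + i"] y_even[of "n + i"] y_even[of "m + i"]
      x_odd[of "n + i"] x_odd[of "m + i"] y_odd[of "n + i"] y_odd[of "m + i"]
    by (cases "even (n + i)") (auto simp: add.assoc)
next
  case (step2 i)
  have "even (n + i) = even (m + i)" using assms(1) by auto
  then show ?case
    using step2 x_even'[of "n + i"] x_even'[of "m + i"] y_even'[of "n + i"] y_even'[of "m + i"]
      x_odd'[of "n + i"] x_odd'[of "m + i"] y_odd'[of "n + i"] y_odd'[of "m + i"]
    by (cases "even (n + i)") (auto simp: add_diff_eq)
qed

end

section \<open>Certificates against splittings\<close>

text \<open>All that is retained of rational functions is that their poles occur at finitely many
  values of the argument. Constant series are left out because a denominator may vanish at
  them.\<close>

definition splits :: "coefficients \<Rightarrow> (complex fls \<Rightarrow> complex fls \<Rightarrow> complex fls) \<Rightarrow> bool" where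
  "splits K h \<longleftrightarrow> (\<exists>f g A B. finite A \<and> finite B \<and>
     (\<forall>z. fls_deriv z \<noteq> 0 \<longrightarrow> val0 z \<notin> A \<longrightarrow> regular (f z)) \<and>
     (\<forall>z. fls_deriv z \<noteq> 0 \<longrightarrow> val0 z \<notin> B \<longrightarrow> regular (g z)) \<and>
     (\<forall>x y. fls_deriv x \<noteq> 0 \<longrightarrow> fls_deriv y \<noteq> 0 \<longrightarrow> biquad K x y = 0 \<longrightarrow> f x + g y = h x y))"

text \<open>With \<open>a\<close> false, a pole at infinity is brought to 0, where the quadratic
  \<open>K(0, _)\<close> controls the other coordinate.\<close>

definition signed :: "bool \<Rightarrow> 'a::field \<Rightarrow> 'a" where
  "signed a x = (if a then x else inverse x)"

lemma not_regular_signed: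
  assumes "x \<noteq> 0" "\<not> regular (signed a x)"
  shows "if a then \<not> regular x else at0 x 0"
  using assms regular_or_inverse[of "inverse x"] by (auto simp: signed_def)

lemma regular_inverse: "x \<noteq> 0 \<Longrightarrow> \<not> at0 x 0 \<Longrightarrow> regular (inverse x)"
  using not_regular_signed[of x False] by (auto simp: signed_def)

lemma at0_0_mult: "at0 a 0 \<Longrightarrow> regular b \<Longrightarrow> at0 (a * b) 0"
  unfolding regular_def using at0_mult by fastforce

text \<open>The product \<open>signed a x * signed b y\<close> may have a pole at positions \<open>-1, 0, 1, 2\<close> of the
  orbit only. The orbit starts either at \<open>(0, \<theta>)\<close>, or at the origin. In the latter case the curve
  is transversal to both axes if \<open>K 0 1 = 1\<close>, and tangent to the axis \<open>x = 0\<close> if \<open>K 0 1 = 0\<close>.\<close>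

definition cert_ok ::
  "coefficients \<Rightarrow> bool \<Rightarrow> bool \<Rightarrow> int \<Rightarrow> int \<Rightarrow> int \<Rightarrow> point list \<Rightarrow> bool" where
  "cert_ok K a b e r p ps \<longleftrightarrow> cycle_ok K p ps \<and> \<not> p dvd fst (fst (ps ! 2)) \<and>
     (\<forall>k<length ps. if a then \<not> p dvd snd (fst (ps ! k)) else p dvd fst (fst (ps ! k)) \<longrightarrow> k \<le> 1) \<and>
     (\<forall>k<length ps. if b then \<not> p dvd snd (snd (ps ! k))
        else p dvd fst (snd (ps ! k)) \<longrightarrow> Suc k = length ps \<or> k = 0 \<or> K 0 1 = 0 \<and> k \<le> 2) \<and>
     (if K 0 0 = 1 then K 0 1 = e \<and> K 0 2 = 1 \<and> \<not> p dvd e\<^sup>2 - 4 \<and> ps ! 0 = ((0, 1), (r, 1)) \<and> \<not> a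
       \<and> b
      else K 0 0 = 0 \<and> K 1 0 = 1 \<and> ps ! 0 = ((0, 1), (0, 1)) \<and>
        (K 0 1 = 1 \<and> \<not> a \<and> \<not> b \<or> K 0 1 = 0 \<and> K 0 2 = 1 \<and> (a \<longrightarrow> \<not> b \<and> K 2 0 = 1)))"

context curve_orbit begin

lemma pt_index:
  obtains k where "k < length ps" "pt n = ps ! k" "int k = n mod int (length ps)"
proof -
  have "int (length ps) > 0" using cycle by (auto simp: cycle_ok_def)
  then show ?thesis
    by (intro that[of "nat (n mod int (length ps))"]) (simp_all add: periodic_def nat_less_iff)
qed

lemma even_length: "even (int (length ps))" and length_ge: "int (length ps) \<ge> 4"
  using cycle by (auto simp: cycle_ok_def)

lemma same_index:
  assumes "n mod int (length ps) = i mod int (length ps)"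
  shows "pt n = pt i" "even (n - i)"
proof -
  show "pt n = pt i" using assms by (simp add: periodic_def)
  have "int (length ps) dvd n - i" using assms by (simp add: mod_eq_dvd_iff)
  then show "even (n - i)" using even_length by (meson dvd_trans)
qed

text \<open>Equal indices in the cycle give equal reductions, hence equal values of \<open>y\<close>
  on the axis, and then equal series by uniqueness of the flow.\<close>

lemma pole_x:
  assumes sp: "at0 (x n) 0" "at0 (x i) 0"
    and eq: "n mod int (length ps) = i mod int (length ps)"
    and disc: "(K 0 1)\<^sup>2 - 4 * K 0 0 * K 0 2 = 0 \<or> \<not> p dvd (K 0 1)\<^sup>2 - 4 * K 0 0 * K 0 2"
    and ne: "\<exists>j\<le>2. K 0 j \<noteq> 0"
  shows "even (n - i) \<and> x n = x i \<and> y n = y i"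
proof -
  have "val0 (y n) = val0 (y i)"
    using edge_unique[OF on_curve on_curve sp y_nz y_nz reduces_y _ disc ne] reduces_y[of i]
      same_index(1)[OF eq] by simp
  moreover have "val0 (x n) = val0 (x i)"
    using sp by (simp add: val0_Some[symmetric])
  ultimately show ?thesis
    using orbit_unique same_index(2)[OF eq] by blast
qed

lemma pole_y:
  assumes sp: "at0 (y n) 0" "at0 (y i) 0"
    and eq: "n mod int (length ps) = i mod int (length ps)"
    and disc: "(K 1 0)\<^sup>2 - 4 * K 0 0 * K 2 0 = 0 \<or> \<not> p dvd (K 1 0)\<^sup>2 - 4 * K 0 0 * K 2 0"
    and ne: "\<exists>j\<le>2. K j 0 \<noteq> 0"
  shows "even (n - i) \<and> x n = x i \<and> y n = y i"
proof -
  have "biquad (tp K) (y m) (x m) = 0" for m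
    using on_curve by (simp add: biquad_tp)
  then have "val0 (x n) = val0 (x i)"
    using edge_unique[of "tp K" "y n" "x n" "y i" "x i", OF _ _ sp x_nz x_nz reduces_x]
      reduces_x[of i]
      same_index(1)[OF eq] disc ne by (simp add: tp_def)
  moreover have "val0 (y n) = val0 (y i)"
    using sp by (simp add: val0_Some[symmetric])
  ultimately show ?thesis
    using orbit_unique same_index(2)[OF eq] by blast
qed

lemma split_regular:
  assumes "splits K h" and x2: "\<not> at0 (x 2) 0" and x0: "at0 x0 0"
    and poles: "\<And>n. \<not> regular (h (x n) (y n)) \<Longrightarrow>
      \<exists>i\<in>{-1, 0, 1, 2}. even (n - i) \<and> x n = x i \<and> y n = y i"
  shows "regular (h (x 0) (y 0) - h (x (-1)) (y (-1)) + h (x 2) (y 2) - h (x 1) (y 1))"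
proof -
  obtain f g A B where fg: "finite A" "finite B"
    "\<And>z. fls_deriv z \<noteq> 0 \<Longrightarrow> val0 z \<notin> A \<Longrightarrow> regular (f z)"
    "\<And>z. fls_deriv z \<noteq> 0 \<Longrightarrow> val0 z \<notin> B \<Longrightarrow> regular (g z)"
    "\<And>x y. fls_deriv x \<noteq> 0 \<Longrightarrow> fls_deriv y \<noteq> 0 \<Longrightarrow> biquad K x y = 0 \<Longrightarrow> f x + g y = h x y"
    using assms(1) unfolding splits_def by blast
  have "x 2 \<noteq> x 0" using x2 x0 xy_0 by metis
  show ?thesis
  proof (rule regular_across_poles[of x y f g "\<lambda>n. h (x n) (y n)" A B])
    show "f (x n) + g (y n) = h (x n) (y n)" for n
      by (rule fg(5)[OF dx dy on_curve])
    show "regular (f (x n))" if "val0 (x n) \<notin> A" for n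
      using fg(3) dx that by blast
    show "regular (g (y n))" if "val0 (y n) \<notin> B" for n
      using fg(4) dy that by blast
    show "\<not> (x 2 = x 0 \<and> y 2 = y 0)"
      using \<open>x 2 \<noteq> x 0\<close> by blast
  qed (fact x_even y_odd fg(1,2) orbit_unique orbit_shift poles)+
qed

end

section \<open>Branches through the starting point\<close>

lemma fls_deriv_eq_0_at0:
  assumes "fls_deriv z = 0" "at0 z 0"
  shows "z = 0"
proof -
  obtain Z where Z: "z = fps_to_fls Z" "fps_nth Z 0 = 0"
    using assms(2) by (auto simp: at0_def)
  then have "fps_deriv Z = 0"
    using assms(1) by (simp add: fls_deriv_fps_to_fls)
  then have "Z = fps_const (fps_nth Z 0)"
    by (simp add: fps_deriv_eq_0_iff)
  then show ?thesis using Z by simp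
qed

text \<open>The root is \<open>-2 c / (b + s)\<close> with \<open>s^2 = b^2 - 4 a c\<close>. This
  form avoids division by \<open>a\<close>, which may vanish, and the choice of \<open>s\<close>
  with constant term \<open>\<beta>\<close> makes \<open>b + s\<close> invertible.\<close>

lemma quadratic_root:
  fixes a b c :: "complex fps"
  assumes "fps_nth b 0 = \<beta>" "\<beta> \<noteq> 0" "fps_nth c 0 = 0"
  obtains m where "a * (c * m)\<^sup>2 + b * (c * m) + c = 0" "fps_nth m 0 = - 1 / \<beta>"
proof -
  define \<Delta> where "\<Delta> = b\<^sup>2 - 4 * a * c"
  define s where "s = fps_radical (\<lambda>_ _. \<beta>) 2 \<Delta>"
  have D0: "fps_nth \<Delta> 0 = \<beta>\<^sup>2"
    using assms by (simp add: \<Delta>_def fps_power_zeroth)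
  have s2: "s\<^sup>2 = \<Delta>"
    using power_radical[of \<Delta> "\<lambda>_ _. \<beta>" 1] D0 assms(2) unfolding s_def by (simp add: numeral_2_eq_2)
  have s0: "fps_nth s 0 = \<beta>" by (simp add: s_def)
  define q where "q = b + s"
  have q0: "fps_nth q 0 = 2 * \<beta>" using assms(1) s0 by (simp add: q_def)
  have qi: "q * inverse q = 1"
    using q0 assms(2) by (simp add: inverse_mult_eq_1')
  have key: "4 * a * c - 2 * b * q + q\<^sup>2 = 0"
    using s2 unfolding q_def \<Delta>_def by (simp add: power2_eq_square algebra_simps)
  define i where "i = inverse q"
  have "a * (c * (-2 * i))\<^sup>2 + b * (c * (-2 * i)) + c = c * (4 * a * c - 2 * b * q + q\<^sup>2) * i\<^sup>2"
    using qi unfolding i_def[symmetric] by algebra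
  then have "a * (c * (-2 * i))\<^sup>2 + b * (c * (-2 * i)) + c = 0"
    unfolding key by simp
  moreover have "fps_nth (-2 * i) 0 = - 1 / \<beta>"
    using q0 by (simp add: i_def field_simps)
  ultimately show ?thesis using that by blast
qed

lemma flow_start:
  assumes "biquad K x y = 0" "fls_deriv x = 1" "at0 (biquad_y K x y) c" "c \<noteq> 0"
  shows "flow K (inverse (biquad_y K x y)) x y \<and> regular (inverse (biquad_y K x y))"
proof -
  have nz: "biquad_y K x y \<noteq> 0"
    using assms(3,4) at0_unique at0_0 by metis
  have "fls_deriv (biquad K x y) = 0" using assms(1) by simp
  then have "biquad_y (tp K) y x + fls_deriv y * biquad_y K x y = 0"
    unfolding fls_deriv_biquad assms(2) by simp
  then have "fls_deriv y = - (inverse (biquad_y K x y) * biquad_y (tp K) y x)"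
    using nz by (simp add: field_simps eq_neg_iff_add_eq_0)
  then show ?thesis
    using assms nz at0_inverse unfolding flow_def regular_def by auto
qed

lemma biquad_y_at0:
  assumes "at0 x 0" "at0 y d"
  shows "at0 (biquad_y K x y) (of_int (K 0 1) + 2 * of_int (K 0 2) * d)"
  unfolding biquad_y_def
  by (intro at0_add at0_mult at0_numeral quad_at0_0 assms)

lemma fps_X_at0: "at0 (fps_to_fls fps_X) 0"
  using at0_fps[of fps_X] by simp

lemma fps_to_fls_quad: "quad K j (fps_to_fls X) = fps_to_fls (quad K j X)"
  by (simp add: quad_def fls_times_fps_to_fls fps_to_fls_power fps_to_fls_of_int)

lemma fps_quad_nth_0: "fps_nth (quad K j (fps_X :: complex fps)) 0 = of_int (K 0 j)"
  by (simp add: quad_def flip: fps_of_int)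

text \<open>A simple root \<open>\<zeta>\<close> of \<open>K(0, _)\<close> extends to a branch
  \<open>y = \<zeta> + v\<close> with parameter \<open>x\<close>; \<open>v\<close> solves a
  quadratic whose constant coefficient vanishes at the origin.\<close>

lemma start_simple:
  assumes "of_int (K 0 0) + of_int (K 0 1) * \<zeta> + of_int (K 0 2) * \<zeta>\<^sup>2 = 0"
    and "of_int (K 0 1) + 2 * of_int (K 0 2) * \<zeta> \<noteq> 0"
  obtains w x y where "flow K w x y" "regular w" "fls_deriv x = 1"
    "at0 x 0" "at0 y \<zeta>"
proof -
  let ?q = "\<lambda>j. quad K j (fps_X :: complex fps)"
  let ?z = "fps_const \<zeta>"
  have "fps_nth (?q 1 + 2 * ?q 2 * ?z) 0 = of_int (K 0 1) + 2 * of_int (K 0 2) * \<zeta>"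
    by (simp add: fps_quad_nth_0)
  moreover have "fps_nth (?q 0 + ?q 1 * ?z + ?q 2 * ?z\<^sup>2) 0 = 0"
    using assms(1) by (simp add: fps_quad_nth_0 fps_power_zeroth)
  ultimately obtain m where m: "?q 2 * ((?q 0 + ?q 1 * ?z + ?q 2 * ?z\<^sup>2) * m)\<^sup>2
      + (?q 1 + 2 * ?q 2 * ?z) * ((?q 0 + ?q 1 * ?z + ?q 2 * ?z\<^sup>2) * m)
      + (?q 0 + ?q 1 * ?z + ?q 2 * ?z\<^sup>2) = 0"
    using quadratic_root assms(2) by metis
  define v where "v = (?q 0 + ?q 1 * ?z + ?q 2 * ?z\<^sup>2) * m"
  have v0: "fps_nth v 0 = 0"
    using assms(1) by (simp add: v_def fps_quad_nth_0 fps_power_zeroth)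
  define x y where "x = fps_to_fls (fps_X :: complex fps)" and "y = fps_to_fls (?z + v)"
  have "biquad K fps_X (?z + v) = 0"
    using m unfolding v_def[symmetric] biquad_def by (simp add: algebra_simps power2_eq_square)
  then have K: "biquad K x y = 0"
    unfolding biquad_def x_def y_def fps_to_fls_quad
    by (metis fls_times_fps_to_fls fps_to_fls_plus fps_to_fls_power fps_zero_to_fls)
  have sp: "at0 x 0" "at0 y \<zeta>"
    using fps_X_at0 at0_fps[of "?z + v"] v0 unfolding x_def y_def by simp_all
  have dx: "fls_deriv x = 1"
    by (simp add: x_def fls_deriv_fps_to_fls)
  show ?thesis
    using flow_start[OF K dx biquad_y_at0[OF sp] assms(2)] dx sp that by blast
qed

text \<open>Here \<open>K_x = 1\<close> at the origin, so \<open>y\<close> serves as the parameter.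
  The branch starts as \<open>x = - K 0 1 * y + ...\<close>, and this slope separates the
  transversal case from the tangent one.\<close>

lemma start_node:
  assumes "K 0 0 = 0" "K 1 0 = 1" "K 0 1 \<noteq> 0 \<or> K 0 2 \<noteq> 0"
  obtains w x y where "flow K w x y" "regular w" "fls_deriv x \<noteq> 0" "fls_deriv y = 1"
    "at0 x 0" "at0 y 0" "at0 (x / y) (- of_int (K 0 1))"
proof -
  let ?q = "\<lambda>j. quad (tp K) j (fps_X :: complex fps)"
  have q1: "fps_nth (?q 1) 0 = 1"
    using assms(2) by (simp add: fps_quad_nth_0 tp_def)
  have q0: "?q 0 = (of_int (K 0 1) + of_int (K 0 2) * fps_X) * fps_X"
    using assms(1) by (simp add: quad_def tp_def algebra_simps power2_eq_square)
  then have "fps_nth (?q 0) 0 = 0" by simp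
  with q1 obtain m where m: "?q 2 * (?q 0 * m)\<^sup>2 + ?q 1 * (?q 0 * m) + ?q 0 = 0" "fps_nth m 0 = -
    1 / 1"
    using quadratic_root[of "?q 1" 1 "?q 0" "?q 2"] by auto
  define x y where "x = fps_to_fls (?q 0 * m)" and "y = fps_to_fls (fps_X :: complex fps)"
  have "biquad (tp K) fps_X (?q 0 * m) = 0"
    using m(1) unfolding biquad_def by (simp add: algebra_simps)
  then have K: "biquad (tp K) y x = 0"
    unfolding biquad_def x_def y_def fps_to_fls_quad
    by (metis fls_times_fps_to_fls fps_to_fls_plus fps_to_fls_power fps_zero_to_fls)
  have dy: "fls_deriv y = 1" by (simp add: y_def fls_deriv_fps_to_fls)
  then have ynz: "y \<noteq> 0" by auto
  have xy: "x / y = fps_to_fls ((of_int (K 0 1) + of_int (K 0 2) * fps_X) * m)"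
  proof -
    have "x = fps_to_fls ((of_int (K 0 1) + of_int (K 0 2) * fps_X) * m) * y"
      unfolding x_def q0 y_def fls_times_fps_to_fls[symmetric] fps_to_fls_eq_iff by (simp only:
        mult_ac)
    then show ?thesis using ynz by simp
  qed
  have sxy: "at0 (x / y) (- of_int (K 0 1))"
    unfolding xy using at0_fps[of "(of_int (K 0 1) + of_int (K 0 2) * fps_X) * m"] m(2)
    by (simp flip: fps_of_int)
  have sy: "at0 y 0" using fps_X_at0 by (simp add: y_def)
  have sx: "at0 x 0"
    using at0_mult[OF sxy sy] ynz by simp
  have sK: "at0 (biquad_y (tp K) y x) 1"
    using biquad_y_at0[OF sy sx, of "tp K"] assms(2) by (simp add: tp_def)
  have fl: "flow (tp K) (inverse (biquad_y (tp K) y x)) y x \<and> regular (inverse (biquad_y (tp K) y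
    x))"
    by (rule flow_start[OF K dy sK]) simp
  have "x \<noteq> 0"
  proof
    assume "x = 0"
    then have "quad (tp K) 0 y = 0" using K by (simp add: biquad_def)
    moreover have "\<exists>j\<le>2. tp K j 0 \<noteq> 0"
      using assms(3) unfolding tp_def by (metis one_le_numeral order_refl)
    ultimately show False
      using quad_nonzero[of y] dy by fastforce
  qed
  then have "fls_deriv x \<noteq> 0" using fls_deriv_eq_0_at0 sx by blast
  then show ?thesis
    using that[of "- inverse (biquad_y (tp K) y x)" x y] flow_tp fl regular_uminus dy sx sy sxy by
      fastforce
qed

section \<open>Leading coefficients of the alternating sum\<close>

context curve_orbit begin

lemma index_minus_1: "pt (-1) = ps ! (length ps - 1)"
proof -
  have "(- 1) mod int (length ps) = int (length ps) - 1"
    using length_ge by (intro zmod_minus1) linarith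
  then show ?thesis
    using length_ge unfolding periodic_def by (simp add: nat_diff_distrib)
qed

lemma index_small: "0 \<le> i \<Longrightarrow> i \<le> 2 \<Longrightarrow> pt i = ps ! nat i"
  using length_ge by (simp add: periodic_def)

lemma neighbours: "x 1 = x 0" "y 2 = y 1" "y (-1) = y 0"
  and neighbours_other: "y 1 = other K (x 0) (y 0)" "x (-1) = other (tp K) (y 0) (x 0)" "x 2 =
    other (tp K) (y 1) (x 1)"
  using x_even[of 0] y_odd[of 1] y_odd'[of 0] y_even[of 0] x_odd'[of 0] x_odd[of 1] by simp_all

definition total :: "bool \<Rightarrow> bool \<Rightarrow> complex fls" where
  "total a b = signed a (x 0) * signed b (y 0) - signed a (x (-1)) * signed b (y (-1))
    + signed a (x 2) * signed b (y 2) - signed a (x 1) * signed b (y 1)"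

text \<open>By \<open>cert_ok\<close>, a pole can occur only at a position congruent to one of the
  permitted ones modulo the length of the cycle; \<open>pole_x\<close> and \<open>pole_y\<close>
  then show that its point is the one at the permitted position.\<close>

lemma total_regular:
  assumes split: "splits K (\<lambda>x y. signed a x * signed b y)"
    and cert: "cert_ok K a b e r p ps"
    and x0: "at0 x0 0"
    and y0: "\<not> b \<Longrightarrow> at0 y0 0" and y1: "\<not> b \<Longrightarrow> K 0 1 = 0 \<Longrightarrow> at0 (y 1) 0"
  shows "regular (total a b)"
  unfolding total_def
proof (rule split_regular[OF split _ x0])
  have "\<not> p dvd fst (fst (ps ! 2))" using cert by (simp add: cert_ok_def)
  then show "\<not> at0 (x 2) 0"
    using reduces_at0_0[OF reduces_x[of 2]] index_small[of 2] by auto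
  fix n assume "\<not> regular (signed a (x n) * signed b (y n))"
  then consider "\<not> regular (signed a (x n))" | "\<not> regular (signed b (y n))"
    using regular_mult by blast
  then show "\<exists>i\<in>{-1, 0, 1, 2}. even (n - i) \<and> x n = x i \<and> y n = y i"
  proof cases
    case 1
    obtain k where k: "k < length ps" "pt n = ps ! k" "int k = n mod int (length ps)"
      using pt_index by blast
    have "\<not> a"
    proof
      assume a
      then have "p dvd snd (fst (ps ! k))"
        using reduces_infinite[OF reduces_x[of n] x_nz] not_regular_signed[OF x_nz 1] k by simp
      then show False using cert \<open>a\<close> k(1) by (simp add: cert_ok_def)
    qed
    then have sp: "at0 (x n) 0"
      using not_regular_signed[OF x_nz 1] by simp
    then have "p dvd fst (fst (ps ! k))"
      using reduces_at0_0[OF reduces_x[of n]] k by simp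
    then have k1: "k \<le> 1" using cert \<open>\<not> a\<close> k(1) by (simp add: cert_ok_def)
    have "at0 (x (int k)) 0"
      using k1 x0 xy_0 neighbours(1) by (cases k) (auto simp: le_Suc_eq)
    moreover have "n mod int (length ps) = int k mod int (length ps)"
      using k by simp
    moreover have "(K 0 1)\<^sup>2 - 4 * K 0 0 * K 0 2 = 0 \<or> \<not> p dvd (K 0 1)\<^sup>2 - 4 * K 0 0 * K 0 2"
      using cert prime_p not_prime_unit by (auto simp: cert_ok_def split: if_splits)
    moreover have "K 0 0 \<noteq> 0 \<or> K 0 1 \<noteq> 0 \<or> K 0 2 \<noteq> 0"
      using cert by (auto simp: cert_ok_def split: if_splits)
    then have "\<exists>j\<le>2. K 0 j \<noteq> 0"
      by (metis le0 one_le_numeral order_refl)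
    ultimately have "even (n - int k) \<and> x n = x (int k) \<and> y n = y (int k)"
      using pole_x sp by blast
    moreover have "int k \<in> {-1, 0, 1, 2}" using k1 by auto
    ultimately show ?thesis by blast
  next
    case 2
    obtain k where k: "k < length ps" "pt n = ps ! k" "int k = n mod int (length ps)"
      using pt_index by blast
    have "\<not> b"
    proof
      assume b
      then have "p dvd snd (snd (ps ! k))"
        using reduces_infinite[OF reduces_y[of n] y_nz] not_regular_signed[OF y_nz 2] k by simp
      then show False using cert \<open>b\<close> k(1) by (simp add: cert_ok_def)
    qed
    then have sp: "at0 (y n) 0"
      using not_regular_signed[OF y_nz 2] by simp
    then have "p dvd fst (snd (ps ! k))"
      using reduces_at0_0[OF reduces_y[of n]] k by simp
    then have k1: "Suc k = length ps \<or> k = 0 \<or> K 0 1 = 0 \<and> k \<le> 2"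
      using cert \<open>\<not> b\<close> k(1) by (simp add: cert_ok_def)
    \<comment> \<open>The last index of the cycle stands for position \<open>-1\<close>.\<close>
    define i where "i = (if Suc k = length ps then -1 else int k)"
    have "at0 (y i) 0"
      using k1 y0[OF \<open>\<not> b\<close>] y1[OF \<open>\<not> b\<close>] xy_0 neighbours
      by (auto simp: i_def le_Suc_eq numeral_2_eq_2)
    moreover have "n mod int (length ps) = i mod int (length ps)"
    proof (cases "Suc k = length ps")
      case True
      then have "int k = int (length ps) - 1"
        by simp
      also have "\<dots> = (- 1) mod int (length ps)"
        using length_ge by (intro zmod_minus1[symmetric]) linarith
      finally have "int k = (- 1) mod int (length ps)" .
      then show ?thesis
        using k True by (simp add: i_def)
    qed (use k in \<open>simp add: i_def\<close>)
    moreover have c: "K 0 0 = 0" "K 1 0 = 1"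
      using cert \<open>\<not> b\<close> by (auto simp: cert_ok_def split: if_splits)
    then have "(K 1 0)\<^sup>2 - 4 * K 0 0 * K 2 0 = 0 \<or> \<not> p dvd (K 1 0)\<^sup>2 - 4 * K 0 0 * K 2 0"
      using prime_p not_prime_unit by auto
    moreover have "\<exists>j\<le>2. K j 0 \<noteq> 0"
      using c by (intro exI[of _ 1]) auto
    ultimately have "even (n - i) \<and> x n = x i \<and> y n = y i"
      using pole_y sp by blast
    moreover have "i \<in> {-1, 0, 1, 2}" using k1 by (auto simp: i_def)
    ultimately show ?thesis by blast
  qed
qed

lemma not_at0_x:
  assumes "cert_ok K a b e r p ps" "\<not> a"
  shows "\<not> at0 (x (-1)) 0" "\<not> at0 (x 2) 0"
proof -
  have "length ps - 1 < length ps" "\<not> length ps - 1 \<le> 1"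
    using length_ge by auto
  then have "\<not> p dvd fst (fst (ps ! (length ps - 1)))" "\<not> p dvd fst (fst (ps ! 2))"
    using assms unfolding cert_ok_def by metis+
  then show "\<not> at0 (x (-1)) 0" "\<not> at0 (x 2) 0"
    using reduces_at0_0[OF reduces_x[of "-1"]] reduces_at0_0[OF reduces_x[of 2]]
      index_minus_1 index_small[of 2] by auto
qed

lemma regular_y:
  assumes "cert_ok K a b e r p ps" "b"
  shows "regular (y n)"
proof (rule ccontr)
  assume "\<not> regular (y n)"
  then have "p dvd snd (snd (pt n))"
    by (rule reduces_infinite[OF reduces_y y_nz])
  moreover obtain k where "k < length ps" "pt n = ps ! k" using pt_index by blast
  ultimately show False
    using assms unfolding cert_ok_def by metis
qed

lemma other_at0:
  assumes "at0 x0 0" "at0 y0 d" "K 0 2 = 1"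
  shows "at0 (y 1) (- of_int (K 0 1) - d)"
proof -
  have "at0 (other K x0 y0) (- (of_int (K 0 1) / of_int (K 0 2)) - d)"
    unfolding other_def using assms
    by (intro at0_diff at0_uminus at0_divide quad_at0_0) auto
  then show ?thesis using assms(3) neighbours_other(1) xy_0 by simp
qed

text \<open>Only positions 0 and 1 contribute a pole. The coefficient of \<open>1 / x0\<close> is
  the difference \<open>\<theta> - (- e - \<theta>)\<close> of the two roots of
  \<open>K(0, _)\<close>.\<close>

lemma simple_contradiction:
  assumes split: "splits K (\<lambda>x y. signed a x * signed b y)" and cert: "cert_ok K a b e r p ps"
    and ab: "\<not> a" "b" and x0: "at0 x0 0" and y0: "at0 y0 \<theta>" and k: "K 0 1 = e" "K 0 2 = 1"
    and ne: "2 * \<theta> + of_int e \<noteq> 0"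
  shows False
proof -
  have reg_y: "regular (y n)" for n
    by (rule regular_y[OF cert ab(2)])
  define T where "T = total a b"
  have "regular T"
    unfolding T_def by (rule total_regular[OF split cert x0]) (use ab in auto)
  then have 1: "at0 (x0 * T) 0"
    using at0_0_mult x0 by blast
  have "regular (inverse (x 2) * y 2 - inverse (x (-1)) * y (-1))"
    by (intro regular_diff regular_mult regular_inverse x_nz reg_y not_at0_x[OF cert ab(1)])
  then have 2: "at0 (x0 * (inverse (x 2) * y 2 - inverse (x (-1)) * y (-1))) 0"
    using at0_0_mult x0 by blast
  have Te: "T = inverse x0 * y0 - inverse (x (-1)) * y (-1) + inverse (x 2) * y 2 - inverse x0 * y
    1"
    using ab by (simp add: T_def total_def signed_def neighbours xy_0)
  have ii: "x0 * inverse x0 = 1" "y0 * inverse y0 = 1"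
    using x_nz[of 0] y_nz[of 0] by (simp_all add: xy_0)
  have "x0 * T = y0 - y 1 + x0 * (inverse (x 2) * y 2 - inverse (x (-1)) * y (-1))"
    unfolding Te divide_inverse using ii by algebra
  then have "at0 (x0 * T) (\<theta> - (- of_int e - \<theta>) + 0)"
    using at0_add[OF at0_diff[OF y0 other_at0[OF x0 y0 k(2)]] 2] k(1) by simp
  then show False
    using at0_unique[OF 1] ne by fastforce
qed

text \<open>Only position 0 has both coordinates vanishing; every other term of the sum keeps at
  most one of the factors \<open>1 / x0\<close> and \<open>1 / y0\<close>.\<close>

lemma node_contradiction:
  assumes split: "splits K (\<lambda>x y. signed a x * signed b y)" and cert: "cert_ok K a b e r p ps"
    and ab: "\<not> a" "\<not> b" and x0: "at0 x0 0" and y0: "at0 y0 0" and k: "K 0 1 = 1"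
  shows False
proof -
  have ny: "\<not> at0 (y 1) 0"
  proof
    assume "at0 (y 1) 0"
    then have "p dvd fst (snd (ps ! 1))"
      using reduces_at0_0[OF reduces_y[of 1]] index_small[of 1] by simp
    moreover have "1 < length ps" "Suc 1 \<noteq> length ps" using length_ge by auto
    ultimately show False using cert ab k by (auto simp: cert_ok_def)
  qed
  note ri = regular_inverse[OF x_nz not_at0_x(1)[OF cert ab(1)]]
    regular_inverse[OF x_nz not_at0_x(2)[OF cert ab(1)]] regular_inverse[OF y_nz ny]
  define T where "T = total a b"
  have "regular T"
    unfolding T_def by (rule total_regular[OF split cert x0]) (use ab y0 k in auto)
  then have 1: "at0 (x0 * (y0 * T)) 0"
    using at0_0_mult x0 y0 regular_def by metis
  have Te: "T = inverse x0 * inverse y0 - inverse (x (-1)) * inverse y0 + inverse (x 2) * inverse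
    (y 1) - inverse x0 * inverse (y 1)"
    using ab by (simp add: T_def total_def signed_def neighbours xy_0)
  have ii: "x0 * inverse x0 = 1" "y0 * inverse y0 = 1"
    using x_nz[of 0] y_nz[of 0] by (simp_all add: xy_0)
  have eq: "x0 * (y0 * T) = 1 - x0 * inverse (x (-1)) + x0 * (y0 * (inverse (x 2) * inverse (y
    1))) - y0 * inverse (y 1)"
    unfolding Te divide_inverse using ii by algebra
  have "regular (y0 * (inverse (x 2) * inverse (y 1)))"
    using y0 by (intro regular_mult ri) (auto simp: regular_def)
  then have "at0 (x0 * (y0 * T)) (1 - 0 + 0 - 0)"
    unfolding eq using ri x0 y0
    by (intro at0_diff at0_add at0_1 at0_0_mult)
  then show False
    using at0_unique[OF 1] by fastforce
qed

text \<open>The sum of the two roots \<open>y0\<close> and \<open>y 1\<close> is a multiple of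
  \<open>x0\<close>, which by tangency is negligible against \<open>y0\<close>.\<close>

lemma double_ratio:
  assumes x0: "at0 x0 0" and xy: "at0 (x0 / y0) 0" and k: "K 0 1 = 0" "K 0 2 = 1"
  shows "at0 (y 1 / y0) (- 1)"
proof -
  have q2: "at0 (quad K 2 x0) 1"
    using quad_at0_0[OF x0, of K 2] k by simp
  then have nz: "quad K 2 x0 \<noteq> 0" "y0 \<noteq> 0"
    using at0_unique[OF at0_0] y_nz[of 0] xy_0 by force+
  have "quad K 1 x0 = x0 * (of_int (K 1 1) + of_int (K 2 1) * x0)"
    using k(1) by (simp add: quad_def algebra_simps power2_eq_square)
  then have "y 1 / y0 = - (x0 / y0 * (of_int (K 1 1) + of_int (K 2 1) * x0)) / quad K 2 x0 - 1"
    using nz neighbours_other(1) xy_0 by (simp add: other_def field_simps)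
  moreover have "at0 \<dots> (- (0 * (of_int (K 1 1) + of_int (K 2 1) * 0)) / 1 - 1)"
    using q2 x0 xy
    by (intro at0_diff at0_divide at0_uminus at0_mult at0_add
        at0_of_int at0_1) auto
  ultimately show ?thesis by simp
qed

text \<open>\<open>y0\<close> and \<open>y 1\<close> are opposite to first order. This cancels the
  signs of the alternating sum, so that in each case the normalized limit is 2.\<close>

lemma double_contradiction:
  assumes split: "splits K (\<lambda>x y. signed a x * signed b y)" and cert: "cert_ok K a b e r p ps"
    and ab: "a \<Longrightarrow> \<not> b \<and> K 2 0 = 1" and x0: "at0 x0 0" and y0: "at0 y0 0"
    and xy: "at0 (x0 / y0) 0" and k: "K 1 0 = 1" "K 0 1 = 0" "K 0 2 = 1"
  shows False
proof -
  have q: "at0 (y 1 / y0) (- 1)" by (rule double_ratio) (fact x0 xy k)+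
  have nz: "x0 \<noteq> 0" "y0 \<noteq> 0" using x_nz[of 0] y_nz[of 0] xy_0 by auto
  have q': "at0 (y0 / y 1) (- 1)"
    using at0_inverse[OF q] by simp
  have y1: "at0 (y 1) 0"
    using at0_mult[OF q y0] nz by simp
  define T where "T = total a b"
  have T: "regular T"
    unfolding T_def by (rule total_regular[OF split cert x0]) (use y0 y1 in auto)
  consider "\<not> a" "\<not> b" | "\<not> a" "b" | "a" "\<not> b" "K 2 0 = 1" using ab by blast
  then show False
  proof cases
    case 1
    note ri = regular_inverse[OF x_nz not_at0_x(1)[OF cert 1(1)]]
      regular_inverse[OF x_nz not_at0_x(2)[OF cert 1(1)]]
    have z: "at0 (x0 * (y0 * T)) 0"
      using at0_0_mult x0 y0 T regular_def by metis
    have Te: "T = inverse x0 * inverse y0 - inverse (x (-1)) * inverse y0 + inverse (x 2) *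
      inverse (y 1) - inverse x0 * inverse (y 1)"
      using 1 by (simp add: T_def total_def signed_def neighbours xy_0)
    have ii: "x0 * inverse x0 = 1" "y0 * inverse y0 = 1"
      using x_nz[of 0] y_nz[of 0] by (simp_all add: xy_0)
    have eq: "x0 * (y0 * T) = 1 - x0 * inverse (x (-1)) + x0 * inverse (x 2) * (y0 / y 1) - y0 / y
      1"
      unfolding Te divide_inverse using ii by algebra
    have "at0 (x0 * (y0 * T)) (1 - 0 + 0 * (- 1) - (- 1))"
      unfolding eq using ri x0 q'
      by (intro at0_diff at0_add at0_1 at0_0_mult at0_mult)
    then show False
      using at0_unique[OF z] by fastforce
  next
    case 2
    have reg_y: "regular (y n)" for n
      by (rule regular_y[OF cert 2(2)])
    have r: "regular (inverse (x 2) * y 2 - inverse (x (-1)) * y (-1))"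
      by (intro regular_diff regular_mult regular_inverse x_nz reg_y not_at0_x[OF cert 2(1)])
    have z: "at0 (x0 / y0 * T) 0"
      using at0_0_mult xy T by blast
    have Te: "T = inverse x0 * y0 - inverse (x (-1)) * y (-1) + inverse (x 2) * y 2 - inverse x0 *
      y 1"
      using 2 by (simp add: T_def total_def signed_def neighbours xy_0)
    have ii: "x0 * inverse x0 = 1" "y0 * inverse y0 = 1"
      using x_nz[of 0] y_nz[of 0] by (simp_all add: xy_0)
    have eq: "x0 / y0 * T = 1 - y 1 / y0 + x0 / y0 * (inverse (x 2) * y 2 - inverse (x (-1)) * y
      (-1))"
      unfolding Te divide_inverse using ii by algebra
    have "at0 (x0 / y0 * T) (1 - (- 1) + 0)"
      unfolding eq using r xy q
      by (intro at0_diff at0_add at0_1 at0_0_mult)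
    then show False
      using at0_unique[OF z] by fastforce
  next
    case 3
    \<comment> \<open>At the origin the root conjugate to \<open>x = 0\<close> is
      \<open>- K 1 0 / K 2 0 = -1\<close>.\<close>
    have o: "at0 (other (tp K) v u) (- 1)" if "at0 u 0" "at0 v 0" for u v
    proof -
      have "at0 (other (tp K) v u) (- (of_int (tp K 0 1) / of_int (tp K 0 2)) - 0)"
        unfolding other_def using that 3 k
        by (intro at0_diff at0_uminus at0_divide quad_at0_0)
          (auto simp: tp_def)
      then show ?thesis using 3 k by (simp add: tp_def)
    qed
    have x12: "at0 (x (-1)) (- 1)" "at0 (x 2) (- 1)"
      using o x0 y0 y1 neighbours neighbours_other xy_0 by simp_all
    have z: "at0 (y0 * T) 0"
      using at0_0_mult y0 T by blast
    have Te: "T = x0 * inverse y0 - x (-1) * inverse y0 + x 2 * inverse (y 1) - x0 * inverse (y 1)"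
      using 3 by (simp add: T_def total_def signed_def neighbours xy_0)
    have ii: "x0 * inverse x0 = 1" "y0 * inverse y0 = 1"
      using x_nz[of 0] y_nz[of 0] by (simp_all add: xy_0)
    have eq: "y0 * T = x0 - x (-1) + x 2 * (y0 / y 1) - x0 * (y0 / y 1)"
      unfolding Te divide_inverse using ii by algebra
    have "at0 (y0 * T) (0 - (- 1) + (- 1) * (- 1) - 0 * (- 1))"
      unfolding eq using x0 x12 q'
      by (intro at0_diff at0_add at0_mult)
    then show False
      using at0_unique[OF z] by fastforce
  qed
qed

end

context reduction begin

text \<open>One nonconstant coordinate suffices: the links at position 0 exclude a horizontal or
  vertical line through the starting point.\<close>

lemma cycle_orbit:
  assumes cyc: "cycle_ok K p ps" and fl: "flow K w x y" and w: "regular w"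
    and d: "fls_deriv x \<noteq> 0 \<or> fls_deriv y \<noteq> 0"
    and red: "case ps ! 0 of ((a, v), c, d) \<Rightarrow> reduces x a v \<and> reduces y c d"
  shows "curve_orbit \<theta> e r p K ps w x y"
proof -
  have p0: "periodic ps 0 = ps ! 0" by (simp add: periodic_def)
  have K: "biquad K x y = 0" using fl by (simp add: flow_def)
  obtain a' v c d where P: "ps ! 0 = ((a', v), c, d)" by (metis surj_pair)
  then have red': "reduces x a' v" "reduces y c d" using red by auto
  have "\<exists>j\<le>2. \<not> p dvd hquad (tp K) j c d"
    using periodic_link[OF cyc, of "-1"] P p0
    by (auto simp: link_ok_def split: prod.splits dest!: conj_ok_nondegenerate)
  then have dy: "fls_deriv y \<noteq> 0" if "fls_deriv x \<noteq> 0"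
    using nonconstant[OF K that red'(2)] by blast
  have nd: "\<exists>j\<le>2. \<not> p dvd hquad (tp (tp K)) j a' v"
    using periodic_link[OF cyc, of 0] P p0
    by (auto simp: link_ok_def split: prod.splits dest!: conj_ok_nondegenerate)
  have "biquad (tp K) y x = 0" using K by (simp add: biquad_tp)
  then have dx: "fls_deriv x \<noteq> 0" if "fls_deriv y \<noteq> 0"
    using nonconstant[OF _ that red'(1) nd] by blast
  have "fls_deriv x \<noteq> 0" "fls_deriv y \<noteq> 0" using d dx dy by blast+
  then show ?thesis
    using cyc fl w red by unfold_locales simp_all
qed

theorem not_splits:
  assumes cert: "cert_ok K a b e r p ps"
  shows "\<not> splits K (\<lambda>x y. signed a x * signed b y)"
proof
  assume split: "splits K (\<lambda>x y. signed a x * signed b y)"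
  have cyc: "cycle_ok K p ps" using cert by (simp add: cert_ok_def)
  have red0: "red 0 0" using red_of_int[of 0] by simp
  show False
  proof (cases "K 0 0 = 1")
    case True
    then have k: "K 0 1 = e" "K 0 2 = 1" "ps ! 0 = ((0, 1), (r, 1))" "\<not> a" "b" "\<not> p dvd e\<^sup>2 - 4"
      using cert by (auto simp: cert_ok_def)
    have ne: "of_int e + 2 * \<theta> \<noteq> 0"
    proof
      assume "of_int e + 2 * \<theta> = 0"
      then have "Im (of_int e + 2 * \<theta>) = 0" by simp
      then show False using Im_theta by simp
    qed
    obtain w x y where s: "flow K w x y" "regular w" "fls_deriv x = 1" "at0 x 0" "at0 y \<theta>"
      by (rule start_simple[of K \<theta>]) (use True k theta ne in auto)
    have "curve_orbit \<theta> e r p K ps w x y"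
      by (rule cycle_orbit[OF cyc s(1,2)])
        (use s k red0 red_theta reduces_at0 in auto)
    then interpret curve_orbit \<theta> e r p K ps w x y .
    show False
      by (rule simple_contradiction[OF split cert k(4,5) s(4,5) k(1,2)]) (use ne in \<open>simp add:
        add.commute\<close>)
  next
    case False
    then have k: "K 0 0 = 0" "K 1 0 = 1" "ps ! 0 = ((0, 1), (0, 1))"
      "K 0 1 = 1 \<and> \<not> a \<and> \<not> b \<or> K 0 1 = 0 \<and> K 0 2 = 1 \<and> (a \<longrightarrow> \<not> b \<and> K 2 0 = 1)"
      using cert by (auto simp: cert_ok_def)
    obtain w x y where s: "flow K w x y" "regular w" "fls_deriv x \<noteq> 0" "fls_deriv y = 1"
      "at0 x 0" "at0 y 0" "at0 (x / y) (- of_int (K 0 1))"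
      by (rule start_node[of K]) (use k in auto)
    have "curve_orbit \<theta> e r p K ps w x y"
      by (rule cycle_orbit[OF cyc s(1,2)])
        (use s k red0 reduces_at0 in auto)
    then interpret curve_orbit \<theta> e r p K ps w x y .
    show False
    proof (cases "K 0 1 = 1")
      case True
      then show ?thesis using node_contradiction[OF split cert _ _ s(5,6)] k(4) by auto
    next
      case False
      then show ?thesis
        using double_contradiction[OF split cert _ s(5,6)] k s(7) by auto
    qed
  qed
qed

end

section \<open>Specialization of a decoupled model\<close>

definition is_hom :: "('a::comm_ring_1 \<Rightarrow> 'b::comm_ring_1) \<Rightarrow> bool" where
  "is_hom h \<longleftrightarrow> h 0 = 0 \<and> h 1 = 1 \<and> (\<forall>a b. h (a + b) = h a + h b) \<and> (\<forall>a b. h (a * b) = h a * h b)"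

lemma is_hom_simps:
  assumes "is_hom h"
  shows "h 0 = 0" "h 1 = 1" "h (a + b) = h a + h b" "h (a * b) = h a * h b"
    "h (- a) = - h a" "h (a - b) = h a - h b" "h (a ^ n) = h a ^ n"
proof -
  show 1: "h 0 = 0" "h 1 = 1" "h (a + b) = h a + h b" "h (a * b) = h a * h b" for a b
    using assms by (auto simp: is_hom_def)
  have "h (- a) + h a = 0" for a using 1(3)[of "- a" a] 1(1) by simp
  then show m: "h (- a) = - h a" for a by (simp add: eq_neg_iff_add_eq_0)
  show "h (a - b) = h a - h b" using 1(3)[of a "- b"] m by simp
  show "h (a ^ n) = h a ^ n" by (induction n) (simp_all add: 1)
qed

text \<open>With a homomorphism on the coefficients, evaluation can be iterated over the nested
  polynomial rings.\<close>

definition heval :: "('a::comm_ring_1 \<Rightarrow> 'b::comm_ring_1) \<Rightarrow> 'b \<Rightarrow> 'a poly \<Rightarrow> 'b" where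
  "heval h X P = poly (map_poly h P) X"

lemma heval_pCons:
  assumes "is_hom h"
  shows "heval h X 0 = 0" "heval h X (pCons a P) = h a + X * heval h X P"
  using is_hom_simps(1)[OF assms] by (simp_all add: heval_def map_poly_pCons)

lemma is_hom_heval:
  assumes h: "is_hom h"
  shows "is_hom (heval h X)"
proof -
  note hs = is_hom_simps[OF h] heval_pCons[OF h]
  have add: "heval h X (P + Q) = heval h X P + heval h X Q" for P Q
    by (induction P Q rule: poly_induct2) (simp_all add: hs algebra_simps)
  have smult: "heval h X (smult a P) = h a * heval h X P" for a P
    by (induction P) (simp_all add: hs algebra_simps)
  have mult: "heval h X (P * Q) = heval h X P * heval h X Q" for P Q
    by (induction P) (simp_all add: hs add smult algebra_simps)
  show ?thesis
    unfolding is_hom_def using add mult by (simp add: hs one_pCons)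
qed

lemma heval_const_lift:
  assumes "is_hom h"
  shows "heval (heval h X) Y (map_poly (\<lambda>c. [:c:]) P) = heval h Y P"
proof (induction P)
  case (pCons a P)
  have "map_poly (\<lambda>c. [:c:]) (pCons a P) = pCons [:a:] (map_poly (\<lambda>c. [:c:]) P)"
    by (intro map_poly_pCons) simp
  then show ?case
    using pCons.IH by (simp add: heval_pCons[OF assms] heval_pCons[OF is_hom_heval[OF assms]])
qed (simp add: heval_pCons[OF assms] heval_pCons[OF is_hom_heval[OF assms]])

definition eval3 :: "('k::field_char_0 \<Rightarrow> 'b::comm_ring_1) \<Rightarrow> 'b \<Rightarrow> 'b \<Rightarrow> 'b \<Rightarrow> 'k poly poly poly \<Rightarrow> 'b"
  where
  "eval3 h T X Y = heval (heval (heval h T) X) Y"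

lemma is_hom_eval3: "is_hom h \<Longrightarrow> is_hom (eval3 h T X Y)"
  unfolding eval3_def by (intro is_hom_heval)

lemma eval3_vars:
  assumes "is_hom h"
  shows "eval3 h T X Y (const3 c) = h c" "eval3 h T X Y var_t = T"
    "eval3 h T X Y var_x = X" "eval3 h T X Y var_y = Y"
    "eval3 h T X Y [:p:] = heval (heval h T) X p"
    "eval3 h T X Y (map_poly (\<lambda>c. [:c:]) p) = heval (heval h T) Y p"
proof -
  note hp = heval_pCons[OF assms] heval_pCons[OF is_hom_heval[OF assms]]
    heval_pCons[OF is_hom_heval[OF is_hom_heval[OF assms]]]
    is_hom_simps(1,2)[OF assms] one_pCons
  show "eval3 h T X Y (const3 c) = h c" "eval3 h T X Y var_t = T"
    "eval3 h T X Y var_x = X" "eval3 h T X Y var_y = Y"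
    "eval3 h T X Y [:p:] = heval (heval h T) X p"
    by (simp_all add: eval3_def hp const3_def var_t_def var_x_def var_y_def)
  show "eval3 h T X Y (map_poly (\<lambda>c. [:c:]) p) = heval (heval h T) Y p"
    unfolding eval3_def by (rule heval_const_lift[OF is_hom_heval[OF assms]])
qed

lemma small_steps_eq:
  "small_steps = {(-1, -1), (-1, 0), (-1, 1), (0, -1), (0, 1), (1, -1), (1, 0), (1, 1)}"
  unfolding small_steps_def by auto

lemma kernel_eq:
  "kernel w = var_t * (const3 (w (-1, -1)) + const3 (w (-1, 0)) * var_y + const3 (w (-1, 1)) *
    var_y\<^sup>2
     + const3 (w (0, -1)) * var_x + const3 (w (0, 1)) * var_x * var_y\<^sup>2 + const3 (w (1, -1)) *
       var_x\<^sup>2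
     + const3 (w (1, 0)) * var_x\<^sup>2 * var_y + const3 (w (1, 1)) * var_x\<^sup>2 * var_y\<^sup>2) - var_x * var_y"
  unfolding kernel_def small_steps_eq by (simp add: numeral_2_eq_2 algebra_simps)

text \<open>Coefficients of \<open>x y (S(x, y) - s)\<close>, where \<open>s = 1 / t\<close>, after the substitution \<open>1 / x\<close> for
  \<open>x\<close> unless \<open>a\<close> and \<open>1 / y\<close> for \<open>y\<close> unless \<open>b\<close>.\<close>

definition model :: "step set \<Rightarrow> bool \<Rightarrow> bool \<Rightarrow> int \<Rightarrow> nat \<Rightarrow> nat \<Rightarrow> int" where
  "model S a b s i j = (if i = 1 \<and> j = 1 then - s
     else if ((if a then int i - 1 else 1 - int i), (if b then int j - 1 else 1 - int j)) \<in> S then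
       1 else 0)"

lemma heval_at0:
  assumes "at0 z c"
  shows "at0 (heval fls_const z P) (poly P c)"
proof -
  have "is_hom (fls_const :: complex \<Rightarrow> _)"
    by (simp add: is_hom_def fls_plus_const)
  then show ?thesis
    using assms
    by (induction P) (auto simp: heval_pCons intro!: at0_0 at0_add at0_const at0_mult)
qed

lemma is_hom_fls_const: "is_hom (fls_const :: complex \<Rightarrow> complex fls)"
  by (simp add: is_hom_def fls_plus_const)

text \<open>A nonconstant series is transcendental over the constants: a relation
  \<open>P(z) = 0\<close> would give \<open>P'(z) = 0\<close>, of smaller degree, after cancelling
  \<open>fls_deriv z\<close>.\<close>

lemma heval_nonzero:
  assumes "fls_deriv z \<noteq> 0" "P \<noteq> 0"
  shows "heval fls_const z P \<noteq> (0 :: complex fls)"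
  using assms(2)
proof (induction "degree P" arbitrary: P)
  case 0
  then obtain c where "P = [:c:]" "c \<noteq> 0" by (metis degree_eq_zeroE pCons_0_0)
  then show ?case by (simp add: heval_pCons[OF is_hom_fls_const])
next
  case (Suc n)
  have d: "fls_deriv (heval fls_const z Q) = fls_deriv z * heval fls_const z (pderiv Q)" for Q
  proof (induction Q)
    case (pCons a Q)
    then show ?case
      by (simp add: heval_pCons[OF is_hom_fls_const] pderiv_pCons
          is_hom_simps(3)[OF is_hom_heval[OF is_hom_fls_const]] algebra_simps)
  qed (simp add: heval_pCons[OF is_hom_fls_const])
  have "degree (pderiv P) = n" using Suc.hyps(2) by (simp add: degree_pderiv)
  moreover have "pderiv P \<noteq> 0"
    using Suc.hyps(2) by (metis pderiv_eq_0_iff nat.distinct(1))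
  ultimately have "heval fls_const z (pderiv P) \<noteq> 0" using Suc.hyps(1) by blast
  then show ?case using d[of P] assms(1) by auto
qed

definition specialize_t :: "rat \<Rightarrow> rat poly poly \<Rightarrow> complex poly" where
  "specialize_t t p = map_poly (\<lambda>c. of_rat (poly c t)) p"

lemma heval_specialize_t:
  "heval (heval (\<lambda>c. fls_const (of_rat c)) (fls_const (of_rat t))) z p = heval fls_const z
    (specialize_t t p)"
proof -
  have h: "is_hom (\<lambda>c. fls_const (of_rat c) :: complex fls)"
    by (simp add: is_hom_def fls_plus_const of_rat_add of_rat_mult)
  have c: "heval (\<lambda>c. fls_const (of_rat c)) (fls_const (of_rat t)) c = (fls_const (of_rat (poly c
    t)) :: complex fls)" for c
    by (induction c) (simp_all add: heval_pCons[OF h] fls_plus_const of_rat_add of_rat_mult)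
  have "map_poly (\<lambda>c. of_rat (poly c t)) (pCons a q) = pCons (of_rat (poly a t) :: complex)
    (specialize_t t q)" for a q
    unfolding specialize_t_def by (intro map_poly_pCons) simp
  then have s: "specialize_t t (pCons a q) = pCons (of_rat (poly a t)) (specialize_t t q)" for a q
    by (simp add: specialize_t_def)
  define H where "H = heval (\<lambda>c. fls_const (of_rat c)) (fls_const (of_rat t) :: complex fls)"
  have H: "is_hom H" unfolding H_def by (rule is_hom_heval[OF h])
  have "specialize_t t 0 = 0" by (simp add: specialize_t_def)
  then have "heval H z p = heval fls_const z (specialize_t t p)"
    by (induction p) (simp_all add: heval_pCons[OF H] heval_pCons[OF is_hom_fls_const] c[folded
      H_def] s)
  then show ?thesis by (simp add: H_def)
qed

text \<open>The leading coefficient of \<open>q\<close> is a nonzero polynomial in \<open>t\<close>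
  and has finitely many roots.\<close>

lemma specialize_t_nonzero:
  assumes "q \<noteq> 0"
  shows "finite {t. specialize_t t q = 0}"
proof -
  let ?c = "coeff q (degree q)"
  have "poly ?c t = 0" if "specialize_t t q = 0" for t
  proof -
    have "coeff (specialize_t t q) (degree q) = of_rat (poly ?c t)"
      unfolding specialize_t_def by (intro coeff_map_poly) simp
    then show ?thesis using that by simp
  qed
  then have "{t. specialize_t t q = 0} \<subseteq> {t. poly ?c t = 0}" by blast
  moreover have "finite {t. poly ?c t = 0}"
    using assms by (intro poly_roots_finite) simp
  ultimately show ?thesis by (rule finite_subset)
qed

lemma is_hom_comp:
  "is_hom g \<Longrightarrow> is_hom h \<Longrightarrow> is_hom (\<lambda>c. g (h c))"
  by (simp add: is_hom_def)

lemma heval_comp: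
  assumes "is_hom g" "is_hom h"
  shows "g (heval h X P) = heval (\<lambda>c. g (h c)) (g X) P"
  by (induction P) (simp_all add: heval_pCons[OF assms(2)] heval_pCons[OF is_hom_comp[OF assms]]
      is_hom_simps[OF assms(1)])

lemma is_hom_const3: "is_hom const3"
  by (simp add: is_hom_def const3_def one_pCons)

text \<open>The images for \<open>var_x\<close> and \<open>var_y\<close> are the subrings
  \<open>k[x, t]\<close> and \<open>k[y, t]\<close>. Being ranges of homomorphisms they are closed
  under the ring operations, so that membership of an explicit polynomial follows by introduction
  rules.\<close>

definition embed :: "'k::field_char_0 poly poly poly \<Rightarrow> 'k poly poly \<Rightarrow> 'k poly poly poly" where
  "embed X = heval (heval const3 var_t) X"

lemma is_hom_embed: "is_hom (embed X)"
  unfolding embed_def by (intro is_hom_heval is_hom_const3)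

lemma eval3_identity: "eval3 const3 var_t var_x var_y P = P"
proof -
  note h = heval_pCons[OF is_hom_const3] heval_pCons[OF is_hom_heval[OF is_hom_const3]]
    heval_pCons[OF is_hom_heval[OF is_hom_heval[OF is_hom_const3]]]
  have t: "heval const3 var_t c = [:[:c:]:]" for c :: "'a poly"
  proof (induction c)
    case (pCons a c)
    show ?case unfolding h pCons.IH by (simp add: const3_def var_t_def)
  qed (simp add: h)
  have x: "heval (heval const3 var_t) var_x p = [:p:]" for p :: "'a poly poly"
  proof (induction p)
    case (pCons a p)
    show ?case unfolding h pCons.IH unfolding t by (simp add: var_x_def)
  qed (simp add: h)
  show ?thesis
    unfolding eval3_def
  proof (induction P)
    case (pCons a P)
    show ?case unfolding h pCons.IH unfolding x by (simp add: var_y_def)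
  qed (simp add: h)
qed

lemma embed_x: "embed var_x p = [:p:]" and embed_y: "embed var_y p = map_poly (\<lambda>c. [:c:]) p"
  using eval3_vars(5,6)[OF is_hom_const3, of var_t var_x var_y p] by (simp_all add: eval3_identity
    embed_def)

lemma range_is_hom:
  assumes "is_hom h"
  shows "a \<in> range h \<Longrightarrow> b \<in> range h \<Longrightarrow> a + b \<in> range h"
    and "a \<in> range h \<Longrightarrow> b \<in> range h \<Longrightarrow> a - b \<in> range h"
    and "a \<in> range h \<Longrightarrow> b \<in> range h \<Longrightarrow> a * b \<in> range h"
    and "a \<in> range h \<Longrightarrow> - a \<in> range h" and "a \<in> range h \<Longrightarrow> a ^ n \<in> range h" and "1 \<in> range h"
  by (auto simp flip: is_hom_simps[OF assms])

lemma numeral_in_range: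
  assumes "is_hom h"
  shows "numeral n \<in> range h"
proof -
  have "of_nat k \<in> range h" for k
    by (induction k) (auto intro: range_is_hom[OF assms] simp flip: is_hom_simps(1)[OF assms])
  then show ?thesis by (metis of_nat_numeral)
qed

lemma generators_in_range:
  "const3 c \<in> range (embed X)" "var_t \<in> range (embed X)" "X \<in> range (embed X)"
proof -
  note h = heval_pCons[OF is_hom_const3] heval_pCons[OF is_hom_heval[OF is_hom_const3]]
    is_hom_simps(1,2)[OF is_hom_const3]
    is_hom_simps(2)[OF is_hom_heval[OF is_hom_const3]]
  have "embed X [:[:c:]:] = const3 c" "embed X [:[:0, 1:]:] = var_t" "embed X [:0, 1:] = X"
    unfolding embed_def by (simp_all add: h)
  then show "const3 c \<in> range (embed X)" "var_t \<in> range (embed X)" "X \<in> range (embed X)"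
    by (metis rangeI)+
qed

lemmas in_range_intros = range_is_hom[OF is_hom_embed] numeral_in_range[OF is_hom_embed]
  generators_in_range

lemma fract_sum_eq_iff:
  fixes P Q P' Q' Z N D :: "'a::idom"
  assumes "Q \<noteq> 0" "Q' \<noteq> 0" "D \<noteq> 0"
  shows "Fract P Q + Fract P' Q' - Fract Z 1 = Fract N D \<longleftrightarrow>
    (P * Q' + P' * Q - Z * (Q * Q')) * D = N * (Q * Q')"
  using assms by (simp add: eq_fract)

lemma decoupled_iff:
  "decoupled w \<longleftrightarrow> (\<exists>P\<in>range (embed var_x). \<exists>Q\<in>range (embed var_x).
     \<exists>P'\<in>range (embed var_y). \<exists>Q'\<in>range (embed var_y). \<exists>N D. Q \<noteq> 0 \<and> Q' \<noteq> 0 \<and> D \<noteq> 0 \<and>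
     coprime N D \<and> kernel w dvd N \<and> (P * Q' + P' * Q - var_x * var_y * (Q * Q')) * D = N * (Q *
       Q'))"
  (is "_ = ?R")
proof
  assume "decoupled w"
  then obtain p q p' q' N D where *: "q \<noteq> 0" "q' \<noteq> 0" "D \<noteq> 0" "coprime N D" "kernel w dvd N"
    and eq: "Fract (embed var_x p) (embed var_x q) + Fract (embed var_y p') (embed var_y q')
      - Fract (var_x * var_y) 1 = Fract N D"
    unfolding decoupled_def rational_functions_x_def rational_functions_y_def embed_x embed_y by
      blast
  have nz: "embed var_x q \<noteq> 0" "embed var_y q' \<noteq> 0"
    using * by (simp_all add: embed_x embed_y map_poly_eq_0_iff)
  show ?R
    using * nz eq unfolding fract_sum_eq_iff[OF nz *(3)] by blast
next
  assume ?R
  then obtain p q p' q' N D where *: "embed var_x q \<noteq> 0" "embed var_y q' \<noteq> 0" "D \<noteq> 0" "coprime N D"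
    "kernel w dvd N" and eq: "(embed var_x p * embed var_y q' + embed var_y p' * embed var_x q
      - var_x * var_y * (embed var_x q * embed var_y q')) * D = N * (embed var_x q * embed var_y
        q')"
    by blast
  have "q \<noteq> 0" "q' \<noteq> 0" using *(1,2) by (auto simp: embed_x embed_y)
  then have "Fract (embed var_x p) (embed var_x q) \<in> rational_functions_x"
    "Fract (embed var_y p') (embed var_y q') \<in> rational_functions_y"
    unfolding rational_functions_x_def rational_functions_y_def embed_x embed_y by blast+
  then show "decoupled w"
    using * eq unfolding fract_sum_eq_iff[OF *(1-3), symmetric] decoupled_def by blast
qed

text \<open>Being coprime to \<open>N\<close>, the reduced denominator \<open>D\<close> divides the
  product of the denominators of \<open>F\<close> and \<open>G\<close>. The numerator over that
  product is therefore a multiple of \<open>N\<close>, hence of the kernel.\<close>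

lemma decoupled_polynomial_identity:
  fixes w :: "step \<Rightarrow> rat"
  assumes "decoupled w"
  obtains p q p' q' where "q \<noteq> 0" "q' \<noteq> 0"
    "kernel w dvd embed var_x p * embed var_y q' + embed var_y p' * embed var_x q
      - var_x * var_y * (embed var_x q * embed var_y q')"
proof -
  obtain p q p' q' N D where *: "embed var_x q \<noteq> 0" "embed var_y q' \<noteq> 0" "D \<noteq> 0" "coprime N D"
    "kernel w dvd N" and cross: "(embed var_x p * embed var_y q' + embed var_y p' * embed var_x q
      - var_x * var_y * (embed var_x q * embed var_y q')) * D = N * (embed var_x q * embed var_y
        q')"
    using assms unfolding decoupled_iff by blast
  have "D dvd N * (embed var_x q * embed var_y q')" using cross by (metis dvd_triv_right)
  moreover have "coprime D N"
    using *(4) by (simp only: coprime_commute)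
  ultimately have "D dvd embed var_x q * embed var_y q'"
    using coprime_dvd_mult_right_iff[of D N "embed var_x q * embed var_y q'"] by simp
  then obtain E where "embed var_x q * embed var_y q' = D * E" by (rule dvdE)
  then have "embed var_x p * embed var_y q' + embed var_y p' * embed var_x q
      - var_x * var_y * (embed var_x q * embed var_y q') = N * E"
    using cross *(3) by (simp add: mult_ac)
  then have "kernel w dvd embed var_x p * embed var_y q' + embed var_y p' * embed var_x q
      - var_x * var_y * (embed var_x q * embed var_y q')"
    using *(5) by simp
  moreover have "q \<noteq> 0" "q' \<noteq> 0" using *(1,2) by (auto simp: embed_x embed_y)
  ultimately show ?thesis by (rule that[rotated 2])
qed

lemma finite_val_set: "finite A \<Longrightarrow> finite {s :: int. 1 / of_int s \<in> (A :: rat set)}"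
proof -
  assume "finite A"
  moreover have "inj (\<lambda>s :: int. 1 / of_int s :: rat)"
    by (intro injI) simp
  ultimately show ?thesis
    using finite_vimageI[of A "\<lambda>s. 1 / of_int s"] by (simp add: vimage_def)
qed

text \<open>At \<open>t = 1 / s\<close> the kernel is \<open>1 / s\<close> times the equation of the
  curve. The only values lost are \<open>s = 0\<close> and those at which a denominator becomes the
  zero polynomial.\<close>

theorem decoupled_splits:
  assumes "decoupled (unweighted S)"
  shows "finite {s. \<not> splits (model S True True s) (\<lambda>x y. x * y)}"
proof -
  obtain p q p' q' where nz: "q \<noteq> 0" "q' \<noteq> 0" and K: "kernel (unweighted S) dvd
      embed var_x p * embed var_y q' + embed var_y p' * embed var_x q
      - var_x * var_y * (embed var_x q * embed var_y q')"
    by (rule decoupled_polynomial_identity[OF assms])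
  have main: "splits (model S True True s) (\<lambda>x y. x * y)"
    if s: "s \<noteq> 0" "specialize_t (1 / of_int s) q \<noteq> 0" "specialize_t (1 / of_int s) q' \<noteq> 0" for s
  proof -
    define t :: rat where "t = 1 / of_int s"
    define h :: "rat \<Rightarrow> complex fls" where "h = (\<lambda>c. fls_const (of_rat c))"
    have h: "is_hom h"
      by (simp add: h_def is_hom_def fls_plus_const of_rat_add of_rat_mult)
    define ev where "ev p z = heval fls_const z (specialize_t t p)" for p z
    have ev: "heval (heval h (h t)) z p = ev p z" for z p
      unfolding ev_def h_def by (rule heval_specialize_t)
    have regular_quot: "regular (ev p z / ev q z)"
      if nr: "val0 z \<notin> insert None (Some ` {c. poly (specialize_t t q) c = 0})" for p q z
    proof -
      obtain c where c: "val0 z = Some c" using nr by (cases "val0 z") auto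
      then have "poly (specialize_t t q) c \<noteq> 0" using nr by auto
      then show ?thesis
        unfolding regular_def ev_def
        using at0_divide[OF heval_at0 heval_at0] c val0_Some by blast
    qed
    have "ev p x / ev q x + ev p' y / ev q' y = x * y"
      if dx: "fls_deriv x \<noteq> 0" and dy: "fls_deriv y \<noteq> 0" and on: "biquad (model S True True s) x y
        = 0" for x y
    proof -
      have st: "of_int s * h t = 1"
        using s(1) by (simp add: h_def t_def of_rat_divide fls_of_int)
      define c :: "step \<Rightarrow> complex fls" where "c z = (if z \<in> S then 1 else 0)" for z
      have hu: "h (unweighted S z) = c z" for z
        by (simp add: unweighted_def h_def c_def)
      have hm: "(of_int (model S True True s i j) :: complex fls)
          = (if i = 1 \<and> j = 1 then - of_int s else c (int i - 1, int j - 1))" for i j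
        by (simp add: model_def c_def)
      have "eval3 h (h t) x y (kernel (unweighted S)) = h t * (biquad (model S True True s) x y +
        of_int s * x * y) - x * y"
        unfolding kernel_eq
        by (simp add: is_hom_simps[OF is_hom_eval3[OF h]] eval3_vars[OF h] hu
            biquad_def quad_def hm algebra_simps power2_eq_square)
      also have "\<dots> = (of_int s * h t - 1) * (x * y)"
        unfolding on by (simp add: algebra_simps)
      also have "\<dots> = 0" unfolding st by simp
      finally have k0: "eval3 h (h t) x y (kernel (unweighted S)) = 0" .
      obtain M where M: "embed var_x p * embed var_y q' + embed var_y p' * embed var_x q
        - var_x * var_y * (embed var_x q * embed var_y q') = kernel (unweighted S) * M"
        using K by blast
      have "eval3 h (h t) x y (embed var_x p * embed var_y q' + embed var_y p' * embed var_x q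
          - var_x * var_y * (embed var_x q * embed var_y q')) = 0"
        unfolding M by (simp only: is_hom_simps(4)[OF is_hom_eval3[OF h]] k0 mult_zero_left)
      then have "ev p x * ev q' y + ev p' y * ev q x - x * y * (ev q x * ev q' y) = 0"
        by (simp only: is_hom_simps[OF is_hom_eval3[OF h]] eval3_vars[OF h] embed_x embed_y ev)
      moreover have "ev q x \<noteq> 0" "ev q' y \<noteq> 0"
        using heval_nonzero[OF dx s(2)] heval_nonzero[OF dy s(3)] by (simp_all add: ev_def t_def)
      ultimately show ?thesis by (simp add: add_frac_eq divide_eq_eq algebra_simps)
    qed
    moreover have "finite (insert None (Some ` {c. poly (specialize_t t q) c = 0}))"
      "finite (insert None (Some ` {c. poly (specialize_t t q') c = 0}))"
      using poly_roots_finite[OF s(2)] poly_roots_finite[OF s(3)] by (simp_all add: t_def)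
    ultimately show ?thesis
      unfolding splits_def using regular_quot
      by (intro exI[of _ "\<lambda>z. ev p z / ev q z"] exI[of _ "\<lambda>z. ev p' z / ev q' z"]
          exI[of _ "insert None (Some ` {c. poly (specialize_t t q) c = 0})"]
          exI[of _ "insert None (Some ` {c. poly (specialize_t t q') c = 0})"]) simp
  qed
  have "{s. \<not> splits (model S True True s) (\<lambda>x y. x * y)} \<subseteq> {0} \<union>
    {s. 1 / of_int s \<in> {t. specialize_t t q = 0}} \<union> {s. 1 / of_int s \<in> {t. specialize_t t q' = 0}}"
    using main by auto
  moreover have "finite \<dots>"
    using finite_val_set[OF specialize_t_nonzero[OF nz(1)]] finite_val_set[OF
      specialize_t_nonzero[OF nz(2)]]
    by simp
  ultimately show ?thesis by (rule finite_subset)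
qed

section \<open>Inverting the coordinates\<close>

definition inv_val :: "complex option \<Rightarrow> complex option" where
  "inv_val v = (case v of None \<Rightarrow> Some 0 | Some c \<Rightarrow> if c = 0 then None else Some (inverse c))"

lemma val0_inverse:
  assumes "z \<noteq> 0"
  shows "val0 (inverse z) = inv_val (val0 z)"
proof (cases "val0 z")
  case None
  then have "val0 (inverse z) = Some 0"
    using regular_or_inverse[OF assms] by (simp add: val0_None val0_Some)
  then show ?thesis
    using None by (simp add: inv_val_def)
next
  case (Some c)
  then have c: "at0 z c" by (simp add: val0_Some)
  have "val0 (inverse z) = (if c = 0 then None else Some (inverse c))"
    using c at0_inverse[OF c] inverse_at0_0[of "inverse z"] assms
    by (auto simp: val0_Some val0_None)
  then show ?thesis
    using Some by (simp add: inv_val_def)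
qed

lemma inv_val_inv_val: "inv_val (inv_val v) = v"
  by (auto simp: inv_val_def split: option.splits)

lemma fls_deriv_signed: "fls_deriv z \<noteq> 0 \<Longrightarrow> fls_deriv (signed a z) \<noteq> (0 :: complex fls)"
  using fls_deriv_inverse_field[of z] by (cases "z = 0") (auto simp: signed_def)

lemma signed_pole_set:
  assumes "finite A" "\<And>z. fls_deriv z \<noteq> 0 \<Longrightarrow> val0 z \<notin> A \<Longrightarrow> regular (f z)"
  shows "\<exists>B. finite B \<and> (\<forall>z. fls_deriv z \<noteq> 0 \<longrightarrow> val0 z \<notin> B \<longrightarrow> regular (f (signed a z)))"
proof (cases a)
  case True
  then show ?thesis using assms by (auto simp: signed_def)
next
  case False
  have "regular (f (inverse z))" if "fls_deriv z \<noteq> 0" "val0 z \<notin> inv_val ` A" for z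
  proof (rule assms(2))
    show "fls_deriv (inverse z) \<noteq> 0" using that fls_deriv_signed[of z False] by (simp add:
      signed_def)
    have "z \<noteq> 0" using that by auto
    then show "val0 (inverse z) \<notin> A"
      using that(2) val0_inverse inv_val_inv_val by (metis image_eqI)
  qed
  then show ?thesis
    using assms(1) False by (intro exI[of _ "inv_val ` A"]) (simp add: signed_def)
qed

lemma biquad_model_signed:
  fixes x y :: "'a::field"
  assumes "x \<noteq> 0" "y \<noteq> 0"
  shows "biquad (model S a b s) x y = 0 \<longleftrightarrow> biquad (model S True True s) (signed a x) (signed b y) =
    0"
proof -
  have x: "biquad (model S False b s) x y = biquad (model S True b s) (inverse x) y * x\<^sup>2" for b
    using assms by (simp add: biquad_def quad_def model_def field_simps power2_eq_square)
  have y: "biquad (model S True False s) x y = biquad (model S True True s) x (inverse y) * y\<^sup>2"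
    for x
    using assms by (simp add: biquad_def quad_def model_def field_simps power2_eq_square)
  show ?thesis
    using assms x y by (cases a; cases b) (simp_all add: signed_def)
qed

lemma splits_signed:
  assumes "splits (model S True True s) (\<lambda>x y. x * y)"
  shows "splits (model S a b s) (\<lambda>x y. signed a x * signed b y)"
proof -
  obtain f g A B where fg: "finite A" "finite B"
    "\<And>z. fls_deriv z \<noteq> 0 \<Longrightarrow> val0 z \<notin> A \<Longrightarrow> regular (f z)"
    "\<And>z. fls_deriv z \<noteq> 0 \<Longrightarrow> val0 z \<notin> B \<Longrightarrow> regular (g z)"
    "\<And>x y. fls_deriv x \<noteq> 0 \<Longrightarrow> fls_deriv y \<noteq> 0 \<Longrightarrow> biquad (model S True True s) x y = 0 \<Longrightarrow> f x + g y =
      x * y"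
    using assms unfolding splits_def by blast
  obtain A' where A': "finite A'" "\<forall>z. fls_deriv z \<noteq> 0 \<longrightarrow> val0 z \<notin> A' \<longrightarrow> regular (f (signed a z))"
    using signed_pole_set[of A f a, OF fg(1,3)] by auto
  obtain B' where B': "finite B'" "\<forall>z. fls_deriv z \<noteq> 0 \<longrightarrow> val0 z \<notin> B' \<longrightarrow> regular (g (signed b z))"
    using signed_pole_set[of B g b, OF fg(2,4)] by auto
  have "f (signed a x) + g (signed b y) = signed a x * signed b y"
    if "fls_deriv x \<noteq> 0" "fls_deriv y \<noteq> 0" "biquad (model S a b s) x y = 0" for x y
  proof (rule fg(5))
    have "x \<noteq> 0" "y \<noteq> 0" using that by auto
    then show "biquad (model S True True s) (signed a x) (signed b y) = 0"
      using biquad_model_signed that(3) by blast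
  qed (simp_all add: that fls_deriv_signed)
  then show ?thesis
    unfolding splits_def using A' B'
    by (intro exI[of _ "\<lambda>z. f (signed a z)"] exI[of _ "\<lambda>z. g (signed b z)"] exI[of _ A'] exI[of _
      B']) simp
qed

section \<open>Certificates for the models that are not decoupled\<close>

lemma tp_model: "tp (model S a b s) = model (prod.swap ` S) b a s"
proof -
  have "(u, v) \<in> prod.swap ` S \<longleftrightarrow> (v, u) \<in> S" for u v by force
  then show ?thesis by (auto simp: tp_def model_def fun_eq_iff)
qed

lemma hquad_model_cong:
  assumes "p dvd s - s'"
  shows "p dvd hquad (model S a b s) j u v - hquad (model S a b s') j u (v :: int)"
proof -
  have "hquad (model S a b s) j u v - hquad (model S a b s') j u v = (s - s') * (if j = 1 then -
    (u * v) else 0)"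
    by (simp add: hquad_def model_def algebra_simps)
  then show ?thesis using assms by (simp only: dvd_mult2)
qed

lemma dvd_congruent: "p dvd x - y \<Longrightarrow> p dvd x \<longleftrightarrow> p dvd (y :: int)"
  by (metis diff_add_cancel dvd_add_right_iff)

lemma conj_ok_cong:
  assumes "\<And>j. p dvd hquad K j a v - hquad K' j a v"
  shows "conj_ok K p a v c d c' d' \<longleftrightarrow> conj_ok K' p a v c d c' d'"
proof -
  let ?d = "\<lambda>j. hquad K j a v - hquad K' j a v"
  have lin: "p dvd ?d i * m + ?d j * n" for i j m n
    using assms by simp
  have "p dvd (hquad K i a v * m + hquad K j a v * n) - (hquad K' i a v * m + hquad K' j a v * n)"
    for i j m n
    using lin[of i m j n] by (simp add: algebra_simps)
  then have main: "p dvd hquad K i a v * m + hquad K j a v * n \<longleftrightarrow>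
      p dvd hquad K' i a v * m + hquad K' j a v * n" for i j m n
    by (rule dvd_congruent)
  have 1: "- (hquad \<mu> 1 a v * d + hquad \<mu> 2 a v * c) * d' - hquad \<mu> 2 a v * d * c'
      = hquad \<mu> 1 a v * (- d * d') + hquad \<mu> 2 a v * (- c * d' - d * c')" for \<mu>
    by (simp add: algebra_simps)
  have 2: "hquad \<mu> 0 a v * c * d' - - (hquad \<mu> 1 a v * c + hquad \<mu> 0 a v * d) * c'
      = hquad \<mu> 0 a v * (c * d' + d * c') + hquad \<mu> 1 a v * (c * c')" for \<mu>
    by (simp add: algebra_simps)
  have s: "p dvd hquad K i a v * m \<longleftrightarrow> p dvd hquad K' i a v * m" for i m
    using main[of i m i 0] by simp
  show ?thesis
    unfolding conj_ok_def conj1_def conj2_def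
    by (simp only: prod.case if_distrib[of "case_prod _"] 1 2 main s dvd_minus_iff cong: if_cong)
qed

lemma link_ok_cong:
  assumes "p dvd s - s'"
  shows "link_ok (model S a b s) p c P Q = link_ok (model S a b s') p c P Q"
  unfolding link_ok_def tp_model
  using conj_ok_cong[OF hquad_model_cong[OF assms]] by simp

text \<open>\<open>s\<close> occurs only in the coefficient of \<open>x y\<close>, which enters a
  certificate through the conjugations alone, and these are tested modulo \<open>p\<close>.\<close>

lemma cert_ok_cong:
  assumes "p dvd s - s'" "cert_ok (model S a b s') a' b' e r p ps"
  shows "cert_ok (model S a b s) a' b' e r p ps"
proof -
  have m: "model S a b s i j = model S a b s' i j" if "(i, j) \<noteq> (1, 1)" for i j
    using that by (auto simp: model_def)
  have "cert_ok (model S a b s) a' b' e r p ps = cert_ok (model S a b s') a' b' e r p ps"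
    unfolding cert_ok_def cycle_ok_def link_ok_cong[OF assms(1)] by (simp add: m)
  then show ?thesis using assms(2) by simp
qed

text \<open>For these \<open>e\<close> the discriminant \<open>e^2 - 4\<close> is negative, so the
  roots are not real.\<close>

lemma reduction_exists:
  assumes "e = 0 \<or> e = 1" "prime p" "p dvd r\<^sup>2 + e * r + 1"
  shows "\<exists>\<theta>. reduction \<theta> e r p"
proof -
  define d where "d = sqrt (1 - (of_int e)\<^sup>2 / 4)"
  have d: "d\<^sup>2 = 1 - (of_int e)\<^sup>2 / 4" "d \<noteq> 0"
    using assms(1) by (auto simp: d_def)
  have "reduction (Complex (- of_int e / 2) d) e r p"
  proof
    show "(Complex (- of_int e / 2) d)\<^sup>2 = - of_int e * Complex (- of_int e / 2) d - 1"
      using d(1) by (simp add: complex_eq_iff power2_eq_square field_simps)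
    show "Im (Complex (- of_int e / 2) d) \<noteq> 0" using d(2) by simp
  qed (fact assms)+
  then show ?thesis by blast
qed

lemma not_decoupledI:
  assumes "p > 0" "\<And>s. p dvd s - s0 \<Longrightarrow> s \<ge> 3 \<Longrightarrow> \<not> splits (model S a b s) (\<lambda>x y. signed a x * signed
    b y)"
  shows "\<not> decoupled (unweighted S)"
proof
  assume "decoupled (unweighted S)"
  then have fin: "finite {s. \<not> splits (model S True True s) (\<lambda>x y. x * y)}"
    by (rule decoupled_splits)
  \<comment> \<open>An arithmetic progression in the residue class of \<open>s0\<close> with all
    terms at least 3; the exceptional model relies on this bound.\<close>
  define f where "f k = s0 + p * (int k + \<bar>s0\<bar> + 3)" for k
  have "f k \<ge> 3" for k
  proof -
    define m where "m = int k + \<bar>s0\<bar> + 3"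
    have "1 * m \<le> p * m"
      using assms(1) by (intro mult_right_mono) (auto simp: m_def)
    moreover have "3 \<le> s0 + m" unfolding m_def by linarith
    ultimately show ?thesis unfolding f_def m_def[symmetric] by linarith
  qed
  moreover have "p dvd f k - s0" for k by (simp add: f_def)
  ultimately have "\<not> splits (model S True True (f k)) (\<lambda>x y. x * y)" for k
    using assms(2) splits_signed by blast
  then have "range f \<subseteq> {s. \<not> splits (model S True True s) (\<lambda>x y. x * y)}" by auto
  moreover have "inj f" using assms(1) by (auto intro!: injI simp: f_def)
  ultimately show False
    using fin finite_subset range_inj_infinite by blast
qed

theorem not_decoupled_certificate:
  assumes "e = 0 \<or> e = 1" "prime p" "p dvd r\<^sup>2 + e * r + 1"
    and cert: "cert_ok (model S a b s0) a b e r p ps"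
  shows "\<not> decoupled (unweighted S)"
proof (rule not_decoupledI)
  show "p > 0" using assms(2) by (simp add: prime_gt_0_int)
  obtain \<theta> where "reduction \<theta> e r p" using reduction_exists[OF assms(1-3)] by blast
  then interpret reduction \<theta> e r p .
  show "\<not> splits (model S a b s) (\<lambda>x y. signed a x * signed b y)" if "p dvd s - s0" for s
    by (rule not_splits[OF cert_ok_cong[OF that cert]])
qed

section \<open>The exceptional model\<close>

context curve_orbit begin

text \<open>For the model \<open>{(-1, 1), (1, -1), (1, 1)}\<close> every reduction of the orbit meets further poles.
  Up to the factor \<open>\<theta>\<close>, its coordinates are values of Chebyshev polynomials at \<open>s / 2\<close>, whose
  growth excludes further poles.\<close>

lemma chebyshev_orbit:
  assumes K: "K = model {(-1, 1), (1, -1), (1, 1)} False False s" and s: "s \<ge> 3"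
    and start: "at0 x0 0" "at0 y0 \<theta>"
  shows "n \<ge> 1 \<Longrightarrow> \<exists>u v. at0 (x n) (of_int u * \<theta>) \<and> at0 (y n) (of_int v * \<theta>) \<and>
      v < 0 \<and> u \<le> 0 \<and> (if even n then u < v else v < u)"
    and "n \<le> -1 \<Longrightarrow> \<exists>u v. at0 (x n) (of_int u * \<theta>) \<and> at0 (y n) (of_int v * \<theta>) \<and>
      0 < v \<and> 0 < u \<and> (if odd n then v < u else u < v)"
proof -
  have q: "quad K 1 z = - of_int s * z" "quad K 2 z = 1" for z :: "complex fls"
    by (simp_all add: quad_def K model_def)
  have q': "quad (tp K) 1 z = - of_int s * z" "quad (tp K) 2 z = 1" for z :: "complex fls"
    by (simp_all add: quad_def K model_def tp_def)
  \<comment> \<open>The inverted curve is \<open>1 + x^2 + y^2 = s x y\<close>; both leading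
    coefficients are 1, which makes the involutions linear.\<close>
  have oth: "other K u v = of_int s * u - v" "other (tp K) u v = of_int s * u - v" for u v ::
    "complex fls"
    unfolding other_def q q' by simp_all
  have move: "at0 (of_int s * a - b) (of_int (s * u - v) * \<theta>)"
    if "at0 a (of_int u * \<theta>)" "at0 b (of_int v * \<theta>)" for a b u v
    using at0_diff[OF at0_mult[OF at0_of_int[of s] that(1)] that(2)]
    by (simp add: algebra_simps)
  \<comment> \<open>For \<open>s >= 3\<close> the recursion strictly increases absolute values, so
    that no coordinate returns to 0.\<close>
  have grow: "v < s * v - u \<or> s * v - u < v" "s * v - u < v" if "v < 0" "v \<le> u" "u \<le> 0" for u v
  proof -
    have "s * v \<le> 3 * v" using s that by (intro mult_right_mono_neg) auto
    then show "s * v - u < v" "v < s * v - u \<or> s * v - u < v" using that by linarith+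
  qed
  have grow': "v < s * v - u" if "0 < v" "u \<le> v" "0 \<le> u" for u v
  proof -
    have "3 * v \<le> s * v" using s that by (intro mult_right_mono) auto
    then show ?thesis using that by linarith
  qed
  show "n \<ge> 1 \<Longrightarrow> \<exists>u v. at0 (x n) (of_int u * \<theta>) \<and> at0 (y n) (of_int v * \<theta>) \<and>
      v < 0 \<and> u \<le> 0 \<and> (if even n then u < v else v < u)"
  proof (induction n rule: int_ge_induct)
    case base
    have "at0 (y 1) (- \<theta>)"
      using move[of "x 0" 0 "y 0" 1] start y_even[of 0] oth xy_0 by simp
    then show ?case
      using start x_even[of 0] xy_0 by (intro exI[of _ 0] exI[of _ "-1"]) simp
  next
    case (step n)
    then obtain u v where uv: "at0 (x n) (of_int u * \<theta>)" "at0 (y n) (of_int v * \<theta>)"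
      "v < 0" "u \<le> 0" "if even n then u < v else v < u" by blast
    show ?case
    proof (cases "even n")
      case True
      then show ?thesis
        using uv grow(2)[of u v] move[OF uv(1,2)] x_even[OF True] y_even[OF True] oth
        by (intro exI[of _ u] exI[of _ "s * u - v"]) auto
    next
      case False
      then show ?thesis
        using uv grow(2)[of v u] move[OF uv(2,1)] x_odd[OF False] y_odd[OF False] oth
        by (intro exI[of _ "s * v - u"] exI[of _ v]) auto
    qed
  qed
  show "n \<le> -1 \<Longrightarrow> \<exists>u v. at0 (x n) (of_int u * \<theta>) \<and> at0 (y n) (of_int v * \<theta>) \<and>
      0 < v \<and> 0 < u \<and> (if odd n then v < u else u < v)"
  proof (induction n rule: int_le_induct)
    case base
    have "at0 (x (-1)) (of_int s * \<theta>)"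
      using move[of "y 0" 1 "x 0" 0] start x_odd'[of 0] oth xy_0 by simp
    then show ?case
      using start y_odd'[of 0] xy_0 s by (intro exI[of _ s] exI[of _ 1]) simp
  next
    case (step n)
    then obtain u v where uv: "at0 (x n) (of_int u * \<theta>)" "at0 (y n) (of_int v * \<theta>)"
      "0 < v" "0 < u" "if odd n then v < u else u < v" by blast
    show ?case
    proof (cases "even n")
      case False
      then show ?thesis
        using uv grow'[of u v] move[OF uv(1,2)] x_even'[OF False] y_even'[OF False] oth
        by (intro exI[of _ u] exI[of _ "s * u - v"]) auto
    next
      case True
      then show ?thesis
        using uv grow'[of v u] move[OF uv(2,1)] x_odd'[OF True] y_odd'[OF True] oth
        by (intro exI[of _ "s * v - u"] exI[of _ v]) auto
    qed
  qed
qed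

lemma chebyshev_contradiction:
  assumes K: "K = model {(-1, 1), (1, -1), (1, 1)} False False s" and s: "s \<ge> 3"
    and start: "at0 x0 0" "at0 y0 \<theta>"
    and split: "splits K (\<lambda>x y. signed False x * signed False y)"
  shows False
proof -
  note orb = chebyshev_orbit[OF K s start]
  have t0: "\<theta> \<noteq> 0" using Im_theta by auto
  have nz: "\<not> at0 z 0" if "at0 z (of_int u * \<theta>)" "u \<noteq> 0" for z u
    using at0_unique[OF that(1), of 0] that(2) t0 by auto
  have ny: "\<not> at0 (y n) 0" for n
  proof (cases "n = 0")
    case True
    then show ?thesis using nz[of y0 1] start xy_0 by simp
  next
    case False
    then consider "n \<ge> 1" | "n \<le> -1" by linarith
    then show ?thesis using orb[of n] nz by cases (metis less_irrefl)+
  qed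
  have nx: "\<not> at0 (x n) 0" if "n \<ge> 2 \<or> n \<le> -1" for n
    using that
  proof
    assume "n \<ge> 2"
    then obtain u v where "at0 (x n) (of_int u * \<theta>)" "v < 0" "u \<le> 0" "if even n then u < v else v
      < u"
      using orb(1)[of n] by auto
    show ?thesis
    proof (cases "even n")
      case True
      then show ?thesis using nz[of "x n" u] \<open>at0 (x n) _\<close> \<open>v < 0\<close> \<open>if _ then _ else _\<close> by auto
    next
      case False
      then have "even (n - 1)" "n - 1 \<ge> 1" using \<open>n \<ge> 2\<close> by auto
      then obtain u v where "at0 (x (n - 1)) (of_int u * \<theta>)" "v < 0" "u < v"
        using orb(1)[of "n - 1"] by auto
      then show ?thesis using nz[of "x n" u] x_even'[OF False] by auto
    qed
  next
    assume "n \<le> -1"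
    then show ?thesis using orb(2)[of n] nz by (metis less_irrefl)
  qed
  note reg = regular_mult[OF regular_inverse[OF x_nz nx] regular_inverse[OF y_nz ny]]
  define T where "T = total False False"
  have "regular T"
    unfolding T_def total_def
  proof (rule split_regular[OF split nx start(1)])
    fix n assume "\<not> regular (signed False (x n) * signed False (y n))"
    then have "\<not> (n \<ge> 2 \<or> n \<le> -1)" using reg[of n n] by (auto simp: signed_def)
    then have "n \<in> {-1, 0, 1, 2}" by auto
    then show "\<exists>i\<in>{-1, 0, 1, 2}. even (n - i) \<and> x n = x i \<and> y n = y i" by force
  qed simp
  then have 1: "at0 (x0 * T) 0" using at0_0_mult start by blast
  have Te: "T = inverse x0 * inverse y0 - inverse (x (-1)) * inverse (y (-1))
      + inverse (x 2) * inverse (y 2) - inverse x0 * inverse (y 1)"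
    by (simp add: T_def total_def signed_def neighbours xy_0)
  have ii: "x0 * inverse x0 = 1" using x_nz[of 0] by (simp add: xy_0)
  have eq: "x0 * T = inverse y0 - inverse (y 1)
      + x0 * (inverse (x 2) * inverse (y 2) - inverse (x (-1)) * inverse (y (-1)))"
    unfolding Te using ii by algebra
  have y1: "at0 (y 1) (- \<theta>)"
    using other_at0[OF start] by (simp add: K model_def)
  \<comment> \<open>The points at positions 0 and 1 have opposite values of \<open>y\<close>, so
    their contributions add up to \<open>2 / \<theta>\<close>.\<close>
  have "at0 (x0 * T) (inverse \<theta> - inverse (- \<theta>) + 0)"
    unfolding eq using start y1 t0 reg[of 2 2] reg[of "-1" "-1"]
    by (intro at0_add at0_diff at0_inverse at0_0_mult regular_diff) auto
  then show False using at0_unique[OF 1] t0 by fastforce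
qed

end

theorem not_decoupled_chebyshev: "\<not> decoupled (unweighted {(-1, 1), (1, -1), (1, 1)})"
proof (rule not_decoupledI[of 5 0])
  fix s :: int assume s: "5 dvd s - 0" "s \<ge> 3"
  define K where "K = model {(-1, 1), (1, -1), (1, 1)} False False s"
  \<comment> \<open>Every first coordinate is 0 modulo 5, so this cycle cannot locate poles. It
    serves to set up the orbit; the poles are located by \<open>chebyshev_orbit\<close>.\<close>
  let ?ps = "[((0, 1), (2, 1)), ((0, 1), (3, 1)), ((0, 1), (3, 1)), ((0, 1), (2, 1))] :: point list"
  obtain \<theta> where "reduction \<theta> 0 2 5" using reduction_exists[of 0 5 2] by auto
  then interpret reduction \<theta> 0 2 5 .
  have "cycle_ok (model {(-1, 1), (1, -1), (1, 1)} False False 0) 5 ?ps"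
    by code_simp
  then have cyc: "cycle_ok K 5 ?ps"
    using link_ok_cong[OF s(1)] unfolding K_def cycle_ok_def by (simp add: model_def)
  show "\<not> splits (model {(-1, 1), (1, -1), (1, 1)} False False s) (\<lambda>x y. signed False x * signed
    False y)"
  proof
    assume split: "splits (model {(-1, 1), (1, -1), (1, 1)} False False s) (\<lambda>x y. signed False x *
      signed False y)"
    have "\<theta> \<noteq> 0" using Im_theta by auto
    obtain w x y where st: "flow K w x y" "regular w" "fls_deriv x = 1" "at0 x 0" "at0 y \<theta>"
      by (rule start_simple[of K \<theta>]) (use theta \<open>\<theta> \<noteq> 0\<close> in \<open>auto simp: K_def model_def\<close>)
    have "curve_orbit \<theta> 0 2 5 K ?ps w x y"
      by (rule cycle_orbit[OF cyc st(1,2)])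
        (use st red_of_int[of 0] red_theta reduces_at0 in auto)
    then interpret curve_orbit \<theta> 0 2 5 K ?ps w x y .
    show False
      by (rule chebyshev_contradiction[OF K_def s(2) st(4,5)]) (use split in \<open>simp add: K_def\<close>)
  qed
qed simp

section \<open>The finite list of certificates\<close>

definition decode :: "int \<times> int \<Rightarrow> point" where
  "decode P = (let c = (\<lambda>z. if z = -1 then (1, 0) else (z, 1)) in (c (fst P), c (snd P)))"

text \<open>A certificate \<open>(S, a, b, e, r, p, s, ps)\<close> consists of a model, the coordinates \<open>a, b\<close>, the
  reduction \<open>r\<close> modulo \<open>p\<close> of \<open>\<theta>\<close> with \<open>\<theta>\<^sup>2 + e \<theta> + 1 = 0\<close>, the residue of \<open>s\<close>, and the reduced
  orbit, where \<open>-1\<close> encodes infinity.\<close>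

type_synonym certificate = "step list \<times> bool \<times> bool \<times> int \<times> int \<times> int \<times> int \<times> (int \<times> int) list"

text \<open>The choice between a step set and its mirror image matters here, since the conditions of
  \<open>cert_ok\<close> are not symmetric in \<open>x\<close> and \<open>y\<close>.\<close>

definition certificates :: "certificate list" where
  "certificates = [
    ([(-1,-1), (0,1), (1,-1)], False, False, 0, 2, 5, 0, [(0,0), (0,0), (-1,0), (-1,0)]),
    ([(-1,0), (0,1), (1,-1)], False, False, 0, 2, 5, 0, [(0,0), (0,0), (-1,0), (-1,-1), (-1,-1),
      (-1,0)]),
    ([(-1,0), (1,-1), (1,1)], False, True, 0, 2, 5, 1, [(0,2), (0,3), (1,3), (1,2)]),
    ([(-1,1), (0,1), (1,-1)], False, False, 0, 2, 5, 0, [(0,0), (0,0), (4,0), (4,0)]),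
    ([(-1,-1), (0,-1), (0,1), (1,-1)], False, False, 0, 2, 5, 0, [(0,0), (0,0), (-1,0), (-1,0)]),
    ([(-1,-1), (-1,0), (0,-1), (1,1)], False, True, 0, 2, 5, 4, [(0,0), (0,0), (4,0), (4,0)]),
    ([(-1,-1), (-1,0), (0,1), (1,-1)], False, False, 0, 2, 5, 4, [(0,0), (0,0), (-1,0), (-1,4),
      (-1,4), (-1,0)]),
    ([(-1,-1), (-1,1), (0,-1), (1,1)], False, True, 0, 2, 5, 0, [(0,0), (0,0), (4,0), (4,0)]),
    ([(-1,-1), (-1,1), (0,1), (1,-1)], False, False, 0, 2, 5, 0, [(0,0), (0,0), (4,0), (4,0)]),
    ([(-1,-1), (-1,1), (1,-1), (1,1)], False, True, 0, 2, 5, 1, [(0,2), (0,3), (-1,3), (-1,2)]),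
    ([(-1,-1), (0,1), (1,-1), (1,1)], False, True, 0, 2, 5, 0, [(0,2), (0,3), (1,3), (1,2)]),
    ([(-1,-1), (0,1), (1,0), (1,1)], True, False, 0, 2, 5, 4, [(0,0), (0,0), (4,0), (4,0)]),
    ([(-1,0), (0,-1), (0,1), (1,-1)], False, False, 0, 2, 5, 4, [(0,0), (0,0), (-1,0), (-1,-1),
      (4,-1), (4,-1), (-1,-1), (-1,0)]),
    ([(-1,0), (-1,1), (0,-1), (1,1)], False, True, 0, 2, 5, 4, [(0,0), (0,0), (-1,0), (-1,4),
      (-1,4), (-1,0)]),
    ([(-1,0), (-1,1), (0,1), (1,-1)], False, False, 0, 2, 5, 4, [(0,0), (0,0), (4,0), (4,0)]),
    ([(-1,1), (0,-1), (0,1), (1,-1)], False, False, 0, 2, 5, 1, [(0,0), (0,0), (4,0), (4,-1),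
      (-1,-1), (-1,-1), (4,-1), (4,0)]),
    ([(-1,1), (0,-1), (1,-1), (1,1)], False, True, 0, 2, 5, 0, [(0,2), (0,3), (1,3), (1,2)]),
    ([(-1,0), (0,-1), (0,1), (1,0)], False, False, 0, 2, 5, 0, [(0,0), (0,-1), (-1,-1), (-1,0)]),
    ([(-1,0), (0,1), (1,-1), (1,1)], False, True, 0, 2, 5, 4, [(0,2), (0,3), (1,3), (1,1), (2,1),
      (2,2)]),
    ([(-1,1), (0,-1), (0,1), (1,1)], False, True, 0, 2, 5, 0, [(0,0), (0,0), (-1,0), (-1,0)]),
    ([(-1,1), (0,1), (1,-1), (1,0)], False, False, 0, 2, 5, 0, [(0,0), (0,4), (4,4), (4,0)]),
    ([(-1,1), (0,1), (1,-1), (1,1)], False, True, 0, 2, 5, 0, [(0,2), (0,3), (4,3), (4,2)]),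
    ([(-1,-1), (-1,0), (0,-1), (0,1), (1,-1)], False, False, 0, 2, 5, 3, [(0,0), (0,0), (-1,0),
      (-1,4), (-1,4), (-1,0)]),
    ([(-1,-1), (-1,0), (-1,1), (0,-1), (1,1)], False, True, 0, 2, 5, 4, [(0,0), (0,0), (4,0),
      (4,0)]),
    ([(-1,-1), (-1,0), (-1,1), (0,1), (1,-1)], False, False, 0, 2, 5, 4, [(0,0), (0,0), (4,0),
      (4,0)]),
    ([(-1,-1), (-1,1), (0,-1), (0,1), (1,-1)], False, False, 0, 2, 5, 0, [(0,0), (0,0), (4,0),
      (4,0)]),
    ([(-1,-1), (-1,0), (-1,1), (1,-1), (1,1)], False, True, 0, 2, 5, 1, [(0,2), (0,3), (1,3),
      (1,2)]),
    ([(-1,-1), (0,-1), (0,1), (1,-1), (1,1)], True, False, 0, 2, 5, 0, [(0,0), (0,0), (4,0),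
      (4,0)]),
    ([(-1,-1), (-1,0), (0,-1), (0,1), (1,0)], False, False, 0, 2, 5, 2, [(0,0), (0,-1), (4,-1),
      (4,4), (-1,4), (-1,0)]),
    ([(-1,-1), (-1,0), (0,1), (1,-1), (1,0)], False, False, 0, 2, 5, 0, [(0,0), (0,4), (-1,4),
      (-1,0)]),
    ([(-1,-1), (-1,0), (0,1), (1,-1), (1,1)], False, True, 0, 2, 5, 1, [(0,2), (0,3), (1,3),
      (1,2)]),
    ([(-1,-1), (-1,1), (0,-1), (0,1), (1,1)], False, True, 0, 2, 5, 0, [(0,0), (0,0), (4,0),
      (4,0)]),
    ([(-1,-1), (-1,1), (0,1), (1,-1), (1,0)], False, False, 0, 2, 5, 1, [(0,0), (0,4), (4,4),
      (4,0)]),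
    ([(-1,-1), (-1,1), (0,1), (1,-1), (1,1)], False, True, 0, 2, 5, 0, [(0,2), (0,3), (-1,3),
      (-1,2)]),
    ([(-1,-1), (0,1), (1,-1), (1,0), (1,1)], True, False, 0, 2, 5, 4, [(0,0), (0,0), (4,0), (4,0)]),
    ([(-1,0), (-1,1), (0,-1), (0,1), (1,-1)], False, False, 0, 2, 5, 3, [(0,0), (0,0), (4,0),
      (4,-1), (-1,-1), (-1,4), (-1,4), (-1,-1), (4,-1), (4,0)]),
    ([(-1,0), (-1,1), (0,-1), (0,1), (1,0)], False, False, 0, 2, 5, 2, [(0,0), (0,-1), (-1,-1),
      (-1,4), (4,4), (4,0)]),
    ([(-1,0), (-1,1), (0,-1), (0,1), (1,1)], False, True, 0, 2, 5, 3, [(0,0), (0,0), (-1,0),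
      (-1,4), (-1,4), (-1,0)]),
    ([(-1,0), (-1,1), (0,-1), (1,-1), (1,1)], False, True, 0, 2, 5, 1, [(0,2), (0,3), (1,3),
      (1,2)]),
    ([(-1,0), (0,-1), (0,1), (1,-1), (1,1)], False, True, 0, 2, 5, 1, [(0,2), (0,3), (1,3), (1,2)]),
    ([(-1,0), (-1,1), (0,1), (1,-1), (1,1)], False, True, 0, 2, 5, 4, [(0,2), (0,3), (4,3), (4,2)]),
    ([(-1,1), (0,-1), (0,1), (1,-1), (1,1)], False, True, 0, 12, 29, 6, [(0,12), (0,17), (14,17),
      (14,8), (17,8), (17,27), (15,27), (15,12)]),
    ([(-1,0), (0,1), (1,-1), (1,0), (1,1)], False, True, 1, 2, 7, 5, [(0,2), (0,4), (1,4), (1,1),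
      (3,1), (3,2)]),
    ([(-1,1), (0,1), (1,-1), (1,0), (1,1)], False, True, 1, 2, 7, 0, [(0,2), (0,4), (6,4), (6,2)]),
    ([(-1,-1), (-1,0), (-1,1), (0,-1), (0,1), (1,-1)], False, False, 0, 2, 5, 4, [(0,0), (0,0),
      (4,0), (4,0)]),
    ([(-1,-1), (-1,0), (-1,1), (0,-1), (0,1), (1,0)], False, False, 0, 2, 5, 0, [(0,0), (0,-1),
      (4,-1), (4,0)]),
    ([(-1,-1), (-1,0), (-1,1), (0,-1), (0,1), (1,1)], False, True, 0, 2, 5, 4, [(0,0), (0,0),
      (4,0), (4,0)]),
    ([(-1,-1), (-1,0), (-1,1), (0,-1), (1,-1), (1,1)], False, True, 0, 9, 41, 19, [(0,9), (0,32),
      (10,32), (10,31), (28,31), (28,9)]),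
    ([(-1,-1), (-1,0), (0,-1), (0,1), (1,-1), (1,1)], False, True, 0, 5, 13, 8, [(0,5), (0,8),
      (10,8), (10,2), (11,2), (11,5)]),
    ([(-1,-1), (-1,0), (-1,1), (0,1), (1,-1), (1,0)], False, False, 0, 2, 5, 0, [(0,0), (0,4),
      (4,4), (4,0)]),
    ([(-1,-1), (-1,0), (-1,1), (0,1), (1,-1), (1,1)], False, True, 0, 2, 5, 0, [(0,2), (0,3),
      (2,3), (2,0), (3,0), (3,2)]),
    ([(-1,-1), (0,-1), (0,1), (1,-1), (1,0), (1,1)], True, False, 0, 2, 5, 4, [(0,0), (0,0),
      (4,0), (4,0)]),
    ([(-1,-1), (-1,1), (0,-1), (0,1), (1,-1), (1,1)], False, True, 0, 2, 5, 1, [(0,2), (0,3),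
      (-1,3), (-1,2)]),
    ([(-1,-1), (-1,0), (0,1), (1,-1), (1,0), (1,1)], False, True, 1, 2, 7, 0, [(0,2), (0,4),
      (1,4), (1,2)]),
    ([(-1,-1), (-1,1), (0,1), (1,-1), (1,0), (1,1)], False, True, 1, 5, 31, 12, [(0,5), (0,25),
      (13,25), (13,6), (24,6), (24,5)]),
    ([(-1,0), (-1,1), (0,-1), (0,1), (1,-1), (1,0)], False, False, 0, 2, 5, 0, [(0,0), (0,4),
      (-1,4), (-1,-1), (4,-1), (4,0)]),
    ([(-1,0), (-1,1), (0,-1), (1,-1), (1,0), (1,1)], False, True, 1, 2, 7, 0, [(0,2), (0,4),
      (1,4), (1,2)]),
    ([(-1,0), (0,-1), (0,1), (1,-1), (1,0), (1,1)], False, True, 1, 2, 7, 0, [(0,2), (0,4), (1,4),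
      (1,2)]),
    ([(-1,0), (-1,1), (0,1), (1,-1), (1,0), (1,1)], False, True, 1, 2, 7, 6, [(0,2), (0,4), (6,4),
      (6,2)]),
    ([(-1,-1), (-1,0), (-1,1), (0,-1), (0,1), (1,-1), (1,0)], False, False, 0, 2, 5, 4, [(0,0),
      (0,4), (4,4), (4,0)]),
    ([(-1,-1), (-1,0), (-1,1), (0,-1), (0,1), (1,-1), (1,1)], False, True, 0, 2, 5, 1, [(0,2),
      (0,3), (1,3), (1,2)]),
    ([(-1,-1), (-1,0), (0,-1), (0,1), (1,-1), (1,0), (1,1)], False, True, 1, 2, 7, 5, [(0,2),
      (0,4), (2,4), (2,0), (4,0), (4,2)]),
    ([(-1,-1), (-1,0), (-1,1), (0,1), (1,-1), (1,0), (1,1)], False, True, 1, 2, 7, 0, [(0,2),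
      (0,4), (-1,4), (-1,2)]),
    ([(-1,0), (-1,1), (0,-1), (0,1), (1,-1), (1,0), (1,1)], False, True, 1, 3, 13, 4, [(0,3),
      (0,9), (7,9), (7,10), (11,10), (11,3)]),
    ([(-1,-1), (-1,0), (-1,1), (0,-1), (0,1), (1,-1), (1,0), (1,1)], False, True, 1, 2, 7, 0,
      [(0,2), (0,4), (-1,4), (-1,2)])]"

text \<open>Listing the primes keeps the check a matter of evaluation; their primality is proved
  separately.\<close>

definition certificate_ok :: "certificate \<Rightarrow> bool" where
  "certificate_ok C = (case C of (S, a, b, e, r, p, s, ps) \<Rightarrow>
     (e = 0 \<or> e = 1) \<and> p \<in> {5, 7, 13, 29, 31, 41} \<and> p dvd r * r + e * r + 1 \<and>
     cert_ok (model (set S) a b s) a b e r p (map decode ps))"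

lemma certificates_ok: "list_all certificate_ok certificates"
  by code_simp

lemma not_decoupled_certified:
  assumes "C \<in> set certificates"
  shows "\<not> decoupled (unweighted (set (fst C)))"
proof -
  obtain S a b e r p s ps where C: "C = (S, a, b, e, r, p, s, ps)"
    by (cases C) auto
  have ok: "certificate_ok C"
    using certificates_ok assms by (simp add: list_all_iff)
  then have "p \<in> {5, 7, 13, 29, 31, 41}" by (simp add: C certificate_ok_def)
  then have "prime p" by auto
  then show ?thesis
    using ok not_decoupled_certificate[of e p r "set S" a b s "map decode ps"]
    by (simp add: C certificate_ok_def power2_eq_square)
qed

section \<open>Explicit decoupling functions\<close>

definition swap_xy :: "'k::field_char_0 poly poly poly \<Rightarrow> 'k poly poly poly" where
  "swap_xy = eval3 const3 var_t var_y var_x"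

lemma is_hom_swap_xy: "is_hom swap_xy"
  unfolding swap_xy_def by (intro is_hom_eval3 is_hom_const3)

lemmas swap_xy_simps = is_hom_simps[OF is_hom_swap_xy]
  eval3_vars(1-4)[OF is_hom_const3, of var_t var_y var_x, folded swap_xy_def]

lemma swap_xy_embed: "swap_xy (embed X p) = embed (swap_xy X) p"
proof -
  have t: "swap_xy (heval const3 var_t c) = heval const3 var_t c" for c
    unfolding heval_comp[OF is_hom_swap_xy is_hom_const3] by (simp add: swap_xy_simps)
  show ?thesis
    unfolding embed_def heval_comp[OF is_hom_swap_xy is_hom_heval[OF is_hom_const3]]
    by (simp add: t)
qed

lemma swap_xy_swap_xy: "swap_xy (swap_xy P) = P"
proof -
  have t: "swap_xy (heval const3 var_t c) = heval const3 var_t c" for c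
    unfolding heval_comp[OF is_hom_swap_xy is_hom_const3] by (simp add: swap_xy_simps)
  note m = is_hom_heval[OF is_hom_const3]
  have "swap_xy (eval3 const3 var_t var_y var_x P) = eval3 const3 var_t var_x var_y P"
    unfolding eval3_def heval_comp[OF is_hom_swap_xy is_hom_heval[OF m]]
    unfolding heval_comp[OF is_hom_swap_xy m] by (simp add: t swap_xy_simps)
  then show ?thesis by (simp add: swap_xy_def eval3_identity)
qed

lemma swap_xy_dvd: "a dvd b \<Longrightarrow> swap_xy a dvd swap_xy b"
  by (auto simp: dvd_def swap_xy_simps)

text \<open>\<open>swap_xy\<close> is an involutive ring automorphism, so it carries common divisors
  to common divisors and units to units.\<close>

lemma swap_xy_coprime:
  assumes "coprime a b"
  shows "coprime (swap_xy a) (swap_xy b)"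
proof (rule coprimeI)
  fix c assume "c dvd swap_xy a" "c dvd swap_xy b"
  then have "swap_xy c dvd a" "swap_xy c dvd b"
    using swap_xy_dvd swap_xy_swap_xy by metis+
  then have "swap_xy c dvd 1" using assms coprime_common_divisor by blast
  then show "c dvd 1" using swap_xy_dvd swap_xy_swap_xy swap_xy_simps(2) by metis
qed

lemma swap_xy_kernel: "swap_xy (kernel w) = kernel (w \<circ> prod.swap)"
  unfolding kernel_eq swap_xy_simps by (simp add: algebra_simps)

lemma decoupled_swap:
  assumes "decoupled w"
  shows "decoupled (w \<circ> prod.swap)"
proof -
  obtain p q p' q' N D where *: "embed var_x q \<noteq> 0" "embed var_y q' \<noteq> 0" "D \<noteq> 0" "coprime N D"
    "kernel w dvd N" and eq: "(embed var_x p * embed var_y q' + embed var_y p' * embed var_x q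
      - var_x * var_y * (embed var_x q * embed var_y q')) * D = N * (embed var_x q * embed var_y
        q')"
    using assms unfolding decoupled_iff by blast
  have nz: "swap_xy P \<noteq> 0" if "P \<noteq> 0" for P :: "'a poly poly poly"
    using that swap_xy_swap_xy swap_xy_simps(1) by metis
  have "embed var_y q \<noteq> 0" "embed var_x q' \<noteq> 0"
    using nz[OF *(1)] nz[OF *(2)] by (simp_all add: swap_xy_embed swap_xy_simps)
  moreover have "(embed var_x p' * embed var_y q + embed var_y p * embed var_x q'
      - var_x * var_y * (embed var_x q' * embed var_y q)) * swap_xy D
      = swap_xy N * (embed var_x q' * embed var_y q)"
    using arg_cong[OF eq, of swap_xy] by (simp add: swap_xy_simps swap_xy_embed algebra_simps)
  moreover have "kernel (w \<circ> prod.swap) dvd swap_xy N"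
    using swap_xy_dvd[OF *(5)] by (simp add: swap_xy_kernel)
  ultimately show ?thesis
    unfolding decoupled_iff using nz[OF *(3)] swap_xy_coprime[OF *(4)] by blast
qed

lemma decoupled_reflection: "decoupled (unweighted (prod.swap ` S)) \<longleftrightarrow> decoupled (unweighted S)"
proof -
  have u: "unweighted T \<circ> prod.swap = unweighted (prod.swap ` T)" for T
    by (force simp: unweighted_def fun_eq_iff)
  have "prod.swap ` prod.swap ` S = S" by (simp add: image_image)
  then show ?thesis
    using decoupled_swap[of "unweighted S"] decoupled_swap[of "unweighted (prod.swap ` S)"]
      unfolding u
    by auto
qed

section \<open>Irreducibility of the explicit fractions\<close>

lemma prime_elem_linear: "prime_elem [:c, 1 :: 'a::idom:]"
proof (rule prime_elemI)
  have dvd: "[:c, 1:] dvd p \<longleftrightarrow> poly p (- c) = 0" for p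
    using poly_eq_0_iff_dvd[of p "- c"] by simp
  show "\<not> [:c, 1:] dvd 1" unfolding dvd by simp
  show "[:c, 1:] dvd a \<or> [:c, 1:] dvd b" if "[:c, 1:] dvd a * b" for a b
    using that unfolding dvd by simp
qed simp

lemma prime_elem_variables:
  "prime_elem (var_t :: 'k::field_char_0 poly poly poly)"
  "prime_elem (var_x :: 'k poly poly poly)" "prime_elem (var_x + 1 :: 'k poly poly poly)"
  "prime_elem (var_y :: 'k poly poly poly)" "prime_elem (var_y + 1 :: 'k poly poly poly)"
proof -
  show "prime_elem (var_t :: 'k poly poly poly)" "prime_elem (var_x :: 'k poly poly poly)"
    "prime_elem (var_y :: 'k poly poly poly)"
    unfolding var_t_def var_x_def var_y_def by (simp_all add: prime_elem_const_poly_iff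
      prime_elem_linear)
  have "(var_x + 1 :: 'k poly poly poly) = [:[:1, 1:]:]" "(var_y + 1 :: 'k poly poly poly) = [:1,
    1:]"
    by (simp_all add: var_x_def var_y_def one_pCons)
  then show "prime_elem (var_x + 1 :: 'k poly poly poly)" "prime_elem (var_y + 1 :: 'k poly poly
    poly)"
    by (simp_all add: prime_elem_const_poly_iff prime_elem_linear)
qed

text \<open>A common divisor \<open>c\<close> of \<open>N\<close> and \<open>\<pi> * D\<close> is
  not divisible by \<open>\<pi>\<close>, so \<open>\<pi>\<close> divides the cofactor of
  \<open>c\<close> and can be cancelled.\<close>

lemma coprime_prime_mult:
  fixes \<pi> N D :: "'a::algebraic_semidom"
  assumes "prime_elem \<pi>" "\<not> \<pi> dvd N" "coprime N D"
  shows "coprime N (\<pi> * D)"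
proof (rule coprimeI)
  fix c assume c: "c dvd N" "c dvd \<pi> * D"
  then obtain d where d: "\<pi> * D = c * d" by blast
  then have "\<pi> dvd c * d" by (metis dvd_triv_left)
  moreover have "\<not> \<pi> dvd c" using assms(2) c(1) dvd_trans by blast
  ultimately have "\<pi> dvd d" using assms(1) prime_elem_dvd_mult_iff by blast
  then obtain d' where "d = \<pi> * d'" by blast
  then have "\<pi> * D = \<pi> * (c * d')" using d by (simp add: mult_ac)
  moreover have "\<pi> \<noteq> 0" using assms(1) by auto
  ultimately have "D = c * d'" by simp
  then show "c dvd 1" using c(1) assms(3) coprime_common_divisor by (metis dvd_triv_left)
qed

lemma coprime_prime_power_mult:
  fixes \<pi> N D :: "'a::algebraic_semidom"
  assumes "prime_elem \<pi>" "\<not> \<pi> dvd N" "coprime N D"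
  shows "coprime N (\<pi> ^ n * D)"
  using assms(3) by (induction n) (auto simp: mult.assoc intro: coprime_prime_mult[OF assms(1,2)])

abbreviation eval_at :: "'k::field_char_0 \<Rightarrow> 'k \<Rightarrow> 'k \<Rightarrow> 'k poly poly poly \<Rightarrow> 'k" where
  "eval_at \<equiv> eval3 (\<lambda>c. c)"

lemma is_hom_id: "is_hom (\<lambda>c. c)"
  by (simp add: is_hom_def)

lemmas eval_at_simps = is_hom_simps[OF is_hom_eval3[OF is_hom_id]]
  eval3_vars(1-4)[OF is_hom_id]

lemma not_dvd_eval_at:
  assumes "eval_at T X Y \<pi> = 0" "eval_at T X Y N \<noteq> 0"
  shows "\<not> \<pi> dvd N"
  using assms by (auto simp: dvd_def eval_at_simps)

text \<open>The evaluation points show that no prime factor of the common denominator divides the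
  numerator, so that the fraction is irreducible.\<close>

lemma decoupled_witness:
  fixes w :: "step \<Rightarrow> 'k::field_char_0"
  assumes P: "P \<in> range (embed var_x)" and P': "P' \<in> range (embed var_y)"
    and id: "P * (var_y ^ a' * (var_y + 1) ^ b') + P' * (var_x ^ a * (var_x + 1) ^ b)
      - var_t ^ n * (var_x * var_y) * (var_x ^ a * (var_x + 1) ^ b) * (var_y ^ a' * (var_y + 1) ^
        b')
      = kernel w * M"
    and nz: "eval_at 0 1 u (kernel w * M) \<noteq> 0" "eval_at 1 0 v (kernel w * M) \<noteq> 0"
      "eval_at 0 (- 1) 1 (kernel w * M) \<noteq> 0" "eval_at 1 z 0 (kernel w * M) \<noteq> 0"
      "eval_at 0 1 (- 1) (kernel w * M) \<noteq> 0"
  shows "decoupled w"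
proof -
  let ?x = "var_x ^ a * (var_x + 1) ^ b :: 'k poly poly poly"
  let ?y = "var_y ^ a' * (var_y + 1) ^ b' :: 'k poly poly poly"
  let ?t = "var_t ^ n :: 'k poly poly poly"
  let ?N = "kernel w * M"
  have nd: "\<not> var_t dvd ?N" "\<not> var_x dvd ?N" "\<not> var_x + 1 dvd ?N" "\<not> var_y dvd ?N" "\<not> var_y + 1
    dvd ?N"
    by (rule not_dvd_eval_at[OF _ nz(1)] not_dvd_eval_at[OF _ nz(2)] not_dvd_eval_at[OF _ nz(3)]
        not_dvd_eval_at[OF _ nz(4)] not_dvd_eval_at[OF _ nz(5)], simp add: eval_at_simps)+
  have "coprime ?N (var_t ^ n * (var_x ^ a * ((var_x + 1) ^ b * (var_y ^ a' * ((var_y + 1) ^ b' *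
    1)))))"
    by (intro coprime_prime_power_mult prime_elem_variables nd) simp
  then have cop: "coprime ?N (?t * ?x * ?y)" by (simp add: mult_ac)
  have nz0: "?t \<noteq> 0" "?x \<noteq> 0" "?y \<noteq> 0"
    using prime_elem_not_zeroI[OF prime_elem_variables(1)[where 'k='k]] prime_elem_not_zeroI[OF
      prime_elem_variables(2)[where 'k='k]]
      prime_elem_not_zeroI[OF prime_elem_variables(3)[where 'k='k]] prime_elem_not_zeroI[OF
        prime_elem_variables(4)[where 'k='k]]
      prime_elem_not_zeroI[OF prime_elem_variables(5)[where 'k='k]] by simp_all
  \<comment> \<open>\<open>F = P / (?t * ?x)\<close> and \<open>G = P' / (?t * ?y)\<close> share the
    factor \<open>?t\<close>, so the fraction in lowest terms has the denominator
    \<open>?t * ?x * ?y\<close> rather than the full product.\<close>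
  have rearrange: "(P * (t * y) + P' * (t * x) - z * ((t * x) * (t * y))) * (t * x * y)
      = (P * y + P' * x - t * z * x * y) * ((t * x) * (t * y))" for t x y z :: "'k poly poly poly"
    by (simp add: algebra_simps)
  have cross: "(P * (?t * ?y) + P' * (?t * ?x) - var_x * var_y * ((?t * ?x) * (?t * ?y))) * (?t *
    ?x * ?y)
      = ?N * ((?t * ?x) * (?t * ?y))"
    by (simp only: rearrange id)
  have range: "?t * ?x \<in> range (embed var_x)" "?t * ?y \<in> range (embed var_y)"
    by (intro in_range_intros)+
  have "?t * ?x \<noteq> 0" "?t * ?y \<noteq> 0" "?t * ?x * ?y \<noteq> 0"
    using nz0 by (simp_all only: mult_eq_0_iff de_Morgan_disj not_False_eq_True simp_thms)
  then have main: "?t * ?x \<noteq> 0 \<and> ?t * ?y \<noteq> 0 \<and> ?t * ?x * ?y \<noteq> 0 \<and> coprime ?N (?t * ?x * ?y) \<and>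
      kernel w dvd ?N \<and> (P * (?t * ?y) + P' * (?t * ?x) - var_x * var_y * ((?t * ?x) * (?t * ?y)))
      * (?t * ?x * ?y) = ?N * ((?t * ?x) * (?t * ?y))"
    by (intro conjI cop cross dvd_triv_left)
  show ?thesis
    unfolding decoupled_iff
    by (rule bexI[OF _ P], rule bexI[OF _ range(1)], rule bexI[OF _ P'], rule bexI[OF _ range(2)],
        rule exI, rule exI, rule main)
qed

section \<open>The seventeen explicit witnesses\<close>

lemma const3_simps: "const3 0 = 0" "const3 1 = 1" "const3 (numeral n) = numeral n"
  by (simp_all add: const3_def one_pCons numeral_poly)

lemma eval_at_numeral: "eval_at T X Y (numeral n) = numeral n"
proof -
  have "eval_at T X Y (of_nat k) = of_nat k" for k
    by (induction k) (simp_all add: eval_at_simps)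
  then show ?thesis by (metis of_nat_numeral)
qed

lemmas witness_simps = kernel_eq const3_simps eval_at_simps eval_at_numeral
  algebra_simps eval_nat_numeral

text \<open>\<open>M = - 1\<close> means that the kernel, divided by the common denominator, itself
  isolates \<open>x y\<close>; here \<open>x y = 1/t - 1/x - 1/y\<close>. In this and the later
  witnesses \<open>v\<close> and \<open>z\<close> are 0 if the step \<open>(-1, -1)\<close> is
  present and 1 otherwise, so that the kernel does not vanish at the points on \<open>x = 0\<close>
  and \<open>y = 0\<close>; for \<open>t = 0\<close> it is \<open>- x y\<close>.\<close>

lemma decoupled_kreweras: "decoupled (unweighted kreweras)"
proof (rule decoupled_witness[where n = 1 and a = 1 and b = 0 and a' = 1 and b' = 0 and
      P = "var_x - var_t" and
      P' = "- var_t" and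
      M = "- 1" and u = "1" and v = "1" and z = "1"])
qed (intro in_range_intros, intro in_range_intros,
    simp_all add: witness_simps unweighted_def kreweras_def)

lemma decoupled_reverse_kreweras: "decoupled (unweighted reverse_kreweras)"
proof (rule decoupled_witness[where n = 1 and a = 0 and b = 0 and a' = 1 and b' = 0 and
      P = "var_x - var_t * var_x ^ 2" and
      P' = "- var_t" and
      M = "- 1" and u = "1" and v = "0" and z = "0"])
qed (intro in_range_intros, intro in_range_intros,
    simp_all add: witness_simps unweighted_def reverse_kreweras_def)

lemma decoupled_double_kreweras: "decoupled (unweighted double_kreweras)"
proof (rule decoupled_witness[where n = 1 and a = 0 and b = 1 and a' = 1 and b' = 0 and
      P = "var_x - var_t - var_t * var_x ^ 2" and
      P' = "- var_t" and
      M = "- 1" and u = "1" and v = "0" and z = "0"])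
qed (intro in_range_intros, intro in_range_intros,
    simp_all add: witness_simps unweighted_def double_kreweras_def)

text \<open>The kernel is \<open>t (1 + x^2 y) (1 + y) - x y\<close>, whence the pole at
  \<open>y = -1\<close>.\<close>

lemma decoupled_gessel: "decoupled (unweighted gessel)"
proof (rule decoupled_witness[where n = 1 and a = 1 and b = 0 and a' = 0 and b' = 1 and
      P = "var_x - var_t" and
      P' = "- 1" and
      M = "- 1" and u = "1" and v = "0" and z = "0"])
qed (intro in_range_intros, intro in_range_intros,
    simp_all add: witness_simps unweighted_def gessel_def)

lemma decoupled_1: "decoupled (unweighted {(0, 1), (1, 0), (-1, 0), (-1, -1)})"
proof (rule decoupled_witness[where n = 1 and a = 0 and b = 0 and a' = 1 and b' = 0 and
      P = "var_x - var_t - var_t * var_x ^ 2" and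
      P' = "- var_t" and
      M = "- 1" and u = "1" and v = "0" and z = "0"])
qed (intro in_range_intros, intro in_range_intros,
    simp_all add: witness_simps unweighted_def)

lemma decoupled_2: "decoupled (unweighted {(0, 1), (1, 0), (-1, 1), (-1, -1)})"
proof (rule decoupled_witness[where n = 1 and a = 0 and b = 0 and a' = 1 and b' = 0 and
      P = "var_x - var_t * var_x ^ 2" and
      P' = "- var_t - var_t * var_y ^ 2" and
      M = "- 1" and u = "1" and v = "0" and z = "0"])
qed (intro in_range_intros, intro in_range_intros,
    simp_all add: witness_simps unweighted_def)

lemma decoupled_3: "decoupled (unweighted {(0, 1), (1, 1), (0, -1), (-1, 0)})"
proof (rule decoupled_witness[where n = 1 and a = 1 and b = 0 and a' = 1 and b' = 0 and
      P = "var_x - var_t" and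
      P' = "- var_t - var_t * var_y ^ 2" and
      M = "- 1" and u = "1" and v = "1" and z = "1"])
qed (intro in_range_intros, intro in_range_intros,
    simp_all add: witness_simps unweighted_def)

text \<open>Divided by \<open>t x^2 y\<close>, the kernel contains the terms \<open>y/x\<close>,
  \<open>1\<close> and \<open>1/x^2\<close>. Multiplication by \<open>- x y\<close> turns the last
  two into \<open>- x y\<close> and \<open>- y/x\<close>; with \<open>M = 1 - x y\<close> the terms
  \<open>y/x\<close> cancel and \<open>- x y\<close> is the only mixed term left. As
  \<open>M\<close> vanishes at \<open>x = y = 1\<close>, the evaluation point is
  \<open>u = -1\<close>.\<close>

lemma decoupled_4: "decoupled (unweighted {(0, 1), (1, 0), (1, -1), (-1, 0)})"
proof (rule decoupled_witness[where n = 1 and a = 2 and b = 0 and a' = 1 and b' = 0 and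
      P = "- var_x + var_t + var_t * var_x ^ 2 - var_t * var_x ^ 3" and
      P' = "var_y ^ 2 + var_t - var_t * var_y ^ 3" and
      M = "1 - var_x * var_y" and u = "-1" and v = "1" and z = "1"])
qed (intro in_range_intros, intro in_range_intros,
    simp_all add: witness_simps unweighted_def)

lemma decoupled_5: "decoupled (unweighted {(0, 1), (1, 0), (1, 1), (-1, -1), (-1, 0)})"
proof (rule decoupled_witness[where n = 1 and a = 1 and b = 0 and a' = 0 and b' = 1 and
      P = "var_x - var_t + var_t * var_x" and
      P' = "- 1 - var_t - var_t * var_y - var_t * var_y ^ 2" and
      M = "- 1" and u = "1" and v = "0" and z = "0"])
qed (intro in_range_intros, intro in_range_intros,
    simp_all add: witness_simps unweighted_def)

lemma decoupled_6: "decoupled (unweighted {(0, 1), (0, -1), (1, 1), (-1, -1), (-1, 0)})"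
proof (rule decoupled_witness[where n = 1 and a = 0 and b = 1 and a' = 1 and b' = 0 and
      P = "var_x - var_t" and
      P' = "- var_t" and
      M = "- 1" and u = "1" and v = "0" and z = "0"])
qed (intro in_range_intros, intro in_range_intros,
    simp_all add: witness_simps unweighted_def)

lemma decoupled_7: "decoupled (unweighted {(-1, 1), (-1, 0), (1, 0), (-1, -1), (0, 1)})"
proof (rule decoupled_witness[where n = 1 and a = 0 and b = 0 and a' = 1 and b' = 0 and
      P = "var_x - var_t - var_t * var_x ^ 2" and
      P' = "- var_t - var_t * var_y ^ 2" and
      M = "- 1" and u = "1" and v = "0" and z = "0"])
qed (intro in_range_intros, intro in_range_intros,
    simp_all add: witness_simps unweighted_def)

lemma decoupled_8: "decoupled (unweighted {(1, 1), (0, -1), (1, 0), (-1, 0), (0, 1)})"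
proof (rule decoupled_witness[where n = 1 and a = 1 and b = 0 and a' = 1 and b' = 0 and
      P = "var_x - var_t - var_t * var_x ^ 2" and
      P' = "- var_t - var_t * var_y ^ 2" and
      M = "- 1" and u = "1" and v = "1" and z = "1"])
qed (intro in_range_intros, intro in_range_intros,
    simp_all add: witness_simps unweighted_def)

text \<open>The multiplier \<open>M\<close> depends on \<open>t\<close>, linearly like the kernel,
  which accounts for \<open>t^2\<close> in the denominators.\<close>

lemma decoupled_9: "decoupled (unweighted {(1, 0), (0, -1), (0, 1), (-1, 1), (1, -1)})"
proof (rule decoupled_witness[where n = 2 and a = 1 and b = 2 and a' = 2 and b' = 0 and
      P = "- (var_x ^ 2) - var_t * var_x ^ 2 + var_t * var_x ^ 3 - var_t ^ 2 - 2 * var_t ^ 2 *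
        var_x - 2 * var_t ^ 2 * var_x ^ 2 - var_t ^ 2 * var_x ^ 3 - var_t ^ 2 * var_x ^ 4" and
      P' = "var_t * var_y + var_t * var_y ^ 3 - var_t ^ 2 + var_t ^ 2 * var_y ^ 3 - var_t ^ 2 *
        var_y ^ 4" and
      M = "var_x * var_y - var_t - var_t * var_x + var_t * var_x * var_y - var_t * var_x * var_y ^
        2 - var_t * var_x ^ 2 * var_y ^ 2" and u = "1" and v = "1" and z = "1"])
qed (intro in_range_intros, intro in_range_intros,
    simp_all add: witness_simps unweighted_def)

text \<open>The weights 1, 2, 1 of the steps with \<open>i = 1\<close> form
  \<open>(1 + y)^2\<close>, so dividing the kernel by \<open>t x (1 + y)\<close> leaves
  \<open>x (1 + y)\<close> as the only mixed term.\<close>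

lemma decoupled_W1: "decoupled (W1 l)"
proof (rule decoupled_witness[where n = 1 and a = 1 and b = 0 and a' = 0 and b' = 1 and
      P = "var_x - var_t - var_t * var_x ^ 2" and
      P' = "- 1 - var_t * const3 l" and
      M = "- 1" and u = "1" and v = "0" and z = "0"])
qed (intro in_range_intros, intro in_range_intros,
    simp_all add: witness_simps W1_def)

lemma decoupled_W2: "decoupled W2"
proof (rule decoupled_witness[where n = 1 and a = 1 and b = 1 and a' = 1 and b' = 1 and
      P = "var_x ^ 2 + var_t + 2 * var_t * var_x + 3 * var_t * var_x ^ 2 - var_t * var_x ^ 3" and
      P' = "- var_y + var_t - 2 * var_t * var_y - var_t * var_y ^ 2 - var_t * var_y ^ 3" and
      M = "1 - var_x * var_y" and u = "-1" and v = "1" and z = "1"])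
qed (intro in_range_intros, intro in_range_intros,
    simp_all add: witness_simps W2_def)

lemma decoupled_W3: "decoupled W3"
proof (rule decoupled_witness[where n = 2 and a = 0 and b = 2 and a' = 1 and b' = 0 and
      P = "- var_x + 2 * var_t - 3 * var_t * var_x + var_t * var_x ^ 2 + 5 * var_t ^ 2 - 3 * var_t
        ^ 2 * var_x - var_t ^ 2 * var_x ^ 3" and
      P' = "var_t + var_t * var_y ^ 2 + 3 * var_t ^ 2 + var_t ^ 2 * var_y ^ 2 - var_t ^ 2 * var_y
        ^ 3" and
      M = "1 + 3 * var_t - var_t * var_y - var_t * var_x * var_y" and u = "1" and v = "0" and z =
        "0"])
qed (intro in_range_intros, intro in_range_intros,
    simp_all add: witness_simps W3_def)

lemma decoupled_W4: "decoupled W4"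
proof (rule decoupled_witness[where n = 1 and a = 0 and b = 1 and a' = 1 and b' = 0 and
      P = "var_x - 2 * var_t - var_t * var_x ^ 2" and
      P' = "- var_t - var_t * var_y ^ 2" and
      M = "- 1" and u = "1" and v = "0" and z = "0"])
qed (intro in_range_intros, intro in_range_intros,
    simp_all add: witness_simps W4_def)

section \<open>Classification of the relevant models\<close>

lemma endpoint_snoc: "endpoint (ws @ [s]) = (fst (endpoint ws) + fst s, snd (endpoint ws) + snd s)"
  by (simp add: endpoint_def)

lemma walks_in_Nil: "[] \<in> walks_in C S \<longleftrightarrow> (0, 0) \<in> C"
  by (simp add: walks_in_def endpoint_def)

lemma walks_in_snoc: "ws @ [s] \<in> walks_in C S \<longleftrightarrow> ws \<in> walks_in C S \<and> s \<in> S \<and> endpoint (ws @ [s]) \<in> C"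
  by (auto simp: walks_in_def le_Suc_eq)

lemma walks_in_endpoint: "ws \<in> walks_in C S \<Longrightarrow> endpoint ws \<in> C"
  unfolding walks_in_def by (metis (mono_tags, lifting) mem_Collect_eq order_refl take_all)

lemma used_steps_subset: "used_steps S \<subseteq> S"
  by (auto simp: used_steps_def walks_in_def)

lemma used_stepsI: "ws \<in> walks_in quadrant S \<Longrightarrow> s \<in> set ws \<Longrightarrow> s \<in> used_steps S"
  by (auto simp: used_steps_def)

text \<open>A condition on endpoints suffices, since every prefix of a walk is a walk.\<close>

lemma quadrant_walks_eq:
  assumes "quadrant \<subseteq> H"
    and "\<And>ws. set ws \<subseteq> used_steps S \<Longrightarrow> endpoint ws \<in> H \<Longrightarrow> endpoint ws \<in> quadrant"
  shows "walks_in quadrant S = walks_in H (used_steps S)"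
proof
  show "walks_in quadrant S \<subseteq> walks_in H (used_steps S)"
    using assms(1) used_stepsI by (fastforce simp: walks_in_def)
  show "walks_in H (used_steps S) \<subseteq> walks_in quadrant S"
  proof
    fix ws assume ws: "ws \<in> walks_in H (used_steps S)"
    have "endpoint (take n ws) \<in> quadrant" if "n \<le> length ws" for n
    proof (rule assms(2))
      show "set (take n ws) \<subseteq> used_steps S"
        using ws set_take_subset by (fastforce simp: walks_in_def)
    qed (use ws that in \<open>simp add: walks_in_def\<close>)
    then show "ws \<in> walks_in quadrant S"
      using ws used_steps_subset by (auto simp: walks_in_def)
  qed
qed

lemma sum_list_zero_nonpos:
  fixes f :: "'a \<Rightarrow> int"
  assumes "\<And>x. x \<in> set xs \<Longrightarrow> f x \<le> 0" "sum_list (map f xs) \<ge> 0" "x \<in> set xs"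
  shows "f x = 0"
  using assms
proof (induction xs)
  case (Cons a xs)
  have "sum_list (map f xs) \<le> 0" by (intro sum_list_nonpos) (use Cons.prems(1) in auto)
  moreover have "f a \<le> 0" using Cons.prems(1) by simp
  ultimately have "f a = 0" "sum_list (map f xs) \<ge> 0" using Cons.prems(2) by simp_all
  then show ?case using Cons by auto
qed simp

text \<open>A criterion for relevance that can be evaluated on each finite step set.\<close>

definition two_dimensional :: "step set \<Rightarrow> bool" where
  "two_dimensional S \<longleftrightarrow> (\<exists>s\<in>S. fst s = 1) \<and> (\<exists>s\<in>S. fst s = -1) \<and> (\<exists>s\<in>S. snd s = 1) \<and>
     (\<exists>s\<in>S. snd s = -1) \<and> (\<exists>s\<in>S. fst s > snd s) \<and> (\<exists>s\<in>S. fst s < snd s) \<and> (\<exists>s\<in>S. fst s + snd s > 0)"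

lemma quadrant_eq: "quadrant = {(a, b). a \<ge> 0 \<and> b \<ge> 0}"
  by (auto simp: quadrant_def right_half_plane_def upper_half_plane_def)

lemma half_plane_upper:
  assumes "\<And>ws. set ws \<subseteq> used_steps S \<Longrightarrow> snd (endpoint ws) \<ge> 0 \<Longrightarrow> fst (endpoint ws) \<ge> 0"
  shows "simpler_problem S"
  unfolding simpler_problem_def
proof (rule disjI2, rule quadrant_walks_eq)
  show "endpoint ws \<in> quadrant" if "set ws \<subseteq> used_steps S" "endpoint ws \<in> upper_half_plane" for ws
    using that assms[of ws] by (auto simp: quadrant_eq upper_half_plane_def split: prod.splits)
qed (simp add: quadrant_def)

lemma half_plane_right:
  assumes "\<And>ws. set ws \<subseteq> used_steps S \<Longrightarrow> fst (endpoint ws) \<ge> 0 \<Longrightarrow> snd (endpoint ws) \<ge> 0"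
  shows "simpler_problem S"
  unfolding simpler_problem_def
proof (rule disjI1, rule quadrant_walks_eq)
  show "endpoint ws \<in> quadrant" if "set ws \<subseteq> used_steps S" "endpoint ws \<in> right_half_plane" for ws
    using that assms[of ws] by (auto simp: quadrant_eq right_half_plane_def split: prod.splits)
qed (simp add: quadrant_def)

lemma sum_list_endpoint_nonneg:
  "(\<And>s. s \<in> set ws \<Longrightarrow> f s \<ge> (0 :: int)) \<Longrightarrow> sum_list (map f ws) \<ge> 0"
  by (intro sum_list_nonneg) auto

text \<open>The sum of \<open>f\<close> over the walk is nonnegative while each summand is
  nonpositive.\<close>

lemma used_steps_zero:
  fixes f :: "step \<Rightarrow> int"
  assumes "\<And>s. s \<in> S \<Longrightarrow> f s \<le> 0" "s \<in> used_steps S"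
    and "\<And>ws. endpoint ws \<in> quadrant \<Longrightarrow> sum_list (map f ws) \<ge> 0"
  shows "f s = 0"
proof -
  obtain ws where ws: "ws \<in> walks_in quadrant S" "s \<in> set ws"
    using assms(2) by (auto simp: used_steps_def)
  then have "sum_list (map f ws) \<ge> 0"
    using walks_in_endpoint assms(3) by blast
  moreover have "f s' \<le> 0" if "s' \<in> set ws" for s'
    using ws that by (intro assms(1)) (auto simp: walks_in_def)
  ultimately show ?thesis using sum_list_zero_nonpos ws(2) by metis
qed

text \<open>The first step of a quadrant walk has nonnegative coordinates; with a sum at most 0 it
  would be \<open>(0, 0)\<close>.\<close>

lemma used_steps_empty:
  assumes S: "S \<subseteq> small_steps" and neg: "\<And>s. s \<in> S \<Longrightarrow> fst s + snd s \<le> 0"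
  shows "used_steps S = {}"
proof -
  have "ws = []" if "ws \<in> walks_in quadrant S" for ws
  proof (rule ccontr)
    assume "ws \<noteq> []"
    then obtain s vs where ws: "ws = s # vs" by (cases ws) auto
    have "endpoint (take 1 ws) \<in> quadrant" using that ws by (auto simp: walks_in_def)
    moreover have "s \<in> S" using that ws by (auto simp: walks_in_def)
    ultimately have "s = (0, 0)"
      using neg[of s] ws by (cases s) (auto simp: endpoint_def quadrant_eq)
    then show False using \<open>s \<in> S\<close> S by (auto simp: small_steps_def)
  qed
  then show ?thesis by (auto simp: used_steps_def)
qed

lemma small_step_bounds:
  "s \<in> small_steps \<Longrightarrow> - 1 \<le> fst s \<and> fst s \<le> 1 \<and> - 1 \<le> snd s \<and> snd s \<le> 1"
  by (auto simp: small_steps_def)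

lemma not_two_dimensional:
  assumes S: "S \<subseteq> small_steps" and "\<not> two_dimensional S"
  shows "simpler_problem S"
proof -
  note U = used_steps_subset[of S]
  have b: "- 1 \<le> fst s" "fst s \<le> 1" "- 1 \<le> snd s" "snd s \<le> 1" if "s \<in> S" for s
    using small_step_bounds S that by blast+
  have b1: "fst s \<le> 0" if "s \<in> S" "fst s \<noteq> 1" for s using b(2)[OF that(1)] that(2) by linarith
  have b2: "fst s \<ge> 0" if "s \<in> S" "fst s \<noteq> -1" for s using b(1)[OF that(1)] that(2) by linarith
  have b3: "snd s \<le> 0" if "s \<in> S" "snd s \<noteq> 1" for s using b(4)[OF that(1)] that(2) by linarith
  have b4: "snd s \<ge> 0" if "s \<in> S" "snd s \<noteq> -1" for s using b(3)[OF that(1)] that(2) by linarith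
  consider (1) "\<forall>s\<in>S. fst s \<noteq> 1" | (2) "\<forall>s\<in>S. fst s \<noteq> -1" | (3) "\<forall>s\<in>S. snd s \<noteq> 1"
    | (4) "\<forall>s\<in>S. snd s \<noteq> -1" | (5) "\<forall>s\<in>S. fst s \<le> snd s" | (6) "\<forall>s\<in>S. snd s \<le> fst s"
    | (7) "\<forall>s\<in>S. fst s + snd s \<le> 0"
    using assms(2) unfolding two_dimensional_def not_less[symmetric] by blast
  then show ?thesis
  proof cases
    case 1
    have "fst s \<ge> 0" if "s \<in> used_steps S" for s
      using used_steps_zero[of S fst s] that b1 1 by (auto simp: quadrant_eq endpoint_def)
    then show ?thesis
      by (intro half_plane_upper) (auto simp: endpoint_def intro!: sum_list_endpoint_nonneg)
  next
    case 2
    then have "fst s \<ge> 0" if "s \<in> used_steps S" for s using b2 U that by blast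
    then show ?thesis
      by (intro half_plane_upper) (auto simp: endpoint_def intro!: sum_list_endpoint_nonneg)
  next
    case 3
    have "snd s \<ge> 0" if "s \<in> used_steps S" for s
      using used_steps_zero[of S snd s] that b3 3 by (auto simp: quadrant_eq endpoint_def)
    then show ?thesis
      by (intro half_plane_right) (auto simp: endpoint_def intro!: sum_list_endpoint_nonneg)
  next
    case 4
    then have "snd s \<ge> 0" if "s \<in> used_steps S" for s using b4 U that by blast
    then show ?thesis
      by (intro half_plane_right) (auto simp: endpoint_def intro!: sum_list_endpoint_nonneg)
  next
    case 5
    show ?thesis
    proof (rule half_plane_right)
      fix ws assume "set ws \<subseteq> used_steps S" "fst (endpoint ws) \<ge> 0"
      moreover from this have "sum_list (map fst ws) \<le> sum_list (map snd ws)"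
        using 5 U by (intro sum_list_mono) auto
      ultimately show "snd (endpoint ws) \<ge> 0" by (simp add: endpoint_def)
    qed
  next
    case 6
    show ?thesis
    proof (rule half_plane_upper)
      fix ws assume "set ws \<subseteq> used_steps S" "snd (endpoint ws) \<ge> 0"
      moreover from this have "sum_list (map snd ws) \<le> sum_list (map fst ws)"
        using 6 U by (intro sum_list_mono) auto
      ultimately show "fst (endpoint ws) \<ge> 0" by (simp add: endpoint_def)
    qed
  next
    case 7
    then have "used_steps S = {}" using used_steps_empty S by blast
    then show ?thesis by (intro half_plane_upper) (auto simp: endpoint_def)
  qed
qed

lemma walks_in_one: "(0, 0) \<in> C \<Longrightarrow> s \<in> S \<Longrightarrow> s \<in> C \<Longrightarrow> [s] \<in> walks_in C S"
  using walks_in_snoc[of "[]" s] by (cases s) (simp add: walks_in_Nil endpoint_def)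

lemma walks_in_extend:
  "ws \<in> walks_in C S \<Longrightarrow> s \<in> S \<Longrightarrow> (fst (endpoint ws) + fst s, snd (endpoint ws) + snd s) \<in> C \<Longrightarrow>
    ws @ [s] \<in> walks_in C S"
  by (simp add: walks_in_snoc endpoint_snoc)

text \<open>From a point with both coordinates at least 1 every small step stays in the quadrant, so
  it is enough that some walk reaches such a point.\<close>

lemma all_steps_used:
  assumes S: "S \<subseteq> small_steps" and two: "two_dimensional S"
  shows "used_steps S = S"
proof -
  have b: "- 1 \<le> fst s" "fst s \<le> 1" "- 1 \<le> snd s" "snd s \<le> 1" if "s \<in> S" for s
    using small_step_bounds S that by blast+
  obtain ws where ws: "ws \<in> walks_in quadrant S" "fst (endpoint ws) \<ge> 1" "snd (endpoint ws) \<ge> 1"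
  proof -
    obtain s where s: "s \<in> S" "fst s + snd s > 0" using two by (auto simp: two_dimensional_def)
    obtain u where u: "u \<in> S" "snd u = 1" using two by (auto simp: two_dimensional_def)
    obtain v where v: "v \<in> S" "fst v = 1" using two by (auto simp: two_dimensional_def)
    have q0: "(0, 0) \<in> quadrant" by (simp add: quadrant_eq)
    have sq: "fst s \<ge> 0" "snd s \<ge> 0" using s b[OF s(1)] by linarith+
    then have w1: "[s] \<in> walks_in quadrant S" using walks_in_one[OF q0 s(1)] by (cases s) (simp
      add: quadrant_eq)
    \<comment> \<open>If \<open>s\<close> is a unit step along one axis, two copies leave room for a
      further step that moves back by 1 along that axis.\<close>
    have w2: "[s] @ [s] \<in> walks_in quadrant S"
      using sq by (intro walks_in_extend[OF w1 s(1)]) (simp add: quadrant_eq endpoint_def)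
    consider "fst s = 1" "snd s = 1" | "fst s = 1" "snd s = 0" | "fst s = 0" "snd s = 1"
      using s b[OF s(1)] by linarith
    then show ?thesis
    proof cases
      case 1
      then show ?thesis using that[OF w1] by (simp add: endpoint_def)
    next
      case 2
      then have "([s] @ [s]) @ [u] \<in> walks_in quadrant S"
        using u b[OF u(1)] by (intro walks_in_extend[OF w2]) (simp_all add: quadrant_eq
          endpoint_def)
      then show ?thesis using that[of "([s] @ [s]) @ [u]"] u b[OF u(1)] 2 by (simp add:
        endpoint_def)
    next
      case 3
      then have "([s] @ [s]) @ [v] \<in> walks_in quadrant S"
        using v b[OF v(1)] by (intro walks_in_extend[OF w2]) (simp_all add: quadrant_eq
          endpoint_def)
      then show ?thesis using that[of "([s] @ [s]) @ [v]"] v b[OF v(1)] 3 by (simp add: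
        endpoint_def)
    qed
  qed
  have "s \<in> used_steps S" if s: "s \<in> S" for s
  proof (rule used_stepsI)
    show "ws @ [s] \<in> walks_in quadrant S"
      using ws(2,3) b[OF s] by (intro walks_in_extend[OF ws(1) s]) (simp add: quadrant_eq)
  qed simp
  then show ?thesis using used_steps_subset by blast
qed

lemma two_dimensional_reflection: "two_dimensional (prod.swap ` S) \<longleftrightarrow> two_dimensional S"
proof -
  have "(\<exists>s\<in>prod.swap ` S. P s) \<longleftrightarrow> (\<exists>s\<in>S. P (prod.swap s))" for P by blast
  then show ?thesis
    unfolding two_dimensional_def by (simp only: fst_swap snd_swap add.commute) blast
qed

lemma small_steps_reflection: "prod.swap ` S \<subseteq> small_steps \<longleftrightarrow> S \<subseteq> small_steps"
proof -
  have sw: "prod.swap s \<in> small_steps \<longleftrightarrow> s \<in> small_steps" for s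
    by (cases s) (auto simp: small_steps_def)
  show ?thesis by (simp only: image_subset_iff sw) (simp only: subset_eq)
qed

text \<open>A step below the diagonal either goes down itself or is \<open>(1, 0)\<close>; in the
  latter case any step with second coordinate \<open>-1\<close> may follow.\<close>

lemma right_walk_leaves_quadrant:
  assumes S: "S \<subseteq> small_steps" and two: "two_dimensional S"
  shows "\<exists>ws\<in>walks_in right_half_plane S. snd (endpoint ws) < 0"
proof -
  have b: "- 1 \<le> fst s" "fst s \<le> 1" "- 1 \<le> snd s" "snd s \<le> 1" if "s \<in> S" for s
    using small_step_bounds S that by blast+
  obtain s u where s: "s \<in> S" "fst s > snd s" and u: "u \<in> S" "snd u = -1"
    using two by (auto simp: two_dimensional_def)
  have 0: "fst s \<ge> 0" using s b[OF s(1)] by linarith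
  then have w: "[s] \<in> walks_in right_half_plane S"
    using walks_in_one[OF _ s(1), of right_half_plane] by (cases s) (simp add: right_half_plane_def)
  show ?thesis
  proof (cases "snd s < 0")
    case True
    then show ?thesis using w by (intro bexI[of _ "[s]"]) (simp_all add: endpoint_def)
  next
    case False
    then have "fst s = 1" "snd s = 0" using s b[OF s(1)] by linarith+
    moreover from this have "[s] @ [u] \<in> walks_in right_half_plane S"
      using b[OF u(1)] by (intro walks_in_extend[OF w u(1)]) (simp add: right_half_plane_def
        endpoint_def)
    ultimately show ?thesis using u by (intro bexI[of _ "[s] @ [u]"]) (simp_all add: endpoint_def)
  qed
qed

lemma endpoint_reflection: "endpoint (map prod.swap ws) = prod.swap (endpoint ws)"
  by (simp add: endpoint_def comp_def)

lemma two_dimensional_not_simpler: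
  assumes S: "S \<subseteq> small_steps" and two: "two_dimensional S"
  shows "\<not> simpler_problem S"
proof -
  have r: "walks_in quadrant S \<noteq> walks_in right_half_plane S"
    using right_walk_leaves_quadrant[OF S two] walks_in_endpoint[of _ quadrant S]
    by (fastforce simp: quadrant_eq)
  have "prod.swap ` S \<subseteq> small_steps" "two_dimensional (prod.swap ` S)"
    using S two by (simp_all only: small_steps_reflection two_dimensional_reflection)
  then obtain ws where ws: "ws \<in> walks_in right_half_plane (prod.swap ` S)" "snd (endpoint ws) < 0"
    using right_walk_leaves_quadrant by blast
  have "set ws \<subseteq> prod.swap ` S" using ws(1) by (simp add: walks_in_def)
  then have "set (map prod.swap ws) \<subseteq> S" by auto
  moreover have "endpoint (take n (map prod.swap ws)) \<in> upper_half_plane" if "n \<le> length ws" for n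
    using ws(1) that
    by (auto simp: walks_in_def take_map endpoint_reflection right_half_plane_def
      upper_half_plane_def
        split: prod.splits)
  ultimately have "map prod.swap ws \<in> walks_in upper_half_plane S"
    by (simp add: walks_in_def)
  moreover have "fst (endpoint (map prod.swap ws)) < 0"
    using ws(2) by (simp add: endpoint_reflection)
  ultimately have "walks_in quadrant S \<noteq> walks_in upper_half_plane S"
    using walks_in_endpoint[of _ quadrant S] by (fastforce simp: quadrant_eq)
  then show ?thesis
    using r all_steps_used[OF S two] by (simp add: simpler_problem_def)
qed

theorem relevant_iff: "relevant S \<longleftrightarrow> S \<subseteq> small_steps \<and> two_dimensional S"
  unfolding relevant_def using not_two_dimensional two_dimensional_not_simpler by blast

lemma relevant_reflection: "relevant (prod.swap ` S) \<longleftrightarrow> relevant S"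
  unfolding relevant_iff by (simp only: small_steps_reflection two_dimensional_reflection)

section \<open>Enumeration of the reflection classes\<close>

definition step_list :: "step list" where
  "step_list = [(-1, -1), (-1, 0), (-1, 1), (0, -1), (0, 1), (1, -1), (1, 0), (1, 1)]"

lemma set_step_list: "set step_list = small_steps"
  by (simp add: step_list_def small_steps_eq)

definition decoupled_models :: "step list list" where
  "decoupled_models =
    [[(1, 1), (-1, 0), (0, -1)], [(-1, -1), (1, 0), (0, 1)],
     [(1, 1), (-1, 0), (0, -1), (-1, -1), (1, 0), (0, 1)], [(1, 0), (1, 1), (-1, 0), (-1, -1)],
     [(0, 1), (1, 0), (-1, 0), (-1, -1)], [(0, 1), (1, 0), (-1, 1), (-1, -1)],
     [(0, 1), (1, 1), (0, -1), (-1, 0)], [(0, 1), (1, 0), (1, -1), (-1, 0)],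
     [(0, 1), (1, 0), (1, 1), (-1, -1), (-1, 0)], [(0, 1), (0, -1), (1, 1), (-1, -1), (-1, 0)],
     [(-1, 1), (-1, 0), (1, 0), (-1, -1), (0, 1)], [(1, 1), (0, -1), (1, 0), (-1, 0), (0, 1)],
     [(1, 0), (0, -1), (0, 1), (-1, 1), (1, -1)]]"

definition other_models :: "step list list" where
  "other_models = [(-1, 1), (1, -1), (1, 1)] # map fst certificates"

abbreviation models :: "step list list" where
  "models \<equiv> decoupled_models @ other_models"

text \<open>The characteristic vector is independent of the order of a list, so that equality of
  step sets becomes equality of lists.\<close>

definition membership :: "step list \<Rightarrow> bool list" where
  "membership L = map (\<lambda>s. s \<in> set L) step_list"

lemma membership_eq_iff:
  assumes "set L \<subseteq> small_steps" "set M \<subseteq> small_steps"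
  shows "membership L = membership M \<longleftrightarrow> set L = set M"
  using assms unfolding membership_def map_eq_conv set_step_list by blast

definition reflect :: "step list \<Rightarrow> step list" where "reflect = map prod.swap"

lemma set_reflect: "set (reflect L) = prod.swap ` set L"
  by (simp add: reflect_def)

text \<open>It suffices to compare one member of the first class with both members of the second,
  because reflection is an involution.\<close>

definition distinct_classes :: "step list list \<Rightarrow> bool" where
  "distinct_classes Ls \<longleftrightarrow> sorted_wrt (\<lambda>(a, b) (c, d). a \<noteq> c \<and> a \<noteq> d) (map (\<lambda>L. (membership L,
    membership (reflect L))) Ls)"

definition covered :: "bool list list \<Rightarrow> step list list \<Rightarrow> bool" where
  "covered cs Ls \<longleftrightarrow> list_all (\<lambda>L. two_dimensional (set L) \<longrightarrow> membership L \<in> set cs) Ls"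

text \<open>All 256 subsets of the eight steps are enumerated.\<close>

lemma classification_check:
  "covered (concat (map (\<lambda>L. [membership L, membership (reflect L)]) models))
     (subseqs step_list)"
  by code_simp

lemma models_check:
  "list_all (\<lambda>L. list_all (\<lambda>s. s \<in> set step_list) L \<and> two_dimensional (set L)) models"
  by code_simp

lemma distinct_classes_check: "distinct_classes models"
  by code_simp

lemma lengths: "length decoupled_models = 13" "length models = 79"
  by code_simp+

lemma model_relevant:
  assumes "L \<in> set models"
  shows "set L \<subseteq> small_steps" "relevant (set L)"
  using models_check assms unfolding list_all_iff set_step_list relevant_iff by auto

lemma reflection_class_reflection: "reflection_class (prod.swap ` S) = reflection_class S"
  unfolding reflection_class_def by (auto simp: image_image)

lemma reflection_class_eqD: "reflection_class S = reflection_class T \<Longrightarrow> S = T \<or> S = prod.swap ` T"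
  unfolding reflection_class_def by blast

lemma reflection_class_cases:
  "T \<in> reflection_class S \<Longrightarrow> T = S \<or> T = prod.swap ` S"
  by (auto simp: reflection_class_def)

lemma relevant_eq: "{S. relevant S} = (\<Union>L\<in>set models. reflection_class (set L))"
proof (intro equalityI subsetI)
  fix S assume "S \<in> {S. relevant S}"
  then have S: "S \<subseteq> small_steps" "two_dimensional S" by (simp_all add: relevant_iff)
  then have "S \<in> set ` set (subseqs step_list)"
    by (simp add: subseqs_powset set_step_list)
  then obtain L where L: "L \<in> set (subseqs step_list)" "S = set L" by blast
  then have "membership L \<in> set (concat (map (\<lambda>L. [membership L, membership (reflect L)]) models))"
    using classification_check S unfolding covered_def list_all_iff by blast
  then obtain M where M: "M \<in> set models"
    "membership L = membership M \<or> membership L = membership (reflect M)"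
    by auto
  moreover have "set (reflect M) \<subseteq> small_steps"
  proof -
    have "relevant (prod.swap ` set M)" using model_relevant(2)[OF M(1)] relevant_reflection by
      blast
    then show ?thesis by (simp add: set_reflect relevant_def)
  qed
  ultimately have "S = set M \<or> S = prod.swap ` set M"
    using S L model_relevant[OF M(1)] by (metis membership_eq_iff set_reflect)
  then show "S \<in> (\<Union>L\<in>set models. reflection_class (set L))"
    using M(1) by (auto simp: reflection_class_def)
next
  fix S assume "S \<in> (\<Union>L\<in>set models. reflection_class (set L))"
  then obtain L where "L \<in> set models" "S \<in> reflection_class (set L)" by blast
  then show "S \<in> {S. relevant S}"
    using model_relevant reflection_class_cases relevant_reflection by blast
qed

lemma distinct_reflection_classes:
  "distinct (map (\<lambda>L. reflection_class (set L)) models)"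
proof -
  have "reflection_class (set L) \<noteq> reflection_class (set M)"
    if "L \<in> set models" "M \<in> set models"
      "membership L \<noteq> membership M \<and> membership L \<noteq> membership (reflect M)" for L M
  proof
    assume "reflection_class (set L) = reflection_class (set M)"
    then have "set L = set M \<or> set L = set (reflect M)"
      using reflection_class_eqD by (simp add: set_reflect)
    then show False
      using that unfolding membership_def by auto
  qed
  then have "sorted_wrt (\<noteq>) (map (\<lambda>L. reflection_class (set L)) models)"
    using distinct_classes_check unfolding distinct_classes_def sorted_wrt_map
    by (auto elim: sorted_wrt_mono_rel[rotated])
  moreover have "sorted_wrt (\<noteq>) xs \<Longrightarrow> distinct xs" for xs :: "step set set list"
    by (induction xs) auto
  ultimately show ?thesis by blast
qed

lemma image_reflection_class:
  "reflection_class ` (\<Union>L\<in>A. reflection_class (set L)) = (\<lambda>L. reflection_class (set L)) ` A"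
proof -
  have "reflection_class ` reflection_class S = {reflection_class S}" for S
    by (auto simp: reflection_class_def[of S] reflection_class_reflection)
  then show ?thesis by (simp add: image_UN) blast
qed

lemma nine_and_four:
  "(\<Union>S \<in> {kreweras, reverse_kreweras, double_kreweras, gessel} \<union> nine_models. reflection_class S)
    = (\<Union>L\<in>set decoupled_models. reflection_class (set L))"
proof -
  have "set ` set decoupled_models = {kreweras, reverse_kreweras, double_kreweras, gessel} \<union>
    nine_models"
    unfolding decoupled_models_def nine_models_def kreweras_def reverse_kreweras_def
      double_kreweras_def gessel_def
    by (simp only: list.set image_insert image_empty Un_insert_left Un_empty_left)
  then show ?thesis by (metis (no_types, lifting) SUP_cong UN_simps(10))
qed

lemma decoupled_models_decoupled:
  assumes "L \<in> set decoupled_models"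
  shows "decoupled (unweighted (set L))"
proof -
  have "set L \<in> {kreweras, reverse_kreweras, double_kreweras, gessel} \<union> nine_models"
    using assms unfolding decoupled_models_def nine_models_def kreweras_def reverse_kreweras_def
      double_kreweras_def gessel_def by (elim set_ConsD[elim_format] disjE) auto
  then show ?thesis
    unfolding nine_models_def
    using decoupled_kreweras decoupled_reverse_kreweras decoupled_double_kreweras decoupled_gessel
      decoupled_1 decoupled_2 decoupled_3 decoupled_4 decoupled_5 decoupled_6 decoupled_7
        decoupled_8 decoupled_9
    by (elim UnE insertE) (simp_all only: empty_iff)
qed

lemma other_models_not_decoupled:
  assumes "L \<in> set other_models"
  shows "\<not> decoupled (unweighted (set L))"
  using assms not_decoupled_chebyshev not_decoupled_certified unfolding other_models_def by auto

lemma decoupled_reflection_class: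
  "T \<in> reflection_class S \<Longrightarrow> decoupled (unweighted T) \<longleftrightarrow> decoupled (unweighted S)"
  using reflection_class_cases decoupled_reflection by blast

lemma relevant_decoupled_eq:
  "{S. relevant S \<and> decoupled (unweighted S)} = (\<Union>L\<in>set decoupled_models. reflection_class (set L))"
proof -
  have "{S. relevant S \<and> decoupled (unweighted S)} = {S \<in> {S. relevant S}. decoupled (unweighted
    S)}"
    by simp
  also have "\<dots> = (\<Union>L\<in>set decoupled_models. reflection_class (set L))"
    unfolding relevant_eq
    using decoupled_models_decoupled other_models_not_decoupled decoupled_reflection_class by
      fastforce
  finally show ?thesis .
qed

theorem theorem4p7:
  fixes l :: "'k::field_char_0"
  shows "card (reflection_class ` {S. relevant S}) = 79 \<and>
    card (reflection_class ` {S. relevant S \<and> decoupled (unweighted S)}) = 13 \<and>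
    {S. relevant S \<and> decoupled (unweighted S)} =
      (\<Union>S \<in> {kreweras, reverse_kreweras, double_kreweras, gessel} \<union> nine_models. reflection_class S) \<and>
    decoupled (W1 l) \<and> decoupled W2 \<and> decoupled W3 \<and> decoupled W4"
proof (intro conjI)
  show "card (reflection_class ` {S. relevant S}) = 79"
    using distinct_card[OF distinct_reflection_classes] lengths(2)
    unfolding relevant_eq image_reflection_class by (simp add: image_Un)
  show "card (reflection_class ` {S. relevant S \<and> decoupled (unweighted S)}) = 13"
    using distinct_card[of "map (\<lambda>L. reflection_class (set L)) decoupled_models"]
      distinct_reflection_classes lengths(1)
    unfolding relevant_decoupled_eq image_reflection_class by simp
  show "{S. relevant S \<and> decoupled (unweighted S)} =
      (\<Union>S \<in> {kreweras, reverse_kreweras, double_kreweras, gessel} \<union> nine_models. reflection_class S)"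
    unfolding nine_and_four relevant_decoupled_eq ..
qed (fact decoupled_W1 decoupled_W2 decoupled_W3 decoupled_W4)+

end
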